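(* Let $(M,\omega)$, $J$, $H$, $X$ be as defined in the context, let $0<\gamma<\frac1{48}$, and let $F_t=(J,H_t)=(J,(1-2t)H+t\gamma X)$. For all $t\in[0,1]$, the system $F_t$ has precisely eight fixed points. They are given by four points not depending on $t$, namely $$A=[\sqrt2,\sqrt6,\sqrt6,2\sqrt2,2,\sqrt2,0,0],\quad C=[2,2\sqrt2,\sqrt6,\sqrt6,\sqrt2,0,0,\sqrt2],$$ $$B=[\sqrt2,0,0,\sqrt2,2,2\sqrt2,\sqrt6,\sqrt6],\quad D=[2,\sqrt2,0,0,\sqrt2,\sqrt6,\sqrt6,2\sqrt2],$$ and four points that change with $t$ as follows: $$P_t^{min}=\left[0,u_-(t),\sqrt{2+u_-^2(t)},\sqrt{6+u_-^2(t)},\sqrt6,\sqrt{8-u_-^2(t)},\sqrt{4-u_-^2(t)},\sqrt{2-u_-^2(t)}\right],$$ $$P_t^{max}=\left[0,u_+(t),\sqrt{2+u_+^2(t)},\sqrt{6+u_+^2(t)},\sqrt6,\sqrt{8-u_+^2(t)},\sqrt{4-u_+^2(t)},\sqrt{2-u_+^2(t)}\right],$$ $$Q_t^{min}=\left[\sqrt6,\sqrt{8-v_-^2(t)},\sqrt{4-v_-^2(t)},\sqrt{2-v_-^2(t)},0,v_-(t),\sqrt{2+v_-^2(t)},\sqrt{6+v_-^2(t)}\right],$$ $$Q_t^{max}=\left[\sqrt6,\sqrt{8-v_+^2(t)},\sqrt{4-v_+^2(t)},\sqrt{2-v_+^2(t)},0,v_+(t),\sqrt{2+v_+^2(t)},\sqrt{6+v_+^2(t)}\right].$$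 Here, with $\mathfrak f(\zeta):=(2+\zeta)(6+\zeta)(8-\zeta)(4-\zeta)(2-\zeta)$, the functions $u_\pm:[0,1]\to[-\sqrt2,\sqrt2]$ are the unique smooth solutions $u=u(t)$ of $$(1-2t)\,u\sqrt{\mathfrak f(u^2)}+\gamma t\,\mathfrak f(u^2)+\gamma t\,u^2\,\mathfrak f'(u^2)=0$$ with initial values $u_-(0)=0$ and $u_+(0)=\sqrt2$, and $v_\pm:[0,1]\to[-\sqrt2,\sqrt2]$ are the unique smooth solutions $v=v(t)$ of $$-(1-2t)\,v\sqrt{\mathfrak f(v^2)}+\gamma t\,\mathfrak f(v^2)+\gamma t\,v^2\,\mathfrak f'(v^2)=0$$ with initial values $v_-(0)=-\sqrt2$ and $v_+(0)=0$. For $t=0$ one has $$P_0^{min}=[0,0,\sqrt2,\sqrt6,\sqrt6,2\sqrt2,2,\sqrt2],\quad P_0^{max}=[0,\sqrt2,2,2\sqrt2,\sqrt6,\sqrt6,\sqrt2,0],$$ $$Q_0^{min}=[\sqrt6,\sqrt6,\sqrt2,0,0,\sqrt2,2,2\sqrt2],\quad Q_0^{max}=[\sqrt6,2\sqrt2,2,\sqrt2,0,0,\sqrt2,\sqrt6].$$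
   Context: Construction of $(M,\omega)$. On $\mathbb{C}^8$ with coordinates $z_k=x_k+iy_k$ take the symplectic form $\omega_{st}=-\frac{i}{2}\sum_{k=1}^8 dz_k\wedge d\bar z_k$. Let $W\subset\mathbb{C}^8$ be the set of points satisfying (A) $|z_1|^2+|z_5|^2=6$, (B) $|z_2|^2+|z_5|^2+|z_7|^2=10$, (C) $|z_3|^2+|z_7|^2=6$, (D) $|z_4|^2-|z_5|^2+|z_7|^2=4$, (E) $|z_5|^2-|z_6|^2+|z_7|^2=2$, (F) $|z_5|^2-|z_7|^2+|z_8|^2=4$. The torus $N\simeq\mathbb{T}^6=(\mathbb{R}/2\pi\mathbb{Z})^6$ acts on $\mathbb{C}^8$ by $$(t,z)\mapsto(e^{it_1}z_1,e^{it_2}z_2,e^{it_3}z_3,e^{it_4}z_4,e^{i(t_1+t_2-t_4-t_5+t_6)}z_5,e^{it_5}z_6,e^{i(t_2+t_3+t_4-t_5-t_6)}z_7,e^{it_6}z_8).$$ $W$ is a regular level set of a momentum map of this action, $N$ acts freely on $W$, and $M:=W/N$ with quotient map $\tau:W\to M$ is a $4$-dimensional compact connected manifold carrying the unique symplectic form $\omega$ with $\tau^*\omega=\kappa^*\omega_{st}$, where $\kappa:W\hookrightarrow\mathbb{C}^8$ is the inclusion. Points of $M$ are written $[z]=[z_1,\dots,z_8]$. Functions on $M$ (well defined since $N$-invariant): $J([z])=\frac12|z_1|^2$, $H([z])=\frac12|z_3|^2$, $X([z])=\mathrm{Re}(\overline{z_2}\,\overline{z_3}\,\overline{z_4}\,z_6z_7z_8)$.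 A fixed point of $F_t$ is a point $p\in M$ with $dF_t(p)=0$. *)

theory Defs
  imports "HOL-Analysis.Analysis"
begin

section \<open>Smooth maps\<close>

text \<open>C^k maps on an open set. In finite dimension, it suffices to ask this of all directional
  derivatives of the total derivative.\<close>

primrec C_k_on :: "nat \<Rightarrow> 'a::euclidean_space set \<Rightarrow> ('a \<Rightarrow> 'b::real_normed_vector) \<Rightarrow> bool" where
  "C_k_on 0 U f \<longleftrightarrow> continuous_on U f"
| "C_k_on (Suc k) U f \<longleftrightarrow>
     (\<exists>f'. (\<forall>x\<in>U. (f has_derivative f' x) (at x)) \<and> (\<forall>v. C_k_on k U (\<lambda>x. f' x v)))"

text \<open>Smoothness on an arbitrary subset of a Euclidean space, by local smooth extension.
  For an embedded submanifold, or a compact interval, this is the usual notion.\<close>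

definition smooth_on :: "'a::euclidean_space set \<Rightarrow> ('a \<Rightarrow> 'b::real_normed_vector) \<Rightarrow> bool" where
  "smooth_on S f \<longleftrightarrow>
     (\<forall>x\<in>S. \<exists>U g. open U \<and> x \<in> U \<and> (\<forall>k. C_k_on k U g) \<and> (\<forall>y\<in>U \<inter> S. g y = f y))"


section \<open>The level set and the torus action\<close>

text \<open>In the index type \<open>8\<close> the numeral 8 equals 0, so that \<open>1, \<dots>, 8\<close> are its eight
  distinct elements; likewise for \<open>6\<close>.\<close>

definition W :: "(complex ^ 8) set" where
  "W = {z.
     (cmod (z $ 1))\<^sup>2 + (cmod (z $ 5))\<^sup>2 = 6 \<and>
     (cmod (z $ 2))\<^sup>2 + (cmod (z $ 5))\<^sup>2 + (cmod (z $ 7))\<^sup>2 = 10 \<and>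
     (cmod (z $ 3))\<^sup>2 + (cmod (z $ 7))\<^sup>2 = 6 \<and>
     (cmod (z $ 4))\<^sup>2 - (cmod (z $ 5))\<^sup>2 + (cmod (z $ 7))\<^sup>2 = 4 \<and>
     (cmod (z $ 5))\<^sup>2 - (cmod (z $ 6))\<^sup>2 + (cmod (z $ 7))\<^sup>2 = 2 \<and>
     (cmod (z $ 5))\<^sup>2 - (cmod (z $ 7))\<^sup>2 + (cmod (z $ 8))\<^sup>2 = 4}"

text \<open>The character of \<open>N\<close> by which it acts on each coordinate; the torus
  \<open>(\<real> / 2\<pi>\<int>)^6\<close> acts through its cover \<open>\<real>^6\<close>, which has the same orbits.\<close>

definition weight :: "real ^ 6 \<Rightarrow> real ^ 8" where
  "weight t = vector
     [t $ 1, t $ 2, t $ 3, t $ 4,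
      t $ 1 + t $ 2 - t $ 4 - t $ 5 + t $ 6,
      t $ 5,
      t $ 2 + t $ 3 + t $ 4 - t $ 5 - t $ 6,
      t $ 6]"

definition act :: "real ^ 6 \<Rightarrow> complex ^ 8 \<Rightarrow> complex ^ 8" where
  "act t z = (\<chi> k. cis (weight t $ k) * z $ k)"

definition same_orbit :: "complex ^ 8 \<Rightarrow> complex ^ 8 \<Rightarrow> bool" where
  "same_orbit z w \<longleftrightarrow> z \<in> W \<and> w \<in> W \<and> (\<exists>t. w = act t z)"

lemma vector_8:
  fixes a :: "'a::zero"
  shows "(vector [a, b, c, d, e, f, g, h] :: 'a ^ 8) $ 1 = a"
    and "(vector [a, b, c, d, e, f, g, h] :: 'a ^ 8) $ 2 = b"
    and "(vector [a, b, c, d, e, f, g, h] :: 'a ^ 8) $ 3 = c"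
    and "(vector [a, b, c, d, e, f, g, h] :: 'a ^ 8) $ 4 = d"
    and "(vector [a, b, c, d, e, f, g, h] :: 'a ^ 8) $ 5 = e"
    and "(vector [a, b, c, d, e, f, g, h] :: 'a ^ 8) $ 6 = f"
    and "(vector [a, b, c, d, e, f, g, h] :: 'a ^ 8) $ 7 = g"
    and "(vector [a, b, c, d, e, f, g, h] :: 'a ^ 8) $ 8 = h"
  unfolding vector_def by simp_all

lemma forall_8: "(\<forall>k::8. P k) \<longleftrightarrow> P 1 \<and> P 2 \<and> P 3 \<and> P 4 \<and> P 5 \<and> P 6 \<and> P 7 \<and> P 8"
proof -
  have *: "k = 1 \<or> k = 2 \<or> k = 3 \<or> k = 4 \<or> k = 5 \<or> k = 6 \<or> k = 7 \<or> k = 8" for k :: 8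
  proof (induct k)
    case (of_int z)
    then have "0 \<le> z" "z < 8" by simp_all
    then have "z = 0 \<or> z = 1 \<or> z = 2 \<or> z = 3 \<or> z = 4 \<or> z = 5 \<or> z = 6 \<or> z = 7" by arith
    then show ?case by (elim disjE) simp_all
  qed
  show ?thesis (is "?L \<longleftrightarrow> ?R")
  proof
    assume ?L then show ?R by (intro conjI; rule spec)
  next
    assume r: ?R
    show ?L
    proof
      fix k show "P k"
        using *[of k] r by (elim disjE; simp only:)
    qed
  qed
qed

lemma act_component: "cmod (act t z $ k) = cmod (z $ k)"
  by (simp add: act_def norm_mult)

lemma weight_linear:
  "weight 0 = 0" "weight (- t) = - weight t" "weight (s + t) = weight s + weight t"
  by (simp_all add: vec_eq_iff forall_8 weight_def vector_8)

lemma act_group: "act 0 z = z" "act s (act t z) = act (s + t) z"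
  by (simp_all add: act_def weight_linear vec_eq_iff mult.assoc flip: cis_mult)

lemma same_orbit_part_equivp: "part_equivp same_orbit"
proof (rule part_equivpI)
  let ?z = "vector [sqrt 2, sqrt 6, sqrt 6, 2 * sqrt 2, 2, sqrt 2, 0, 0] :: complex ^ 8"
  have "?z \<in> W"
    by (simp add: W_def vector_8 norm_mult power_mult_distrib)
  then have "same_orbit ?z ?z"
    unfolding same_orbit_def by (metis act_group(1))
  then show "\<exists>z. same_orbit z z" ..
  show "symp same_orbit"
  proof (rule sympI)
    fix z w assume "same_orbit z w"
    then obtain t where t: "z \<in> W" "w \<in> W" "w = act t z"
      by (auto simp: same_orbit_def)
    then have "z = act (- t) w"
      by (simp add: act_group)
    with t show "same_orbit w z"
      unfolding same_orbit_def by blast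
  qed
  show "transp same_orbit"
    by (rule transpI) (auto simp: same_orbit_def act_group)
qed


section \<open>The quotient manifold\<close>

quotient_type M = "complex ^ 8" / partial: same_orbit
  morphisms orbit_of_M proj
  by (rule same_orbit_part_equivp)

text \<open>On \<open>W\<close>, \<^const>\<open>proj\<close> is the quotient map \<open>\<tau>\<close>; its values outside \<open>W\<close> are irrelevant.
  All points named in the theorem have representatives with real coordinates.\<close>

definition pt :: "real list \<Rightarrow> M" where
  "pt xs = proj (vector (map complex_of_real xs))"

lift_definition J :: "M \<Rightarrow> real" is "\<lambda>z. (cmod (z $ 1))\<^sup>2 / 2"
  by (auto simp: same_orbit_def act_component)

lift_definition H :: "M \<Rightarrow> real" is "\<lambda>z. (cmod (z $ 3))\<^sup>2 / 2"
  by (auto simp: same_orbit_def act_component)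

lift_definition X :: "M \<Rightarrow> real" is
  "\<lambda>z. Re (cnj (z $ 2) * cnj (z $ 3) * cnj (z $ 4) * z $ 6 * z $ 7 * z $ 8)"
proof -
  fix z w assume "same_orbit z w"
  then obtain t where w: "w = act t z"
    by (auto simp: same_orbit_def)
  let ?c = "\<lambda>k. cis (weight t $ k)"
  have "cnj (w $ 2) * cnj (w $ 3) * cnj (w $ 4) * w $ 6 * w $ 7 * w $ 8 =
    (cnj (?c 2) * cnj (?c 3) * cnj (?c 4) * ?c 6 * ?c 7 * ?c 8) *
    (cnj (z $ 2) * cnj (z $ 3) * cnj (z $ 4) * z $ 6 * z $ 7 * z $ 8)"
    by (simp add: w act_def)
  also have "cnj (?c 2) * cnj (?c 3) * cnj (?c 4) * ?c 6 * ?c 7 * ?c 8 =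
      cis (- weight t $ 2 - weight t $ 3 - weight t $ 4 + weight t $ 6 + weight t $ 7 + weight t $ 8)"
    by (simp only: cis_cnj cis_mult diff_conv_add_uminus)
  also have "- weight t $ 2 - weight t $ 3 - weight t $ 4 + weight t $ 6 + weight t $ 7 + weight t $ 8 = 0"
    unfolding weight_def vector_8 by simp
  also have "cis 0 = 1"
    by simp
  finally show "Re (cnj (z $ 2) * cnj (z $ 3) * cnj (z $ 4) * z $ 6 * z $ 7 * z $ 8) =
      Re (cnj (w $ 2) * cnj (w $ 3) * cnj (w $ 4) * w $ 6 * w $ 7 * w $ 8)"
    by simp
qed

definition F :: "real \<Rightarrow> real \<Rightarrow> M \<Rightarrow> real \<times> real" where
  "F \<gamma> t p = (J p, (1 - 2 * t) * H p + t * \<gamma> * X p)"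

text \<open>The quotient smooth structure, the one for which \<open>\<tau>\<close> is a submersion: a function on \<open>M\<close>
  is smooth iff its pullback to \<open>W\<close> is.\<close>

definition smooth_functions :: "(M \<Rightarrow> real) set" where
  "smooth_functions = {f. smooth_on W (\<lambda>z. f (proj z))}"

text \<open>Tangent vectors as derivations of the algebra of smooth functions. The last condition only
  normalises the values of a derivation outside of its domain.\<close>

definition tangent_space :: "M \<Rightarrow> ((M \<Rightarrow> real) \<Rightarrow> real) set" where
  "tangent_space p = {D.
     (\<forall>f\<in>smooth_functions. \<forall>g\<in>smooth_functions. D (\<lambda>q. f q + g q) = D f + D g) \<and>
     (\<forall>c. \<forall>f\<in>smooth_functions. D (\<lambda>q. c * f q) = c * D f) \<and>
     (\<forall>f\<in>smooth_functions. \<forall>g\<in>smooth_functions. D (\<lambda>q. f q * g q) = f p * D g + g p * D f) \<and>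
     (\<forall>f. f \<notin> smooth_functions \<longrightarrow> D f = 0)}"

text \<open>The differential at \<open>p\<close> of a smooth map into the plane, as a map from the tangent space
  at \<open>p\<close> to the plane.\<close>

definition differential ::
    "(M \<Rightarrow> real \<times> real) \<Rightarrow> M \<Rightarrow> ((M \<Rightarrow> real) \<Rightarrow> real) \<Rightarrow> real \<times> real" where
  "differential \<Phi> p D = (D (\<lambda>q. fst (\<Phi> q)), D (\<lambda>q. snd (\<Phi> q)))"

definition fixed_point :: "(M \<Rightarrow> real \<times> real) \<Rightarrow> M \<Rightarrow> bool" where
  "fixed_point \<Phi> p \<longleftrightarrow> (\<forall>D\<in>tangent_space p. differential \<Phi> p D = (0, 0))"


section \<open>The moving fixed points\<close>

definition ff :: "real \<Rightarrow> real" where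
  "ff \<zeta> = (2 + \<zeta>) * (6 + \<zeta>) * (8 - \<zeta>) * (4 - \<zeta>) * (2 - \<zeta>)"

text \<open>Smooth solutions on \<open>[0,1]\<close> with values in \<open>[-\<surd>2, \<surd>2]\<close>; \<open>\<rightarrow>\<^sub>E\<close> fixes the values
  outside \<open>[0,1]\<close>, so that equality of solutions is equality on \<open>[0,1]\<close>.\<close>

definition u_solution :: "real \<Rightarrow> (real \<Rightarrow> real) \<Rightarrow> bool" where
  "u_solution \<gamma> u \<longleftrightarrow>
     u \<in> {0..1} \<rightarrow>\<^sub>E {- sqrt 2..sqrt 2} \<and> smooth_on {0..1} u \<and>
     (\<forall>t\<in>{0..1}. (1 - 2 * t) * u t * sqrt (ff ((u t)\<^sup>2)) + \<gamma> * t * ff ((u t)\<^sup>2)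
        + \<gamma> * t * (u t)\<^sup>2 * deriv ff ((u t)\<^sup>2) = 0)"

definition v_solution :: "real \<Rightarrow> (real \<Rightarrow> real) \<Rightarrow> bool" where
  "v_solution \<gamma> v \<longleftrightarrow>
     v \<in> {0..1} \<rightarrow>\<^sub>E {- sqrt 2..sqrt 2} \<and> smooth_on {0..1} v \<and>
     (\<forall>t\<in>{0..1}. - (1 - 2 * t) * v t * sqrt (ff ((v t)\<^sup>2)) + \<gamma> * t * ff ((v t)\<^sup>2)
        + \<gamma> * t * (v t)\<^sup>2 * deriv ff ((v t)\<^sup>2) = 0)"

definition P_pt :: "real \<Rightarrow> M" where
  "P_pt u = pt [0, u, sqrt (2 + u\<^sup>2), sqrt (6 + u\<^sup>2), sqrt 6,
                sqrt (8 - u\<^sup>2), sqrt (4 - u\<^sup>2), sqrt (2 - u\<^sup>2)]"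

definition Q_pt :: "real \<Rightarrow> M" where
  "Q_pt v = pt [sqrt 6, sqrt (8 - v\<^sup>2), sqrt (4 - v\<^sup>2), sqrt (2 - v\<^sup>2), 0,
                v, sqrt (2 + v\<^sup>2), sqrt (6 + v\<^sup>2)]"

end

theory Submission
  imports Defs
begin

text \<open>
  Write \<open>a\<^sub>k\<close> for \<open>|z\<^sub>k|\<^sup>2\<close>. On \<open>W\<close> these functions are affine in \<open>a\<^sub>5\<close> and \<open>a\<^sub>7\<close>, hence in \<open>J\<close> and \<open>H\<close>, and
  \<open>(a\<^sub>5, a\<^sub>7)\<close> maps \<open>M\<close> onto an octagon whose edge number \<open>k\<close> is the locus \<open>z\<^sub>k = 0\<close>. A fixed point of
  \<open>F\<^sub>t\<close> is in particular critical for \<open>J\<close>. Away from the edges 1 and 5, the spheres \<open>J = 0\<close> and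
  \<open>J = 3\<close>, and away from the vertices of the octagon, the value of \<open>J\<close> can be moved to first order along a curve
  in \<open>W\<close> (\<open>fixed_point_off_spheres\<close>). Of the four vertices off these spheres, each is a single point of \<open>M\<close>, and
  they are \<open>A\<close>, \<open>B\<close>, \<open>C\<close>, \<open>D\<close>. They are fixed for all coefficients of \<open>H\<close> and \<open>X\<close>, because \<open>J\<close>, \<open>H\<close> and \<open>X\<close> are
  affine combinations of functions that, up to nonvanishing factors, are quadratic in functions that vanish there.

  On the sphere \<open>J = 0\<close>, where \<open>J\<close> is critical, it remains to find the critical points of
  \<open>\<alpha> H + \<beta> X\<close> with \<open>\<alpha> = 1 - 2t\<close> and \<open>\<beta> = \<gamma> t\<close>. A point is determined by its second coordinate \<open>r e^(i\<phi>)\<close>,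
  and there \<open>H = (2 + r\<^sup>2) / 2\<close> and \<open>X = r cos \<phi> sqrt (ff (r\<^sup>2))\<close>. The derivative in \<open>\<phi>\<close> forces
  a real second coordinate \<open>u\<close>, and the derivative in \<open>r\<close> is the equation for \<open>u\<close> in the theorem
  (\<open>fixed_points_J_0\<close>). An involution of \<open>M\<close> that fixes \<open>X\<close> and reverses \<open>H\<close> carries this to the sphere
  \<open>J = 3\<close> and explains the sign in the equation for \<open>v\<close> (\<open>fixed_point_flip\<close>).

  The equation for \<open>u\<close> is solved with \<open>u\<^sup>2 = 1 \<plusminus> cos x\<close>. The product \<open>u\<^sup>2 ff (u\<^sup>2)\<close> is an even polynomial in
  \<open>u\<^sup>2 - 1\<close>, so for each \<open>t > 0\<close> the equation has one solution \<open>x\<close> in \<open>(0, \<pi>)\<close>, which gives one positive and one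
  negative \<open>u\<close>. Existence, uniqueness and smoothness of \<open>x\<close> all rest on the positivity of one
  Wronskian (\<open>wronskian_pos\<close>). Since the two roots stay apart, a continuous solution is determined by its
  initial value (\<open>u_solution_unique\<close>).

  Tangent vectors being derivations of global smooth functions, two tools replace local coordinates. Curves in
  \<open>W\<close> give derivations (\<open>curve_derivation_tangent\<close>), which shows that points are not fixed. The product rule applied to
  torus-invariant monomials shows that all derivations of certain functions vanish
  (\<open>cderiv_abs_sq_vanishes\<close>, \<open>cderiv_Ymon_edge\<close>), which shows that points are fixed.
\<close>

section \<open>Calculus of C^k maps\<close>

lemma C_k_on_SucI:
  assumes "\<And>x. x \<in> U \<Longrightarrow> (f has_derivative f' x) (at x)"
    and "\<And>v. C_k_on k U (\<lambda>x. f' x v)"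
  shows "C_k_on (Suc k) U f"
  unfolding C_k_on.simps using assms by (intro exI[of _ f'] conjI ballI allI)

lemma C_k_on_SucE:
  assumes "C_k_on (Suc k) U f"
  obtains f' where "\<And>x. x \<in> U \<Longrightarrow> (f has_derivative f' x) (at x)"
    and "\<And>v. C_k_on k U (\<lambda>x. f' x v)"
  using assms unfolding C_k_on.simps by blast

lemma C_k_on_SucD: "C_k_on (Suc k) U f \<Longrightarrow> C_k_on k U f"
proof (induction k arbitrary: f)
  case 0
  then obtain f' where "\<And>x. x \<in> U \<Longrightarrow> (f has_derivative f' x) (at x)"
    by (rule C_k_on_SucE) (rule that)
  then show ?case
    unfolding C_k_on.simps
    by (intro continuous_at_imp_continuous_on ballI) (rule has_derivative_continuous)
next
  case (Suc k)
  from Suc.prems obtain f' where "\<And>x. x \<in> U \<Longrightarrow> (f has_derivative f' x) (at x)"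
    "\<And>v. C_k_on (Suc k) U (\<lambda>x. f' x v)"
    by (rule C_k_on_SucE) (rule that)
  then show ?case
    by (intro C_k_on_SucI[of U f f']) (auto intro: Suc.IH simp del: C_k_on.simps)
qed

lemma C_k_on_cong:
  assumes "C_k_on k U f" "open U" "\<And>x. x \<in> U \<Longrightarrow> f x = g x"
  shows "C_k_on k U g"
proof (cases k)
  case 0
  with assms show ?thesis using continuous_on_cong by force
next
  case (Suc m)
  from assms(1) obtain f' where f': "\<And>x. x \<in> U \<Longrightarrow> (f has_derivative f' x) (at x)"
    "\<And>v. C_k_on m U (\<lambda>x. f' x v)"
    unfolding Suc by (rule C_k_on_SucE) (rule that)
  have "(g has_derivative f' x) (at x)" if "x \<in> U" for x
    using has_derivative_transform_within_open[OF f'(1) assms(2)] that assms(3) by blast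
  with f'(2) show ?thesis unfolding Suc by (intro C_k_on_SucI[of U g f'])
qed

lemma C_k_on_subset: "C_k_on k U f \<Longrightarrow> V \<subseteq> U \<Longrightarrow> C_k_on k V f"
proof (induction k arbitrary: f)
  case 0
  then show ?case using continuous_on_subset by auto
next
  case (Suc k)
  obtain f' where f': "\<And>x. x \<in> U \<Longrightarrow> (f has_derivative f' x) (at x)"
    "\<And>v. C_k_on k U (\<lambda>x. f' x v)" using Suc.prems(1) by (rule C_k_on_SucE) (rule that)
  show ?case
    by (rule C_k_on_SucI[of V f f'])
      (rule f'(1), use Suc.prems in blast, rule Suc.IH[OF f'(2) Suc.prems(2)])
qed

lemma C_k_on_const: "C_k_on k U (\<lambda>x. c)"
proof (induction k arbitrary: c)
  case (Suc k)
  show ?case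
    by (rule C_k_on_SucI[where f' = "\<lambda>x v. 0"]) (rule has_derivative_const, rule Suc)
qed simp

lemma C_k_on_linear:
  assumes "bounded_linear L"
  shows "C_k_on k U L"
proof (cases k)
  case 0
  then show ?thesis using assms by (simp add: linear_continuous_on)
next
  case (Suc m)
  show ?thesis unfolding Suc
    by (rule C_k_on_SucI[where f' = "\<lambda>x. L"])
      (rule bounded_linear_imp_has_derivative[OF assms], rule C_k_on_const)
qed

lemma C_k_on_add:
  assumes "C_k_on k U f" "C_k_on k U g"
  shows "C_k_on k U (\<lambda>x. f x + g x)"
  using assms
proof (induction k arbitrary: f g)
  case (Suc k)
  obtain f' where f': "\<And>x. x \<in> U \<Longrightarrow> (f has_derivative f' x) (at x)"
    "\<And>v. C_k_on k U (\<lambda>x. f' x v)" using Suc.prems(1) by (rule C_k_on_SucE) (rule that)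
  obtain g' where g': "\<And>x. x \<in> U \<Longrightarrow> (g has_derivative g' x) (at x)"
    "\<And>v. C_k_on k U (\<lambda>x. g' x v)" using Suc.prems(2) by (rule C_k_on_SucE) (rule that)
  show ?case
    by (rule C_k_on_SucI[where f' = "\<lambda>x v. f' x v + g' x v"])
      (intro has_derivative_add f' g', assumption+, intro Suc.IH f' g')
qed (auto intro: continuous_on_add)

lemma C_k_on_mult:
  fixes f g :: "'a::euclidean_space \<Rightarrow> 'b::real_normed_algebra"
  assumes "C_k_on k U f" "C_k_on k U g"
  shows "C_k_on k U (\<lambda>x. f x * g x)"
  using assms
proof (induction k arbitrary: f g)
  case (Suc k)
  obtain f' where f': "\<And>x. x \<in> U \<Longrightarrow> (f has_derivative f' x) (at x)"
    "\<And>v. C_k_on k U (\<lambda>x. f' x v)" using Suc.prems(1) by (rule C_k_on_SucE) (rule that)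
  obtain g' where g': "\<And>x. x \<in> U \<Longrightarrow> (g has_derivative g' x) (at x)"
    "\<And>v. C_k_on k U (\<lambda>x. g' x v)" using Suc.prems(2) by (rule C_k_on_SucE) (rule that)
  show ?case
    by (rule C_k_on_SucI[where f' = "\<lambda>x v. f x * g' x v + f' x v * g x"])
      (intro has_derivative_mult f' g', assumption+,
       intro C_k_on_add Suc.IH f' g' Suc.prems[THEN C_k_on_SucD])
qed (auto intro: continuous_on_mult)

lemma C_k_on_bounded_linear:
  assumes "bounded_linear L" "C_k_on k U f"
  shows "C_k_on k U (\<lambda>x. L (f x))"
  using assms(2)
proof (induction k arbitrary: f)
  case 0
  then show ?case by (simp add: bounded_linear.continuous_on[OF assms(1)])
next
  case (Suc k)
  obtain f' where f': "\<And>x. x \<in> U \<Longrightarrow> (f has_derivative f' x) (at x)"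
    "\<And>v. C_k_on k U (\<lambda>x. f' x v)" using Suc.prems(1) by (rule C_k_on_SucE) (rule that)
  show ?case
    by (rule C_k_on_SucI[where f' = "\<lambda>x v. L (f' x v)"])
      (intro bounded_linear.has_derivative[OF assms(1)] f', assumption, intro Suc.IH f')
qed

text \<open>Needed to transport smooth functions on \<open>M\<close> along the involution \<open>flip_M\<close>, which permutes
  the coordinates of \<open>\<complex>^8\<close>.\<close>

lemma C_k_on_precomp_linear:
  assumes "bounded_linear L" "C_k_on k U f"
  shows "C_k_on k (L -` U) (\<lambda>x. f (L x))"
  using assms(2)
proof (induction k arbitrary: f)
  case 0
  have "continuous_on (L -` U) L"
    using assms(1) by (rule linear_continuous_on)
  with 0 show ?case
    using continuous_on_compose2[of U f "L -` U" L] by simp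
next
  case (Suc k)
  obtain f' where f': "\<And>x. x \<in> U \<Longrightarrow> (f has_derivative f' x) (at x)"
    "\<And>v. C_k_on k U (\<lambda>x. f' x v)" using Suc.prems(1) by (rule C_k_on_SucE) (rule that)
  have "((\<lambda>x. f (L x)) has_derivative (\<lambda>v. f' (L x) (L v))) (at x)" if "x \<in> L -` U" for x
    using that has_derivative_compose[OF bounded_linear_imp_has_derivative[OF assms(1)] f'(1)]
    by simp
  then show ?case
    by (rule C_k_on_SucI[where f' = "\<lambda>x v. f' (L x) (L v)"]) (assumption, intro Suc.IH f')
qed

text \<open>In the induction the chain rule turns a directional derivative of \<open>h \<circ> f\<close> into a product of a
  directional derivative of \<open>f\<close> with \<open>h' \<circ> f\<close>. The derivative of \<open>h\<close> is therefore evaluated in the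
  fixed direction 1, so that the induction hypothesis applies to it.\<close>

lemma C_k_on_compose_real:
  fixes f :: "'a::euclidean_space \<Rightarrow> real" and h :: "real \<Rightarrow> real"
  assumes "C_k_on k V h" "C_k_on k U f" "f ` U \<subseteq> V"
  shows "C_k_on k U (\<lambda>x. h (f x))"
  using assms
proof (induction k arbitrary: h f)
  case 0
  then show ?case using continuous_on_compose2[of V h U f] by simp
next
  case (Suc k)
  obtain f' where f': "\<And>x. x \<in> U \<Longrightarrow> (f has_derivative f' x) (at x)"
    "\<And>v. C_k_on k U (\<lambda>x. f' x v)" using Suc.prems(2) by (rule C_k_on_SucE) (rule that)
  obtain h' where h': "\<And>x. x \<in> V \<Longrightarrow> (h has_derivative h' x) (at x)"
    "\<And>v. C_k_on k V (\<lambda>x. h' x v)" using Suc.prems(1) by (rule C_k_on_SucE) (rule that)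
  have "((\<lambda>x. h (f x)) has_derivative (\<lambda>v. f' x v * h' (f x) 1)) (at x)" if "x \<in> U" for x
  proof -
    have hd: "(h has_derivative h' (f x)) (at (f x))"
      using h'(1) Suc.prems(3) that by blast
    have "h' (f x) y = y * h' (f x) 1" for y
      using linear_scale[OF has_derivative_linear[OF hd], of y 1] by simp
    then have "(\<lambda>v. f' x v * h' (f x) 1) = (\<lambda>v. h' (f x) (f' x v))"
      by (intro ext) (rule sym)
    then show ?thesis
      using has_derivative_compose[OF f'(1)[OF that] hd] by (simp only:)
  qed
  moreover have "C_k_on k U (\<lambda>x. f' x v * h' (f x) 1)" for v
    using f'(2) Suc.IH[OF h'(2) C_k_on_SucD[OF Suc.prems(2)] Suc.prems(3)]
    by (rule C_k_on_mult)
  ultimately show ?case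
    by (rule C_k_on_SucI[where f' = "\<lambda>x v. f' x v * h' (f x) 1"])
qed

lemma C_k_on_Suc_real:
  fixes f :: "real \<Rightarrow> real"
  assumes "\<And>x. x \<in> U \<Longrightarrow> (f has_field_derivative f' x) (at x)" "C_k_on k U f'"
  shows "C_k_on (Suc k) U f"
  by (rule C_k_on_SucI[where f' = "\<lambda>x v. f' x * v"])
    (erule assms(1)[unfolded has_field_derivative_def], intro C_k_on_mult C_k_on_const assms(2))

lemma C_k_on_sin_cos:
  "C_k_on k U (sin :: real \<Rightarrow> real) \<and> C_k_on k U (cos :: real \<Rightarrow> real)"
proof (induction k)
  case (Suc k)
  then have "C_k_on k U (\<lambda>x::real. - sin x)"
    by (intro C_k_on_bounded_linear[of uminus]) (auto intro: bounded_linear_minus bounded_linear_ident)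
  with Suc show ?case
    using C_k_on_Suc_real[OF DERIV_sin] C_k_on_Suc_real[OF DERIV_cos] by blast
qed (auto intro!: continuous_intros)

text \<open>The powers of \<open>x\<close> are closed under differentiation up to constants; square roots and inverses are
  two members of this family.\<close>

lemma C_k_on_powr: "C_k_on k {0<..} (\<lambda>x::real. x powr a)"
proof (induction k arbitrary: a)
  case (Suc k)
  have "((\<lambda>x. x powr a) has_field_derivative a * x powr (a - 1)) (at x)" if "x \<in> {0<..}" for x
    using that by (simp add: has_real_derivative_powr)
  then show ?case
    by (rule C_k_on_Suc_real) (assumption, intro C_k_on_mult C_k_on_const Suc)
qed (auto intro!: continuous_intros)

lemma C_k_on_sqrt: "C_k_on k {0<..} sqrt"
  by (rule C_k_on_cong[OF C_k_on_powr[of k "1/2"]]) (auto simp: powr_half_sqrt)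

lemma C_k_on_inverse: "C_k_on k {0<..} (inverse :: real \<Rightarrow> real)"
  by (rule C_k_on_cong[OF C_k_on_powr[of k "-1"]]) (auto simp: powr_minus)

text \<open>Bootstrapping: if \<open>g\<close> is C^k, so is \<open>g' = V \<circ> g\<close>, and then \<open>g\<close> is C^(k+1). This gives the smoothness
  of an inverse function \<open>g\<close> of \<open>T\<close>, with \<open>V = 1 / T'\<close>.\<close>

lemma smooth_autonomous_ode:
  fixes g V :: "real \<Rightarrow> real"
  assumes V: "\<And>k. C_k_on k B V" and "g ` U \<subseteq> B"
    and g: "\<And>x. x \<in> U \<Longrightarrow> (g has_field_derivative V (g x)) (at x)"
  shows "C_k_on k U g"
proof (induction k)
  case 0
  show ?case using g by (auto intro!: continuous_at_imp_continuous_on DERIV_isCont)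
next
  case (Suc k)
  show ?case
    by (rule C_k_on_Suc_real[OF g C_k_on_compose_real[OF V Suc assms(2)]])
qed

lemma smooth_on_continuous:
  assumes "smooth_on S f" shows "continuous_on S f"
  unfolding continuous_on_eq_continuous_within
proof
  fix x assume "x \<in> S"
  then obtain U g where U: "open U" "x \<in> U" "\<forall>k. C_k_on k U g" "\<forall>y\<in>U \<inter> S. g y = f y"
    using assms unfolding smooth_on_def by blast
  from U(3) have "C_k_on 0 U g" by blast
  then have "isCont g x"
    using U(1,2) by (simp add: continuous_on_eq_continuous_at)
  then have "continuous (at x within S) g"
    by (rule continuous_at_imp_continuous_at_within)
  then have "(g \<longlongrightarrow> f x) (at x within S)"
    using U \<open>x \<in> S\<close> by (simp add: continuous_within)
  moreover have "\<forall>\<^sub>F y in at x within S. g y = f y"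
    unfolding eventually_at_topological by (rule exI[of _ U]) (use U in simp)
  ultimately show "continuous (at x within S) f"
    unfolding continuous_within by (rule Lim_transform_eventually)
qed

section \<open>The quotient map\<close>

lemma same_orbit_refl: "z \<in> W \<Longrightarrow> same_orbit z z"
  unfolding same_orbit_def by (metis act_group(1))

lemma proj_exhaust: obtains z where "z \<in> W" "p = proj z"
proof -
  have "\<exists>z. z \<in> W \<and> p = proj z"
    by (rule M.abs_induct[of _ p]) (auto simp: same_orbit_def)
  with that show thesis by blast
qed

lemma act_in_W: "z \<in> W \<Longrightarrow> act t z \<in> W"
  by (simp add: W_def act_component)

lemma proj_eq_iff:
  assumes "z \<in> W" "w \<in> W"
  shows "proj z = proj w \<longleftrightarrow> (\<exists>t. w = act t z)"
proof -
  have "proj z = proj w \<longleftrightarrow> same_orbit z w"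
    using Quotient3_rel[OF Quotient3_M, of z w] assms by (simp add: same_orbit_refl)
  with assms show ?thesis by (simp add: same_orbit_def)
qed

lemma proj_act: "z \<in> W \<Longrightarrow> proj (act t z) = proj z"
  using proj_eq_iff[of z "act t z"] act_in_W by auto

section \<open>Tangent vectors of curves\<close>

lemma vec_has_vector_derivative:
  fixes c :: "real \<Rightarrow> 'a::euclidean_space ^ 'n"
  assumes "\<And>k. ((\<lambda>s. c s $ k) has_vector_derivative c' $ k) (at x)"
  shows "(c has_vector_derivative c') (at x)"
  unfolding has_vector_derivative_def
proof (subst has_derivative_componentwise_within, rule ballI)
  fix b :: "'a ^ 'n" assume "b \<in> Basis"
  then obtain k d where b: "b = axis k d" by (auto simp: Basis_vec_def)
  have "((\<lambda>s. c s $ k \<bullet> d) has_derivative (\<lambda>s. (s *\<^sub>R c' $ k) \<bullet> d)) (at x)"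
    using assms[of k] unfolding has_vector_derivative_def by (rule has_derivative_inner_left)
  then show "((\<lambda>s. c s \<bullet> b) has_derivative (\<lambda>s. (s *\<^sub>R c') \<bullet> b)) (at x)"
    by (simp add: b inner_axis)
qed

text \<open>A curve in \<open>W\<close> that is differentiable at 0 yields a tangent vector of \<open>M\<close>. Such derivations
  show that a point is not a fixed point. The value 0 off the smooth functions is the one that
  \<^const>\<open>tangent_space\<close> prescribes.\<close>

definition curve_derivation :: "(real \<Rightarrow> complex ^ 8) \<Rightarrow> (M \<Rightarrow> real) \<Rightarrow> real" where
  "curve_derivation c f =
     (if f \<in> smooth_functions then deriv (\<lambda>s. f (proj (c s))) 0 else 0)"

lemma smooth_functionsD:
  assumes "f \<in> smooth_functions" "z \<in> W"
  obtains U g where "open U" "z \<in> U" "\<And>k. C_k_on k U g" "\<And>y. y \<in> U \<inter> W \<Longrightarrow> g y = f (proj y)"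
  using assms unfolding smooth_functions_def smooth_on_def by blast

lemma smooth_functions_binary:
  assumes op: "\<And>k U f g. C_k_on k U f \<Longrightarrow> C_k_on k U g \<Longrightarrow> C_k_on k U (\<lambda>z :: complex ^ 8. op (f z) (g z) :: real)"
    and fg: "f \<in> smooth_functions" "g \<in> smooth_functions"
  shows "(\<lambda>p. op (f p) (g p)) \<in> smooth_functions"
  unfolding smooth_functions_def smooth_on_def
proof (intro CollectI ballI)
  fix z assume "z \<in> W"
  obtain U f' where U: "open U" "z \<in> U" "\<And>k. C_k_on k U f'" "\<And>y. y \<in> U \<inter> W \<Longrightarrow> f' y = f (proj y)"
    using smooth_functionsD[OF fg(1) \<open>z \<in> W\<close>] by metis
  obtain V g' where V: "open V" "z \<in> V" "\<And>k. C_k_on k V g'" "\<And>y. y \<in> V \<inter> W \<Longrightarrow> g' y = g (proj y)"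
    using smooth_functionsD[OF fg(2) \<open>z \<in> W\<close>] by metis
  have "C_k_on k (U \<inter> V) (\<lambda>z. op (f' z) (g' z))" for k
    by (rule op; rule C_k_on_subset, (rule U V), blast)
  with U V show "\<exists>U h. open U \<and> z \<in> U \<and> (\<forall>k. C_k_on k U h) \<and>
      (\<forall>y\<in>U \<inter> W. h y = op (f (proj y)) (g (proj y)))"
    by (intro exI[of _ "U \<inter> V"] exI[of _ "\<lambda>z. op (f' z) (g' z)"]) auto
qed

lemma smooth_functions_add:
  "f \<in> smooth_functions \<Longrightarrow> g \<in> smooth_functions \<Longrightarrow> (\<lambda>p. f p + g p) \<in> smooth_functions"
  by (rule smooth_functions_binary[of "(+)" f g], rule C_k_on_add)

lemma smooth_functions_mult:
  "f \<in> smooth_functions \<Longrightarrow> g \<in> smooth_functions \<Longrightarrow> (\<lambda>p. f p * g p) \<in> smooth_functions"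
  by (rule smooth_functions_binary[of "(*)" f g], rule C_k_on_mult)

lemma smooth_functions_const: "(\<lambda>p. a) \<in> smooth_functions"
  unfolding smooth_functions_def smooth_on_def
  by (intro CollectI ballI exI[of _ UNIV] exI[of _ "\<lambda>z. a"]) (simp add: C_k_on_const)

lemma smooth_functions_cmult: "f \<in> smooth_functions \<Longrightarrow> (\<lambda>p. a * f p) \<in> smooth_functions"
  by (rule smooth_functions_mult) (rule smooth_functions_const)

text \<open>A smooth function on \<open>M\<close> pulls back to \<open>W\<close>, where it agrees near \<open>z\<close> with a smooth function on an
  open subset of \<open>\<complex>^8\<close>; so the chain rule applies even though \<open>c\<close> is only differentiable at 0.\<close>

lemma curve_derivation:
  assumes c: "(c has_vector_derivative c') (at 0)" "\<forall>\<^sub>F s in nhds 0. c s \<in> W" "c 0 = z"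
    and f: "f \<in> smooth_functions"
  shows "((\<lambda>s. f (proj (c s))) has_real_derivative curve_derivation c f) (at 0)"
proof -
  have "z \<in> W" using eventually_nhds_x_imp_x[OF c(2)] c(3) by simp
  with f obtain U g where U: "open U" "z \<in> U" "\<And>k. C_k_on k U g"
    "\<And>y. y \<in> U \<inter> W \<Longrightarrow> g y = f (proj y)" by (rule smooth_functionsD) (rule that)
  have "C_k_on (Suc 0) U g" by (rule U)
  then obtain g' where "\<And>x. x \<in> U \<Longrightarrow> (g has_derivative g' x) (at x)"
    by (rule C_k_on_SucE) (rule that)
  with U(2) have gz: "(g has_derivative g' z) (at (c 0))" by (simp add: c(3))
  from has_derivative_compose[OF c(1)[unfolded has_vector_derivative_def] gz]
  have "((\<lambda>s. g (c s)) has_derivative (\<lambda>s. g' z (s *\<^sub>R c'))) (at 0)" .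
  moreover have "(\<lambda>s. g' z (s *\<^sub>R c')) = (*) (g' z c')"
    using linear_scale[OF has_derivative_linear[OF gz]] by (simp add: fun_eq_iff)
  ultimately have "((\<lambda>s. g (c s)) has_real_derivative g' z c') (at 0)"
    by (simp only: has_field_derivative_def)
  moreover have "\<forall>\<^sub>F s in nhds 0. g (c s) = f (proj (c s))"
  proof -
    have "isCont c 0" using c(1) by (rule has_vector_derivative_continuous)
    then have "filterlim c (nhds z) (nhds 0)"
      using c(3) by (simp add: continuous_at tendsto_nhds_iff)
    then have "\<forall>\<^sub>F s in nhds 0. c s \<in> U"
      using U(1,2) by (rule topological_tendstoD)
    with c(2) show ?thesis by eventually_elim (simp add: U(4))
  qed
  ultimately have "((\<lambda>s. f (proj (c s))) has_real_derivative g' z c') (at 0)"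
    using DERIV_cong_ev[OF refl, of "\<lambda>s. g (c s)" "\<lambda>s. f (proj (c s))"] by blast
  with f show ?thesis by (simp add: curve_derivation_def DERIV_imp_deriv)
qed

lemma curve_derivation_tangent:
  assumes c: "(c has_vector_derivative c') (at 0)" "\<forall>\<^sub>F s in nhds 0. c s \<in> W" "c 0 = z"
  shows "curve_derivation c \<in> tangent_space (proj z)"
  unfolding tangent_space_def
proof (intro CollectI conjI ballI allI impI)
  note D = curve_derivation[OF c]
  fix f g a assume f: "f \<in> smooth_functions"
  show "curve_derivation c (\<lambda>q. a * f q) = a * curve_derivation c f"
    using D[OF smooth_functions_cmult[OF f, of a]] DERIV_cmult[OF D[OF f], of a] by (rule DERIV_unique)
  assume g: "g \<in> smooth_functions"
  show "curve_derivation c (\<lambda>q. f q + g q) = curve_derivation c f + curve_derivation c g"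
    using D[OF smooth_functions_add[OF f g]] DERIV_add[OF D[OF f] D[OF g]] by (rule DERIV_unique)
  show "curve_derivation c (\<lambda>q. f q * g q) = f (proj z) * curve_derivation c g + g (proj z) * curve_derivation c f"
    using DERIV_unique[OF D[OF smooth_functions_mult[OF f g]] DERIV_mult[OF D[OF f] D[OF g]]]
    by (simp add: c(3) mult.commute)
qed (simp add: curve_derivation_def)

section \<open>Derivations of invariant functions\<close>

text \<open>Every smooth torus-invariant function on \<open>\<complex>^8\<close> descends to \<open>M\<close>. Complex values make products of
  coordinates available; a derivation is applied to real and imaginary parts separately and remains
  a derivation.\<close>

definition invariant :: "(complex ^ 8 \<Rightarrow> complex) \<Rightarrow> bool" where
  "invariant \<phi> \<longleftrightarrow> (\<forall>k. C_k_on k UNIV \<phi>) \<and> (\<forall>t z. \<phi> (act t z) = \<phi> z)"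

definition descend :: "(complex ^ 8 \<Rightarrow> complex) \<Rightarrow> M \<Rightarrow> complex" where
  "descend \<phi> p = \<phi> (SOME z. z \<in> W \<and> proj z = p)"

lemma descend_proj:
  assumes "invariant \<phi>" "z \<in> W"
  shows "descend \<phi> (proj z) = \<phi> z"
proof -
  define w where "w = (SOME w. w \<in> W \<and> proj w = proj z)"
  have "w \<in> W \<and> proj w = proj z" unfolding w_def by (rule someI[of _ z]) (use assms in simp)
  then obtain t where "z = act t w" using proj_eq_iff assms(2) by blast
  then have "\<phi> z = \<phi> w" using assms(1) by (simp add: invariant_def)
  then show ?thesis by (simp add: descend_def flip: w_def)
qed

lemma descend_smooth:
  assumes "invariant \<phi>" "bounded_linear L"
  shows "(\<lambda>p. L (descend \<phi> p)) \<in> smooth_functions"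
  unfolding smooth_functions_def smooth_on_def
proof (intro CollectI ballI exI[of _ UNIV] exI[of _ "\<lambda>z. L (\<phi> z)"] conjI allI)
  show "C_k_on k UNIV (\<lambda>z. L (\<phi> z))" for k
    using assms by (simp add: invariant_def C_k_on_bounded_linear)
qed (use assms(1) in \<open>simp_all add: descend_proj\<close>)

lemma invariant_const: "invariant (\<lambda>z. a)"
  by (simp add: invariant_def C_k_on_const)

lemma invariant_mult: "invariant \<phi> \<Longrightarrow> invariant \<psi> \<Longrightarrow> invariant (\<lambda>z. \<phi> z * \<psi> z)"
  by (simp add: invariant_def C_k_on_mult)

lemma invariant_cnj: "invariant \<phi> \<Longrightarrow> invariant (\<lambda>z. cnj (\<phi> z))"
  by (simp add: invariant_def C_k_on_bounded_linear[OF bounded_linear_cnj])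

definition cderiv :: "((M \<Rightarrow> real) \<Rightarrow> real) \<Rightarrow> (complex ^ 8 \<Rightarrow> complex) \<Rightarrow> complex" where
  "cderiv D \<phi> = Complex (D (\<lambda>p. Re (descend \<phi> p))) (D (\<lambda>p. Im (descend \<phi> p)))"

lemma descend_cong:
  assumes "\<And>z. z \<in> W \<Longrightarrow> \<phi> z = \<psi> z"
  shows "descend \<phi> = descend \<psi>"
proof
  fix p
  obtain z where z: "z \<in> W" "p = proj z" by (rule proj_exhaust)
  then have "(SOME z. z \<in> W \<and> proj z = p) \<in> W" using someI[of "\<lambda>z. z \<in> W \<and> proj z = p" z] by auto
  then show "descend \<phi> p = descend \<psi> p" unfolding descend_def by (rule assms)
qed

text \<open>Only the values on \<open>W\<close> matter, so the defining equations of \<open>W\<close> may be differentiated.\<close>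

lemma cderiv_cong: "(\<And>z. z \<in> W \<Longrightarrow> \<phi> z = \<psi> z) \<Longrightarrow> cderiv D \<phi> = cderiv D \<psi>"
  unfolding cderiv_def using descend_cong[of \<phi> \<psi>] by simp

context
  fixes D z
  assumes D: "D \<in> tangent_space (proj z)" and z: "z \<in> W"
begin

lemma
  shows D_add: "f \<in> smooth_functions \<Longrightarrow> g \<in> smooth_functions \<Longrightarrow> D (\<lambda>q. f q + g q) = D f + D g"
    and D_cmult: "f \<in> smooth_functions \<Longrightarrow> D (\<lambda>q. a * f q) = a * D f"
    and D_mult: "f \<in> smooth_functions \<Longrightarrow> g \<in> smooth_functions \<Longrightarrow>
      D (\<lambda>q. f q * g q) = f (proj z) * D g + g (proj z) * D f"
  using D unfolding tangent_space_def by auto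

lemma D_const: "D (\<lambda>q. a) = 0"
  using D_mult[OF smooth_functions_const[of 1] smooth_functions_const[of 1]]
    D_cmult[OF smooth_functions_const[of 1], of a] by simp

lemma cderiv_const: "cderiv D (\<lambda>z. a) = 0"
  by (simp add: cderiv_def descend_def D_const complex_eq_iff)

lemma cderiv_mult:
  assumes "invariant \<phi>" "invariant \<psi>"
  shows "cderiv D (\<lambda>z. \<phi> z * \<psi> z) = \<phi> z * cderiv D \<psi> + \<psi> z * cderiv D \<phi>"
proof -
  note sm = descend_smooth[OF _ bounded_linear_Re] descend_smooth[OF _ bounded_linear_Im]
  let ?r = "\<lambda>\<phi> p. Re (descend \<phi> p)" and ?i = "\<lambda>\<phi> p. Im (descend \<phi> p)"
  have "D (\<lambda>p. ?r \<phi> p * ?r \<psi> p + (-1) * (?i \<phi> p * ?i \<psi> p)) =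
      (?r \<phi> (proj z) * D (?r \<psi>) + ?r \<psi> (proj z) * D (?r \<phi>))
      + (-1) * (?i \<phi> (proj z) * D (?i \<psi>) + ?i \<psi> (proj z) * D (?i \<phi>))"
    using assms by (simp only: D_add D_mult D_cmult sm smooth_functions_mult smooth_functions_cmult)
  moreover have "D (\<lambda>p. ?r \<phi> p * ?i \<psi> p + ?i \<phi> p * ?r \<psi> p) =
      (?r \<phi> (proj z) * D (?i \<psi>) + ?i \<psi> (proj z) * D (?r \<phi>))
      + (?i \<phi> (proj z) * D (?r \<psi>) + ?r \<psi> (proj z) * D (?i \<phi>))"
    using assms by (simp only: D_add D_mult D_cmult sm smooth_functions_mult smooth_functions_cmult)
  moreover have "?r (\<lambda>z. \<phi> z * \<psi> z) = (\<lambda>p. ?r \<phi> p * ?r \<psi> p + (-1) * (?i \<phi> p * ?i \<psi> p))"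
    "?i (\<lambda>z. \<phi> z * \<psi> z) = (\<lambda>p. ?r \<phi> p * ?i \<psi> p + ?i \<phi> p * ?r \<psi> p)"
    by (simp_all add: descend_def)
  ultimately show ?thesis
    using assms z unfolding cderiv_def complex_eq_iff by (simp add: descend_proj algebra_simps)
qed

lemma cderiv_add:
  assumes "invariant \<phi>" "invariant \<psi>"
  shows "cderiv D (\<lambda>z. \<phi> z + \<psi> z) = cderiv D \<phi> + cderiv D \<psi>"
proof -
  note sm = descend_smooth[OF _ bounded_linear_Re] descend_smooth[OF _ bounded_linear_Im]
  have "descend (\<lambda>z. \<phi> z + \<psi> z) p = descend \<phi> p + descend \<psi> p" for p
    by (simp add: descend_def)
  with assms show ?thesis
    by (simp add: cderiv_def complex_eq_iff D_add sm)
qed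

lemma cderiv_cmult: "invariant \<phi> \<Longrightarrow> cderiv D (\<lambda>z. a * \<phi> z) = a * cderiv D \<phi>"
  using cderiv_mult[OF invariant_const[of a], of \<phi>] by (simp add: cderiv_const)

lemma cderiv_cnj:
  assumes "invariant \<phi>"
  shows "cderiv D (\<lambda>z. cnj (\<phi> z)) = cnj (cderiv D \<phi>)"
proof -
  note sm = descend_smooth[OF _ bounded_linear_Im]
  have "descend (\<lambda>z. cnj (\<phi> z)) p = cnj (descend \<phi> p)" for p
    by (simp add: descend_def)
  with assms show ?thesis
    using D_cmult[OF sm[OF assms], of "-1"] by (simp add: cderiv_def complex_eq_iff)
qed

end

section \<open>Invariant monomials and vanishing derivatives\<close>

text \<open>Up to the factors \<open>abs_sq k\<close>, the monomials in \<open>z\<^sub>k\<close> and \<open>cnj z\<^sub>k\<close> that the torus leaves invariant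
  form a lattice of rank 2 (the dual of the two-dimensional torus acting on \<open>M\<close>), with basis
  \<open>Ymon\<close> and \<open>Emon\<close>. Since a conjugate counts as an inverse there, \<open>Smon\<close> and \<open>Tmon\<close> are
  \<open>Emon * Ymon\<close> and \<open>Emon * cnj Ymon\<close> after cancellation of the pairs \<open>z\<^sub>k * cnj z\<^sub>k\<close>. The real part of
  \<open>Ymon\<close> is \<open>X\<close>.\<close>

definition abs_sq :: "8 \<Rightarrow> complex ^ 8 \<Rightarrow> complex" where
  "abs_sq k z = z $ k * cnj (z $ k)"

definition Ymon :: "complex ^ 8 \<Rightarrow> complex" where
  "Ymon z = cnj (z $ 2) * cnj (z $ 3) * cnj (z $ 4) * z $ 6 * z $ 7 * z $ 8"

definition Emon :: "complex ^ 8 \<Rightarrow> complex" where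
  "Emon z = z $ 1 * z $ 2 * cnj (z $ 4) * cnj (z $ 5) * cnj (z $ 6) * z $ 8"

definition Smon :: "complex ^ 8 \<Rightarrow> complex" where
  "Smon z = z $ 1 * cnj (z $ 3) * cnj (z $ 4) * cnj (z $ 4) * cnj (z $ 5) * z $ 7 * z $ 8 * z $ 8"

definition Tmon :: "complex ^ 8 \<Rightarrow> complex" where
  "Tmon z = z $ 1 * z $ 2 * z $ 2 * z $ 3 * cnj (z $ 5) * cnj (z $ 6) * cnj (z $ 6) * cnj (z $ 7)"

lemma coordinate_smooth:
  "C_k_on m U (\<lambda>z :: complex ^ 8. z $ k)" "C_k_on m U (\<lambda>z :: complex ^ 8. cnj (z $ k))"
  by (auto intro!: C_k_on_linear bounded_linear_vec_nth bounded_linear_compose[OF bounded_linear_cnj])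

lemma act_nth: "act t z $ k = cis (weight t $ k) * z $ k"
  by (simp add: act_def)

lemma cis_cancel: "cis a * cis (- a) = 1" "cis a * (cis (- a) * x) = x"
  by (simp_all add: cis_mult flip: mult.assoc)

lemma invariant_abs_sq: "invariant (abs_sq k)"
proof -
  have "abs_sq k (act t z) = abs_sq k z" for t z
    by (simp add: abs_sq_def act_nth cis_cnj mult_ac cis_cancel)
  then show ?thesis
    unfolding invariant_def abs_sq_def[abs_def] by (simp add: C_k_on_mult coordinate_smooth)
qed

lemma invariant_Ymon: "invariant Ymon"
proof -
  have "Ymon (act t z) = Ymon z" for t z
    by (simp add: Ymon_def act_nth cis_cnj weight_def vector_8 mult_ac)
      (simp add: cis_mult flip: mult.assoc)
  then show ?thesis
    unfolding invariant_def Ymon_def[abs_def] by (simp add: C_k_on_mult coordinate_smooth)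
qed

lemma invariant_Emon: "invariant Emon"
proof -
  have "Emon (act t z) = Emon z" for t z
    by (simp add: Emon_def act_nth cis_cnj weight_def vector_8 mult_ac)
      (simp add: cis_mult flip: mult.assoc)
  then show ?thesis
    unfolding invariant_def Emon_def[abs_def] by (simp add: C_k_on_mult coordinate_smooth)
qed

lemma invariant_Smon: "invariant Smon"
proof -
  have "Smon (act t z) = Smon z" for t z
    by (simp add: Smon_def act_nth cis_cnj weight_def vector_8 mult_ac)
      (simp add: cis_mult flip: mult.assoc)
  then show ?thesis
    unfolding invariant_def Smon_def[abs_def] by (simp add: C_k_on_mult coordinate_smooth)
qed

lemma invariant_Tmon: "invariant Tmon"
proof -
  have "Tmon (act t z) = Tmon z" for t z
    by (simp add: Tmon_def act_nth cis_cnj weight_def vector_8 mult_ac)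
      (simp add: cis_mult flip: mult.assoc)
  then show ?thesis
    unfolding invariant_def Tmon_def[abs_def] by (simp add: C_k_on_mult coordinate_smooth)
qed

lemmas invariants = invariant_const invariant_mult invariant_cnj
  invariant_abs_sq invariant_Ymon invariant_Emon invariant_Smon invariant_Tmon

lemma abs_sq_eq_0_iff [simp]: "abs_sq k z = 0 \<longleftrightarrow> z $ k = 0"
  by (simp add: abs_sq_def)

lemma abs_sq_cmod: "abs_sq k z = complex_of_real ((cmod (z $ k))\<^sup>2)"
  unfolding abs_sq_def by (rule complex_norm_square[symmetric])

text \<open>The values of the \<open>abs_sq k\<close> are affine functions of those for \<open>k = 5\<close> and \<open>k = 7\<close>, which serve as
  coordinates in the plane of \<open>(J, H)\<close>. There the conditions \<open>abs_sq k \<ge> 0\<close> cut out an octagon, and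
  \<open>z\<^sub>k = 0\<close> is its edge number \<open>k\<close>; edges with cyclically adjacent numbers meet in a vertex.\<close>

lemma W_abs_sq:
  assumes "z \<in> W"
  shows "abs_sq 1 z = 6 + (-1) * abs_sq 5 z"
    and "abs_sq 2 z = 10 + ((-1) * abs_sq 5 z + (-1) * abs_sq 7 z)"
    and "abs_sq 3 z = 6 + (-1) * abs_sq 7 z"
    and "abs_sq 4 z = 4 + (abs_sq 5 z + (-1) * abs_sq 7 z)"
    and "abs_sq 6 z = (-2) + (abs_sq 5 z + abs_sq 7 z)"
    and "abs_sq 8 z = 4 + ((-1) * abs_sq 5 z + abs_sq 7 z)"
  using assms unfolding W_def abs_sq_cmod by (auto simp: complex_eq_iff)

lemma invariant_add: "invariant \<phi> \<Longrightarrow> invariant \<psi> \<Longrightarrow> invariant (\<lambda>z. \<phi> z + \<psi> z)"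
  by (simp add: invariant_def C_k_on_add)

lemma norm_Ymon: "Ymon w * cnj (Ymon w) = abs_sq 2 w * (abs_sq 3 w * (abs_sq 4 w * (abs_sq 6 w * (abs_sq 7 w * abs_sq 8 w))))"
  and norm_Emon: "Emon w * cnj (Emon w) = abs_sq 1 w * (abs_sq 2 w * (abs_sq 4 w * (abs_sq 5 w * (abs_sq 6 w * abs_sq 8 w))))"
  and norm_Smon: "Smon w * cnj (Smon w) =
    abs_sq 1 w * (abs_sq 3 w * (abs_sq 4 w * (abs_sq 4 w * (abs_sq 5 w * (abs_sq 7 w * (abs_sq 8 w * abs_sq 8 w))))))"
  and norm_Tmon: "Tmon w * cnj (Tmon w) =
    abs_sq 1 w * (abs_sq 2 w * (abs_sq 2 w * (abs_sq 3 w * (abs_sq 5 w * (abs_sq 6 w * (abs_sq 6 w * abs_sq 7 w))))))"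
  by (simp_all only: Ymon_def Emon_def Smon_def Tmon_def abs_sq_def complex_cnj_mult complex_cnj_cnj mult_ac)

context
  fixes D z
  assumes D: "D \<in> tangent_space (proj z)" and z: "z \<in> W"
begin

lemma cderiv_abs_sq:
  shows "cderiv D (abs_sq 1) = - cderiv D (abs_sq 5)"
    and "cderiv D (abs_sq 2) = - cderiv D (abs_sq 5) - cderiv D (abs_sq 7)"
    and "cderiv D (abs_sq 3) = - cderiv D (abs_sq 7)"
    and "cderiv D (abs_sq 4) = cderiv D (abs_sq 5) - cderiv D (abs_sq 7)"
    and "cderiv D (abs_sq 6) = cderiv D (abs_sq 5) + cderiv D (abs_sq 7)"
    and "cderiv D (abs_sq 8) = - cderiv D (abs_sq 5) + cderiv D (abs_sq 7)"
  using cderiv_cong[where D = D, OF W_abs_sq(1)] cderiv_cong[where D = D, OF W_abs_sq(2)] cderiv_cong[where D = D, OF W_abs_sq(3)]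
    cderiv_cong[where D = D, OF W_abs_sq(4)] cderiv_cong[where D = D, OF W_abs_sq(5)] cderiv_cong[where D = D, OF W_abs_sq(6)]
  by (simp_all only: cderiv_add[OF D z] cderiv_cmult[OF D z] cderiv_const[OF D z] invariants invariant_add)
    simp_all

text \<open>The function \<open>abs_sq k\<close> has a critical point wherever \<open>z\<^sub>k = 0\<close>, but \<open>z\<^sub>k\<close> itself is not a function
  on \<open>M\<close>. Multiplication by other coordinates makes it an invariant monomial \<open>\<phi>\<close>; then
  \<open>abs_sq k * R = \<phi> * cnj \<phi>\<close> is quadratic in a function that vanishes at the point, and \<open>R\<close> does not
  vanish there. This takes the place of the Hadamard lemma, with globally defined functions only.\<close>

lemma cderiv_abs_sq_vanishes:
  assumes "invariant \<phi>" "invariant R" "\<And>w. w \<in> W \<Longrightarrow> \<phi> w * cnj (\<phi> w) = abs_sq k w * R w"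
    and "z $ k = 0" "R z \<noteq> 0"
  shows "cderiv D (abs_sq k) = 0"
proof -
  have a: "abs_sq k z = 0"
    using assms(4) by simp
  then have "\<phi> z = 0"
    using assms(3)[OF z] by (simp del: abs_sq_eq_0_iff)
  then have "cderiv D (\<lambda>w. \<phi> w * cnj (\<phi> w)) = 0"
    using assms(1) by (simp add: cderiv_mult[OF D z] invariant_cnj)
  moreover have "cderiv D (\<lambda>w. \<phi> w * cnj (\<phi> w)) = cderiv D (\<lambda>w. abs_sq k w * R w)"
    by (rule cderiv_cong) (rule assms(3))
  ultimately show ?thesis
    using assms(2,5) a by (simp add: cderiv_mult[OF D z] invariants)
qed

text \<open>For each edge or vertex a monomial is chosen that contains one of the vanishing coordinates to the
  first power and none of the other vanishing ones.\<close>

lemma cderiv_abs_sq_1_edge: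
  assumes "z $ 1 = 0" "\<forall>k\<in>{2,4,5,6,8}. z $ k \<noteq> 0"
  shows "cderiv D (abs_sq 1) = 0"
  by (rule cderiv_abs_sq_vanishes[where \<phi> = Emon and
        R = "\<lambda>w. abs_sq 2 w * (abs_sq 4 w * (abs_sq 5 w * (abs_sq 6 w * abs_sq 8 w)))"])
    (use assms in \<open>simp_all add: invariants norm_Emon\<close>)

lemma cderiv_abs_sq_vertex_12:
  assumes "z $ 1 = 0" "z $ 2 = 0" "\<forall>k\<in>{3,4,5,6,7,8}. z $ k \<noteq> 0"
  shows "cderiv D (abs_sq 1) = 0" "cderiv D (abs_sq 2) = 0"
   by (rule cderiv_abs_sq_vanishes[where \<phi> = Smon and
        R = "\<lambda>w. abs_sq 3 w * (abs_sq 4 w * (abs_sq 4 w * (abs_sq 5 w * (abs_sq 7 w * (abs_sq 8 w * abs_sq 8 w)))))"],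
       (use assms in \<open>simp_all add: invariants norm_Smon\<close>)[5],
       rule cderiv_abs_sq_vanishes[where \<phi> = Ymon and
        R = "\<lambda>w. abs_sq 3 w * (abs_sq 4 w * (abs_sq 6 w * (abs_sq 7 w * abs_sq 8 w)))"])
    (use assms in \<open>simp_all add: invariants norm_Ymon\<close>)

lemma cderiv_abs_sq_vertex_18:
  assumes "z $ 1 = 0" "z $ 8 = 0" "\<forall>k\<in>{2,3,4,5,6,7}. z $ k \<noteq> 0"
  shows "cderiv D (abs_sq 1) = 0" "cderiv D (abs_sq 8) = 0"
   by (rule cderiv_abs_sq_vanishes[where \<phi> = Tmon and
        R = "\<lambda>w. abs_sq 2 w * (abs_sq 2 w * (abs_sq 3 w * (abs_sq 5 w * (abs_sq 6 w * (abs_sq 6 w * abs_sq 7 w)))))"],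
       (use assms in \<open>simp_all add: invariants norm_Tmon\<close>)[5],
       rule cderiv_abs_sq_vanishes[where \<phi> = Ymon and
        R = "\<lambda>w. abs_sq 2 w * (abs_sq 3 w * (abs_sq 4 w * (abs_sq 6 w * abs_sq 7 w)))"])
    (use assms in \<open>simp_all add: invariants norm_Ymon\<close>)

text \<open>At this vertex, as at the next one, \<open>Ymon\<close> contains both vanishing coordinates. Up to a nonzero factor
  it is the product of the two monomials used for the two edges, one of them conjugated, so its derivative vanishes as well.\<close>

lemma cderiv_abs_sq_vertex_78:
  assumes "z $ 7 = 0" "z $ 8 = 0" "\<forall>k\<in>{1,2,3,4,5,6}. z $ k \<noteq> 0"
  shows "cderiv D (abs_sq 7) = 0" "cderiv D (abs_sq 8) = 0" "cderiv D Ymon = 0"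
proof -
  show "cderiv D (abs_sq 7) = 0"
    by (rule cderiv_abs_sq_vanishes[where \<phi> = Tmon and
        R = "\<lambda>w. abs_sq 1 w * (abs_sq 2 w * (abs_sq 2 w * (abs_sq 3 w * (abs_sq 5 w * (abs_sq 6 w * abs_sq 6 w)))))"])
     (use assms in \<open>simp_all add: invariants norm_Tmon\<close>)
  show "cderiv D (abs_sq 8) = 0"
    by (rule cderiv_abs_sq_vanishes[where \<phi> = Emon and
        R = "\<lambda>w. abs_sq 1 w * (abs_sq 2 w * (abs_sq 4 w * (abs_sq 5 w * abs_sq 6 w)))"])
     (use assms in \<open>simp_all add: invariants norm_Emon\<close>)
  let ?R = "\<lambda>w. abs_sq 1 w * (abs_sq 2 w * (abs_sq 5 w * abs_sq 6 w))"
  have t: "Tmon z = 0" "Emon z = 0" using assms by (simp_all add: Tmon_def Emon_def)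
  have "cderiv D (\<lambda>w. cnj (Tmon w) * Emon w) = 0"
    using t by (simp add: cderiv_mult[OF D z] invariants)
  moreover have "(\<lambda>w. cnj (Tmon w) * Emon w) = (\<lambda>w. Ymon w * ?R w)"
    by (rule ext) (simp only: abs_sq_def Tmon_def Emon_def Ymon_def complex_cnj_mult complex_cnj_cnj mult_ac)
  moreover have "Ymon z = 0" using assms by (simp add: Ymon_def)
  ultimately show "cderiv D Ymon = 0"
    using assms by (simp add: cderiv_mult[OF D z, of Ymon ?R] invariants)
qed

lemma cderiv_abs_sq_vertex_67:
  assumes "z $ 6 = 0" "z $ 7 = 0" "\<forall>k\<in>{1,2,3,4,5,8}. z $ k \<noteq> 0"
  shows "cderiv D (abs_sq 6) = 0" "cderiv D (abs_sq 7) = 0" "cderiv D Ymon = 0"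
proof -
  show "cderiv D (abs_sq 6) = 0"
    by (rule cderiv_abs_sq_vanishes[where \<phi> = Emon and
        R = "\<lambda>w. abs_sq 1 w * (abs_sq 2 w * (abs_sq 4 w * (abs_sq 5 w * abs_sq 8 w)))"])
     (use assms in \<open>simp_all add: invariants norm_Emon\<close>)
  show "cderiv D (abs_sq 7) = 0"
    by (rule cderiv_abs_sq_vanishes[where \<phi> = Smon and
        R = "\<lambda>w. abs_sq 1 w * (abs_sq 3 w * (abs_sq 4 w * (abs_sq 4 w * (abs_sq 5 w * (abs_sq 8 w * abs_sq 8 w)))))"])
     (use assms in \<open>simp_all add: invariants norm_Smon\<close>)
  let ?R = "\<lambda>w. abs_sq 1 w * (abs_sq 4 w * (abs_sq 5 w * abs_sq 8 w))"
  have t: "Smon z = 0" "Emon z = 0" using assms by (simp_all add: Smon_def Emon_def)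
  have "cderiv D (\<lambda>w. Smon w * cnj (Emon w)) = 0"
    using t by (simp add: cderiv_mult[OF D z] invariants)
  moreover have "(\<lambda>w. Smon w * cnj (Emon w)) = (\<lambda>w. Ymon w * ?R w)"
    by (rule ext) (simp only: abs_sq_def Smon_def Emon_def Ymon_def complex_cnj_mult complex_cnj_cnj mult_ac)
  moreover have "Ymon z = 0" using assms by (simp add: Ymon_def)
  ultimately show "cderiv D Ymon = 0"
    using assms by (simp add: cderiv_mult[OF D z, of Ymon ?R] invariants)
qed

text \<open>Inside the edge \<open>z\<^sub>1 = 0\<close> all \<open>abs_sq k\<close> vary with the single parameter \<open>\<zeta> = abs_sq 2\<close>, and the
  product of those that occur in \<open>Ymon * cnj Ymon\<close> is \<open>\<zeta> * ff \<zeta>\<close>. If \<open>Ymon\<close> is real at the point, the product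
  rule expresses the derivative of its real part by that of \<open>\<zeta>\<close>, which equals that of \<open>abs_sq 3\<close>.\<close>

lemma cderiv_Ymon_edge:
  assumes "cderiv D (abs_sq 5) = 0" "Im (Ymon z) = 0" "abs_sq 2 z = of_real \<zeta>" "abs_sq 3 z = of_real (2 + \<zeta>)"
    "abs_sq 4 z = of_real (6 + \<zeta>)" "abs_sq 6 z = of_real (8 - \<zeta>)" "abs_sq 7 z = of_real (4 - \<zeta>)"
    "abs_sq 8 z = of_real (2 - \<zeta>)"
    and P: "((\<lambda>x. x * ff x) has_real_derivative P) (at \<zeta>)"
  shows "2 * Re (Ymon z) * Re (cderiv D Ymon) = P * Re (cderiv D (abs_sq 3))"
proof -
  define d where "d = cderiv D (abs_sq 3)"
  have d: "cderiv D (abs_sq 2) = d" "cderiv D (abs_sq 3) = d" "cderiv D (abs_sq 4) = d"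
    "cderiv D (abs_sq 6) = - d" "cderiv D (abs_sq 7) = - d" "cderiv D (abs_sq 8) = - d"
    using cderiv_abs_sq assms(1) by (simp_all add: d_def)
  have y: "Ymon z = of_real (Re (Ymon z))" using assms(2) by (simp add: complex_eq_iff)
  let ?p = "\<lambda>w. abs_sq 2 w * (abs_sq 3 w * (abs_sq 4 w * (abs_sq 6 w * (abs_sq 7 w * abs_sq 8 w))))"
  have "Ymon z * cnj (cderiv D Ymon) + cnj (Ymon z) * cderiv D Ymon
      = cderiv D (\<lambda>w. Ymon w * cnj (Ymon w))"
    by (simp add: cderiv_mult[OF D z] cderiv_cnj[OF D z] invariants)
  also have "\<dots> = cderiv D ?p"
    by (simp only: norm_Ymon)
  also have "\<dots> = of_real P * d"
  proof -
    have "((\<lambda>x. x * ff x) has_real_derivative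
        (2 + \<zeta>) * (6 + \<zeta>) * (8 - \<zeta>) * (4 - \<zeta>) * (2 - \<zeta>)
        + \<zeta> * (6 + \<zeta>) * (8 - \<zeta>) * (4 - \<zeta>) * (2 - \<zeta>)
        + \<zeta> * (2 + \<zeta>) * (8 - \<zeta>) * (4 - \<zeta>) * (2 - \<zeta>)
        - \<zeta> * (2 + \<zeta>) * (6 + \<zeta>) * (4 - \<zeta>) * (2 - \<zeta>)
        - \<zeta> * (2 + \<zeta>) * (6 + \<zeta>) * (8 - \<zeta>) * (2 - \<zeta>)
        - \<zeta> * (2 + \<zeta>) * (6 + \<zeta>) * (8 - \<zeta>) * (4 - \<zeta>)) (at \<zeta>)"
      unfolding ff_def by (auto intro!: derivative_eq_intros) (simp add: algebra_simps)
    from DERIV_unique[OF P this] show ?thesis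
      by (simp add: cderiv_mult[OF D z] invariants d assms) (simp add: algebra_simps)
  qed
  finally have "Re (Ymon z * cnj (cderiv D Ymon) + cnj (Ymon z) * cderiv D Ymon) = Re (of_real P * d)"
    by (rule arg_cong)
  then show ?thesis using y by (simp add: d_def) (metis assms(2) mult_zero_left diff_zero add_0_right mult.commute mult.assoc mult_2)
qed

end

section \<open>Fixed points through derivations and curves\<close>

text \<open>The two coefficients are kept independent of each other, because the involution below changes the
  sign of the first one only.\<close>

definition JHX :: "real \<Rightarrow> real \<Rightarrow> M \<Rightarrow> real \<times> real" where
  "JHX \<alpha> \<beta> p = (J p, \<alpha> * H p + \<beta> * X p)"

lemma F_eq_JHX: "F \<gamma> t = JHX (1 - 2 * t) (t * \<gamma>)"
  by (simp add: fun_eq_iff F_def JHX_def)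

lemma J_H_X_proj:
  assumes "z \<in> W"
  shows "J (proj z) = (cmod (z $ 1))\<^sup>2 / 2" "H (proj z) = (cmod (z $ 3))\<^sup>2 / 2"
    "X (proj z) = Re (Ymon z)"
  using J.abs_eq H.abs_eq X.abs_eq same_orbit_refl[OF assms] by (simp_all add: Ymon_def)

lemma J_H_X_descend:
  "J = (\<lambda>p. 1 / 2 * Re (descend (abs_sq 1) p))" "H = (\<lambda>p. 1 / 2 * Re (descend (abs_sq 3) p))"
  "X = (\<lambda>p. Re (descend Ymon p))"
proof -
  have "J p = 1 / 2 * Re (descend (abs_sq 1) p) \<and> H p = 1 / 2 * Re (descend (abs_sq 3) p) \<and>
      X p = Re (descend Ymon p)" for p
    by (rule proj_exhaust[of p]) (simp add: J_H_X_proj descend_proj invariants, simp add: abs_sq_cmod)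
  then show "J = (\<lambda>p. 1 / 2 * Re (descend (abs_sq 1) p))" "H = (\<lambda>p. 1 / 2 * Re (descend (abs_sq 3) p))"
    "X = (\<lambda>p. Re (descend Ymon p))" by (auto simp: fun_eq_iff)
qed

lemma smooth_J_H_X: "J \<in> smooth_functions" "H \<in> smooth_functions" "X \<in> smooth_functions"
  unfolding J_H_X_descend
  by (intro smooth_functions_cmult descend_smooth[OF _ bounded_linear_Re] invariants)+

lemma fixed_point_JHX_iff:
  "fixed_point (JHX \<alpha> \<beta>) p \<longleftrightarrow> (\<forall>D\<in>tangent_space p. D J = 0 \<and> \<alpha> * D H + \<beta> * D X = 0)"
proof -
  have "D (\<lambda>p. \<alpha> * H p + \<beta> * X p) = \<alpha> * D H + \<beta> * D X" if "D \<in> tangent_space p" for D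
    using that unfolding tangent_space_def
    by (simp add: smooth_J_H_X smooth_functions_cmult)
  then show ?thesis
    unfolding fixed_point_def differential_def JHX_def by auto
qed

lemma D_J_H_X:
  assumes D: "D \<in> tangent_space (proj z)" and z: "z \<in> W"
  shows "D J = 1 / 2 * Re (cderiv D (abs_sq 1))" "D H = 1 / 2 * Re (cderiv D (abs_sq 3))"
    "D X = Re (cderiv D Ymon)"
  unfolding J_H_X_descend cderiv_def
  by (simp_all add: D_cmult[OF D z, of _ "1/2", simplified] descend_smooth[OF _ bounded_linear_Re] invariants)

lemma fixed_point_curve:
  assumes fp: "fixed_point (JHX \<alpha> \<beta>) (proj z)"
    and c: "(c has_vector_derivative c') (at 0)" "\<forall>\<^sub>F s in nhds 0. c s \<in> W" "c 0 = z"
  shows "((\<lambda>s. (cmod (c s $ 1))\<^sup>2) has_real_derivative j) (at 0) \<Longrightarrow> j = 0"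
    and "((\<lambda>s. \<alpha> * (cmod (c s $ 3))\<^sup>2 / 2 + \<beta> * Re (Ymon (c s))) has_real_derivative h) (at 0) \<Longrightarrow> h = 0"
proof -
  note cd = curve_derivation[OF c]
  have 0: "curve_derivation c J = 0" "\<alpha> * curve_derivation c H + \<beta> * curve_derivation c X = 0"
    using fp curve_derivation_tangent[OF c] by (auto simp: fixed_point_JHX_iff)
  have J: "((\<lambda>s. J (proj (c s))) has_real_derivative 0) (at 0)"
    using cd[OF smooth_J_H_X(1)] 0 by simp
  assume j: "((\<lambda>s. (cmod (c s $ 1))\<^sup>2) has_real_derivative j) (at 0)"
  have "\<forall>\<^sub>F s in nhds 0. J (proj (c s)) = (cmod (c s $ 1))\<^sup>2 / 2"
    using c(2) by eventually_elim (rule J_H_X_proj)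
  then have "((\<lambda>s. (cmod (c s $ 1))\<^sup>2 / 2) has_real_derivative 0) (at 0)"
    using DERIV_cong_ev[OF refl _ refl] J by fastforce
  from DERIV_unique[OF this DERIV_cdivide[OF j]] show "j = 0" by simp
next
  note cd = curve_derivation[OF c]
  have 0: "curve_derivation c J = 0" "\<alpha> * curve_derivation c H + \<beta> * curve_derivation c X = 0"
    using fp curve_derivation_tangent[OF c] by (auto simp: fixed_point_JHX_iff)
  have J: "((\<lambda>s. \<alpha> * H (proj (c s)) + \<beta> * X (proj (c s))) has_real_derivative 0) (at 0)"
    using DERIV_add[OF DERIV_cmult[OF cd[OF smooth_J_H_X(2)], of \<alpha>] DERIV_cmult[OF cd[OF smooth_J_H_X(3)], of \<beta>]] 0 by simp
  assume j: "((\<lambda>s. \<alpha> * (cmod (c s $ 3))\<^sup>2 / 2 + \<beta> * Re (Ymon (c s))) has_real_derivative h) (at 0)"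
  have "\<forall>\<^sub>F s in nhds 0. \<alpha> * H (proj (c s)) + \<beta> * X (proj (c s)) = \<alpha> * (cmod (c s $ 3))\<^sup>2 / 2 + \<beta> * Re (Ymon (c s))"
    using c(2) by eventually_elim (simp add: J_H_X_proj)
  then have "((\<lambda>s. \<alpha> * (cmod (c s $ 3))\<^sup>2 / 2 + \<beta> * Re (Ymon (c s))) has_real_derivative 0) (at 0)"
    using DERIV_cong_ev[OF refl _ refl] J by fastforce
  from DERIV_unique[OF this j] show "h = 0" by simp
qed

section \<open>The involution exchanging the spheres J = 0 and J = 3\<close>

text \<open>Renumbering the coordinates by a shift of 4 preserves \<open>W\<close> and, after a change of torus parameters,
  the action. On \<open>M\<close> it reverses \<open>J\<close> and \<open>H\<close> and preserves \<open>X\<close>: a rotation of the octagon by a half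
  turn. It maps the points \<open>P\<close> to the points \<open>Q\<close>, and \<open>A\<close>, \<open>C\<close> to \<open>D\<close>, \<open>B\<close>.\<close>

definition shift :: "complex ^ 8 \<Rightarrow> complex ^ 8" where
  "shift z = vector [z $ 5, z $ 6, z $ 7, z $ 8, z $ 1, z $ 2, z $ 3, z $ 4]"

lemma shift_nth [simp]:
  "shift z $ 1 = z $ 5" "shift z $ 2 = z $ 6" "shift z $ 3 = z $ 7" "shift z $ 4 = z $ 8"
  "shift z $ 5 = z $ 1" "shift z $ 6 = z $ 2" "shift z $ 7 = z $ 3" "shift z $ 8 = z $ 4"
  by (simp_all add: shift_def vector_8)

lemma shift_shift [simp]: "shift (shift z) = z"
  by (simp add: vec_eq_iff forall_8)

lemma shift_in_W_iff [simp]: "shift z \<in> W \<longleftrightarrow> z \<in> W"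
  by (auto simp: W_def)

lemma vector_6:
  fixes a :: "'a::zero"
  shows "(vector [a, b, c, d, e, f] :: 'a ^ 6) $ 1 = a"
    and "(vector [a, b, c, d, e, f] :: 'a ^ 6) $ 2 = b"
    and "(vector [a, b, c, d, e, f] :: 'a ^ 6) $ 3 = c"
    and "(vector [a, b, c, d, e, f] :: 'a ^ 6) $ 4 = d"
    and "(vector [a, b, c, d, e, f] :: 'a ^ 6) $ 5 = e"
    and "(vector [a, b, c, d, e, f] :: 'a ^ 6) $ 6 = f"
  unfolding vector_def by simp_all

lemma shift_act:
  "shift (act t z) = act (vector [weight t $ 5, t $ 5, weight t $ 7, t $ 6, t $ 2, t $ 4]) (shift z)"
  by (simp add: vec_eq_iff forall_8 act_nth weight_def vector_8 vector_6)

lemma bounded_linear_shift: "bounded_linear shift"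
  unfolding linear_conv_bounded_linear[symmetric]
  by (rule linearI) (simp_all add: vec_eq_iff forall_8)

definition flip_M :: "M \<Rightarrow> M" where
  "flip_M p = proj (shift (SOME z. z \<in> W \<and> proj z = p))"

lemma flip_M_proj:
  assumes "z \<in> W"
  shows "flip_M (proj z) = proj (shift z)"
proof -
  define w where "w = (SOME w. w \<in> W \<and> proj w = proj z)"
  have w: "w \<in> W \<and> proj w = proj z" unfolding w_def by (rule someI[of _ z]) (use assms in simp)
  then obtain t where "z = act t w" using proj_eq_iff assms by blast
  then have "proj (shift z) = proj (shift w)" using w by (simp add: shift_act proj_act)
  then show ?thesis by (simp add: flip_M_def flip: w_def)
qed

lemma smooth_functions_flip:
  assumes "f \<in> smooth_functions"
  shows "(\<lambda>p. f (flip_M p)) \<in> smooth_functions"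
  unfolding smooth_functions_def smooth_on_def
proof (intro CollectI ballI)
  fix z assume z: "z \<in> W"
  then have "shift z \<in> W" by simp
  with assms obtain U g where U: "open U" "shift z \<in> U" "\<And>k. C_k_on k U g"
    "\<And>y. y \<in> U \<inter> W \<Longrightarrow> g y = f (proj y)" by (rule smooth_functionsD) (rule that)
  show "\<exists>U h. open U \<and> z \<in> U \<and> (\<forall>k. C_k_on k U h) \<and> (\<forall>y\<in>U \<inter> W. h y = f (flip_M (proj y)))"
  proof (intro exI[of _ "shift -` U"] exI[of _ "\<lambda>y. g (shift y)"] conjI allI ballI)
    show "open (shift -` U)"
      using U(1) linear_continuous_on[OF bounded_linear_shift] by (simp add: open_vimage)
    show "C_k_on k (shift -` U) (\<lambda>y. g (shift y))" for k
      by (rule C_k_on_precomp_linear[OF bounded_linear_shift U(3)])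
  qed (use U in \<open>auto simp: flip_M_proj\<close>)
qed

lemma flip_M_flip_M [simp]: "flip_M (flip_M p) = p"
  by (rule proj_exhaust[of p]) (simp add: flip_M_proj)

lemma smooth_functions_flip_iff: "(\<lambda>p. f (flip_M p)) \<in> smooth_functions \<longleftrightarrow> f \<in> smooth_functions"
  using smooth_functions_flip[of f] smooth_functions_flip[of "\<lambda>p. f (flip_M p)"] by auto

lemma flip_M_tangent:
  assumes "D \<in> tangent_space (flip_M p)"
  shows "(\<lambda>f. D (\<lambda>q. f (flip_M q))) \<in> tangent_space p"
  using assms unfolding tangent_space_def
  by (simp add: smooth_functions_flip smooth_functions_flip_iff)

lemma J_H_X_flip: "J (flip_M p) = 3 + (-1) * J p" "H (flip_M p) = 3 + (-1) * H p" "X (flip_M p) = X p"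
proof -
  obtain z where z: "z \<in> W" "p = proj z" by (rule proj_exhaust)
  have "Ymon (shift z) = cnj (Ymon z)"
    by (simp add: Ymon_def mult_ac)
  with z show "J (flip_M p) = 3 + (-1) * J p" "H (flip_M p) = 3 + (-1) * H p" "X (flip_M p) = X p"
    by (auto simp add: flip_M_proj J_H_X_proj) (auto simp: W_def)
qed

lemma fixed_point_flip_imp:
  assumes fp: "fixed_point (JHX (- \<alpha>) \<beta>) p"
  shows "fixed_point (JHX \<alpha> \<beta>) (flip_M p)"
  unfolding fixed_point_JHX_iff
proof
  fix D assume D: "D \<in> tangent_space (flip_M p)"
  obtain z where z: "z \<in> W" "flip_M p = proj z" by (rule proj_exhaust)
  note D' = D[unfolded z(2)]
  have "D (\<lambda>q. 3 + (-1) * h q) = - D h" if "h \<in> smooth_functions" for h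
    using D_add[OF D' z(1) smooth_functions_const smooth_functions_cmult[OF that], of 3 "-1"]
      D_const[OF D' z(1), of 3] D_cmult[OF D' z(1) that, of "-1"] by simp
  note neg = this[OF smooth_J_H_X(1)] this[OF smooth_J_H_X(2)]
  from fp flip_M_tangent[OF D] have "D (\<lambda>q. J (flip_M q)) = 0"
    "- \<alpha> * D (\<lambda>q. H (flip_M q)) + \<beta> * D (\<lambda>q. X (flip_M q)) = 0"
    unfolding fixed_point_JHX_iff by auto
  then show "D J = 0 \<and> \<alpha> * D H + \<beta> * D X = 0"
    by (simp only: J_H_X_flip neg) simp
qed

lemma fixed_point_flip: "fixed_point (JHX \<alpha> \<beta>) (flip_M p) \<longleftrightarrow> fixed_point (JHX (- \<alpha>) \<beta>) p"
  using fixed_point_flip_imp[of \<alpha> \<beta> p] fixed_point_flip_imp[of "- \<alpha>" \<beta> "flip_M p"] by auto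

lemma flip_pt:
  assumes "(vector (map complex_of_real [a,b,c,d,e,f,g,h]) :: complex ^ 8) \<in> W"
  shows "flip_M (pt [a,b,c,d,e,f,g,h]) = pt [e,f,g,h,a,b,c,d]"
proof -
  have "shift (vector (map complex_of_real [a,b,c,d,e,f,g,h])) = vector (map complex_of_real [e,f,g,h,a,b,c,d])"
    by (simp add: vec_eq_iff forall_8 vector_8)
  with assms show ?thesis by (simp add: pt_def flip_M_proj)
qed

section \<open>Normal forms on the sphere J = 0\<close>

text \<open>Like the representative of \<^const>\<open>P_pt\<close>, but with a complex second coordinate. The phase of the
  second coordinate is the angle on the sphere \<open>J = 0\<close>.\<close>

definition sphere_rep :: "complex \<Rightarrow> complex ^ 8" where
  "sphere_rep w = (let r = (cmod w)\<^sup>2 in vector [0, w, sqrt (2 + r), sqrt (6 + r), sqrt 6, sqrt (8 - r), sqrt (4 - r), sqrt (2 - r)])"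

lemma sphere_rep_nth [simp]:
  "sphere_rep w $ 1 = 0" "sphere_rep w $ 2 = w" "sphere_rep w $ 3 = sqrt (2 + (cmod w)\<^sup>2)" "sphere_rep w $ 4 = sqrt (6 + (cmod w)\<^sup>2)"
  "sphere_rep w $ 5 = sqrt 6" "sphere_rep w $ 6 = sqrt (8 - (cmod w)\<^sup>2)" "sphere_rep w $ 7 = sqrt (4 - (cmod w)\<^sup>2)"
  "sphere_rep w $ 8 = sqrt (2 - (cmod w)\<^sup>2)"
  by (simp_all add: sphere_rep_def Let_def vector_8)

lemma sphere_rep_in_W: "(cmod w)\<^sup>2 \<le> 2 \<Longrightarrow> sphere_rep w \<in> W"
  by (simp add: W_def)

lemma P_pt_eq: "P_pt u = proj (sphere_rep u)"
  by (simp add: P_pt_def pt_def sphere_rep_def Let_def)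

lemma flip_P_pt: "u\<^sup>2 \<le> 2 \<Longrightarrow> flip_M (P_pt u) = Q_pt u"
  unfolding P_pt_def Q_pt_def by (rule flip_pt) (use sphere_rep_in_W[of u] in \<open>simp add: sphere_rep_def Let_def\<close>)

lemma Ymon_sphere_rep:
  assumes "(cmod w)\<^sup>2 \<le> 2"
  shows "Ymon (sphere_rep w) = cnj w * of_real (sqrt (ff ((cmod w)\<^sup>2)))"
  by (simp add: Ymon_def ff_def real_sqrt_mult)

text \<open>The pole \<open>z\<^sub>8 = 0\<close> of the sphere: a torus element that fixes the coordinates 3 to 7 can rotate the
  second one, as it only moves the first and the eighth besides, and both vanish. In particular
  \<open>P_pt (- sqrt 2) = P_pt (sqrt 2)\<close>.\<close>

lemma proj_sphere_rep_rim:
  assumes "(cmod w)\<^sup>2 = 2"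
  shows "proj (sphere_rep w) = P_pt (sqrt 2)"
proof -
  define \<theta> where "\<theta> = Arg w"
  have r: "cmod w = sqrt 2" using assms by (simp add: real_sqrt_unique)
  then have w: "w = cis \<theta> * sqrt 2"
    using rcis_cmod_Arg[of w] by (simp add: rcis_def \<theta>_def mult.commute)
  have "sphere_rep w = act (vector [- 2 * \<theta>, \<theta>, 0, 0, 0, \<theta>]) (sphere_rep (complex_of_real (sqrt 2)))"
    by (simp add: vec_eq_iff forall_8 act_nth weight_def vector_8 vector_6 assms) (simp add: w)
  then show ?thesis using sphere_rep_in_W by (simp add: P_pt_eq proj_act)
qed

lemma cis_neg_Arg: "cis (- Arg z) * z = of_real (cmod z)"
proof -
  have "cis (- Arg z) * rcis (cmod z) (Arg z) = of_real (cmod z)"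
    by (simp add: rcis_def cis_mult mult.left_commute)
  then show ?thesis by (simp add: rcis_cmod_Arg)
qed

lemma of_real_cmod_eq: "(cmod z)\<^sup>2 = a \<Longrightarrow> complex_of_real (cmod z) = complex_of_real (sqrt a)"
  by (auto simp: real_sqrt_abs)

text \<open>When \<open>z\<^sub>1 = 0\<close>, the six torus parameters can be chosen to make the coordinates 3 to 8 nonnegative;
  their absolute values are then determined by that of the second coordinate.\<close>

lemma J_0_representative:
  assumes "J p = 0"
  obtains w where "(cmod w)\<^sup>2 \<le> 2" "p = proj (sphere_rep w)"
proof -
  obtain z where z: "z \<in> W" "p = proj z" by (rule proj_exhaust)
  define A where "A k = - Arg (z $ k)" for k
  \<comment> \<open>The second and first torus parameters solve the equations for the weights 7 and 5.\<close>
  let ?t2 = "A 7 - A 3 - A 4 + A 6 + A 8"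
  define t where "t = (vector [A 5 - ?t2 + A 4 + A 6 - A 8, ?t2, A 3, A 4, A 6, A 8] :: real ^ 6)"
  have wt: "weight t $ k = A k" if "k \<in> {3,4,5,6,7,8}" for k
    using that by (auto simp: weight_def t_def vector_8 vector_6)
  define w where "w = act t z $ 2"
  have z1: "z $ 1 = 0" using assms z by (simp add: J_H_X_proj)
  have r: "(cmod w)\<^sup>2 = (cmod (z $ 2))\<^sup>2" by (simp add: w_def act_component)
  have a: "(cmod (z $ 5))\<^sup>2 = 6" "(cmod (z $ 7))\<^sup>2 = 4 - (cmod w)\<^sup>2" "(cmod (z $ 3))\<^sup>2 = 2 + (cmod w)\<^sup>2"
    "(cmod (z $ 4))\<^sup>2 = 6 + (cmod w)\<^sup>2" "(cmod (z $ 6))\<^sup>2 = 8 - (cmod w)\<^sup>2" "(cmod (z $ 8))\<^sup>2 = 2 - (cmod w)\<^sup>2"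
    using z(1) z1 unfolding W_def r by auto
  have "act t z $ k = of_real (cmod (z $ k))" if "k \<in> {3,4,5,6,7,8}" for k
    unfolding act_nth wt[OF that] A_def by (rule cis_neg_Arg)
  then have "act t z = sphere_rep w"
    using z1 a[THEN of_real_cmod_eq] by (simp add: vec_eq_iff forall_8 flip: w_def) (simp add: act_nth)
  then have "p = proj (sphere_rep w)" using z proj_act by metis
  moreover have "(cmod w)\<^sup>2 \<le> 2" using a(6) by (smt (verit) zero_le_power2)
  ultimately show thesis using that by blast
qed

section \<open>Fixed points on the sphere J = 0\<close>

lemma curve_differentiable:
  fixes c :: "real \<Rightarrow> complex ^ 8"
  assumes "\<And>k. \<exists>d. ((\<lambda>s. c s $ k) has_vector_derivative d) (at 0)"
  obtains c' where "(c has_vector_derivative c') (at 0)"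
proof -
  obtain d where "\<And>k. ((\<lambda>s. c s $ k) has_vector_derivative d k) (at 0)"
    using assms by metis
  then have "(c has_vector_derivative (\<chi> k. d k)) (at 0)"
    by (intro vec_has_vector_derivative) simp
  with that show thesis .
qed

lemma of_real_times_differentiable:
  assumes "(h has_real_derivative d) (at 0)"
  shows "\<exists>d. ((\<lambda>s. of_real (h s) * a :: complex) has_vector_derivative d) (at 0)"
    and "\<exists>d. ((\<lambda>s. of_real (h s) :: complex) has_vector_derivative d) (at 0)"
proof -
  have h: "((\<lambda>s. of_real (h s) :: complex) has_vector_derivative of_real d) (at 0)"
    using assms by (simp add: has_vector_derivative_of_real has_real_derivative_iff_has_vector_derivative)
  show "\<exists>d. ((\<lambda>s. of_real (h s) * a :: complex) has_vector_derivative d) (at 0)"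
    using has_vector_derivative_mult_left[OF h] by blast
  show "\<exists>d. ((\<lambda>s. of_real (h s) :: complex) has_vector_derivative d) (at 0)"
    using h by blast
qed

lemma deriv_ff: "(ff has_real_derivative deriv ff \<zeta>) (at \<zeta>)"
proof -
  have "\<exists>d. (ff has_real_derivative d) (at \<zeta>)"
    unfolding ff_def by (rule exI, (rule derivative_eq_intros refl)+)
  then show ?thesis using DERIV_imp_deriv by metis
qed

lemma ff_pos: "0 \<le> \<zeta> \<Longrightarrow> \<zeta> < 2 \<Longrightarrow> 0 < ff \<zeta>"
  by (simp add: ff_def)

text \<open>The condition for \<open>u\<close> to be a critical point of \<open>\<alpha> * (2 + u\<^sup>2) / 2 + \<beta> * u * sqrt (ff (u\<^sup>2))\<close>, the value
  of \<open>\<alpha> * H + \<beta> * X\<close> at \<open>P_pt u\<close>, multiplied by \<open>sqrt (ff (u\<^sup>2))\<close>.\<close>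

definition critical :: "real \<Rightarrow> real \<Rightarrow> real \<Rightarrow> bool" where
  "critical \<alpha> \<beta> u \<longleftrightarrow> \<alpha> * u * sqrt (ff (u\<^sup>2)) + \<beta> * (ff (u\<^sup>2) + u\<^sup>2 * deriv ff (u\<^sup>2)) = 0"

text \<open>On the sphere \<open>J\<close> is critical. By \<open>cderiv_Ymon_edge\<close> every derivation sends \<open>\<alpha> * H + \<beta> * X\<close> to a
  multiple of the left-hand side of the critical equation.\<close>

lemma P_pt_fixed_interior:
  assumes "u\<^sup>2 < 2" "u \<noteq> 0" "critical \<alpha> \<beta> u"
  shows "fixed_point (JHX \<alpha> \<beta>) (P_pt u)"
  unfolding fixed_point_JHX_iff P_pt_eq
proof
  let ?z = "sphere_rep (complex_of_real u)"
  fix D assume D: "D \<in> tangent_space (proj ?z)"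
  have z: "?z \<in> W" using assms by (intro sphere_rep_in_W) simp
  have "6 + u\<^sup>2 \<noteq> 0" by (metis add_pos_nonneg zero_le_power2 zero_less_numeral less_irrefl)
  then have "cderiv D (abs_sq 1) = 0"
    using assms by (intro cderiv_abs_sq_1_edge[OF D z]) auto
  then have d5: "cderiv D (abs_sq 5) = 0" using cderiv_abs_sq[OF D z] by simp
  have Y: "Ymon ?z = of_real (u * sqrt (ff (u\<^sup>2)))" using assms by (subst Ymon_sphere_rep) auto
  have P: "((\<lambda>x. x * ff x) has_real_derivative (ff (u\<^sup>2) + u\<^sup>2 * deriv ff (u\<^sup>2))) (at (u\<^sup>2))"
    by (auto intro!: derivative_eq_intros deriv_ff)
  have "2 * Re (Ymon ?z) * Re (cderiv D Ymon) = (ff (u\<^sup>2) + u\<^sup>2 * deriv ff (u\<^sup>2)) * Re (cderiv D (abs_sq 3))"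
    by (rule cderiv_Ymon_edge[OF D z d5 _ _ _ _ _ _ _ P])
      (use assms Y in \<open>simp_all add: abs_sq_cmod\<close>)
  then have "2 * (u * sqrt (ff (u\<^sup>2))) * D X = (ff (u\<^sup>2) + u\<^sup>2 * deriv ff (u\<^sup>2)) * (2 * D H)"
    using Y D_J_H_X[OF D z] by simp
  then have Y_DX: "(u * sqrt (ff (u\<^sup>2))) * D X = (ff (u\<^sup>2) + u\<^sup>2 * deriv ff (u\<^sup>2)) * D H"
    by simp
  have "u * sqrt (ff (u\<^sup>2)) * (\<alpha> * D H + \<beta> * D X)
      = D H * (\<alpha> * u * sqrt (ff (u\<^sup>2))) + \<beta> * (u * sqrt (ff (u\<^sup>2)) * D X)"
    by (simp add: algebra_simps)
  also have "\<dots> = D H * (\<alpha> * u * sqrt (ff (u\<^sup>2)) + \<beta> * (ff (u\<^sup>2) + u\<^sup>2 * deriv ff (u\<^sup>2)))"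
    unfolding Y_DX by (simp add: algebra_simps)
  also have "\<dots> = 0" using assms(3) unfolding critical_def by simp
  finally have "\<alpha> * D H + \<beta> * D X = 0" using assms ff_pos[of "u\<^sup>2"] by simp
  then show "D J = 0 \<and> \<alpha> * D H + \<beta> * D X = 0"
    using D_J_H_X(1)[OF D z] \<open>cderiv D (abs_sq 1) = 0\<close> by simp
qed

text \<open>At the two poles of the sphere two coordinates vanish, so that all \<open>abs_sq k\<close> are critical.\<close>

lemma P_pt_fixed_vertices:
  "fixed_point (JHX \<alpha> 0) (P_pt 0)" "fixed_point (JHX \<alpha> 0) (P_pt (sqrt 2))"
proof -
  show "fixed_point (JHX \<alpha> 0) (P_pt 0)"
    unfolding fixed_point_JHX_iff P_pt_eq
  proof
    let ?z = "sphere_rep (complex_of_real 0)"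
    fix D assume D: "D \<in> tangent_space (proj ?z)"
    have z: "?z \<in> W" by (intro sphere_rep_in_W) simp
    have "cderiv D (abs_sq 1) = 0" "cderiv D (abs_sq 2) = 0"
      by (rule cderiv_abs_sq_vertex_12[OF D z]; simp)+
    then show "D J = 0 \<and> \<alpha> * D H + 0 * D X = 0"
      using D_J_H_X[OF D z] cderiv_abs_sq[OF D z] by simp
  qed
  show "fixed_point (JHX \<alpha> 0) (P_pt (sqrt 2))"
    unfolding fixed_point_JHX_iff P_pt_eq
  proof
    let ?z = "sphere_rep (complex_of_real (sqrt 2))"
    fix D assume D: "D \<in> tangent_space (proj ?z)"
    have z: "?z \<in> W" by (intro sphere_rep_in_W) simp
    have "cderiv D (abs_sq 1) = 0" "cderiv D (abs_sq 8) = 0"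
      by (rule cderiv_abs_sq_vertex_18[OF D z]; simp)+
    then show "D J = 0 \<and> \<alpha> * D H + 0 * D X = 0"
      using D_J_H_X[OF D z] cderiv_abs_sq[OF D z] by simp
  qed
qed

lemma DERIV_ff_chain:
  "(g has_real_derivative d) (at x) \<Longrightarrow> e = deriv ff (g x) * d \<Longrightarrow>
    ((\<lambda>x. ff (g x)) has_real_derivative e) (at x)"
  using DERIV_chain2[OF deriv_ff] by blast

lemma sqrt_quadratic_differentiable:
  assumes "0 < a + b * r\<^sup>2"
  shows "\<exists>d. ((\<lambda>s. complex_of_real (sqrt (a + b * (r + s)\<^sup>2))) has_vector_derivative d) (at 0)"
proof -
  have "\<exists>d. ((\<lambda>s. sqrt (a + b * (r + s)\<^sup>2)) has_real_derivative d) (at 0)"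
    using assms by (intro exI) (rule derivative_eq_intros refl | simp)+
  then show ?thesis using of_real_times_differentiable(2) by blast
qed

text \<open>The derivative of \<open>\<alpha> * H + \<beta> * X\<close> along the meridian of constant angle. The equation at \<open>r = 0\<close>
  is also meaningful, because the meridian passes through that pole with nonzero speed.\<close>

lemma fixed_point_sphere_rep_radial:
  assumes fp: "fixed_point (JHX \<alpha> \<beta>) (proj (sphere_rep (of_real r * cis \<phi>)))" and r: "r\<^sup>2 < 2"
  shows "\<alpha> * r * sqrt (ff (r\<^sup>2)) + \<beta> * cos \<phi> * (ff (r\<^sup>2) + r\<^sup>2 * deriv ff (r\<^sup>2)) = 0"
proof -
  define c where "c s = sphere_rep (of_real (r + s) * cis \<phi>)" for s
  define q where "q = sqrt (ff (r\<^sup>2))"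
  have n: "(cmod (complex_of_real x * cis \<phi>))\<^sup>2 = x\<^sup>2" for x
    by (simp add: norm_mult power_mult_distrib)
  have f: "0 < ff (r\<^sup>2)" using r by (simp add: ff_pos)
  then have q: "0 < q" "q * q = ff (r\<^sup>2)" by (simp_all add: q_def)
  obtain c' where c': "(c has_vector_derivative c') (at 0)"
  proof (rule curve_differentiable)
    note S = sqrt_quadratic_differentiable
    have "\<exists>d. ((\<lambda>s. complex_of_real (r + s) * cis \<phi>) has_vector_derivative d) (at 0)"
      by (rule of_real_times_differentiable(1)[of _ 1]) (auto intro!: derivative_eq_intros)
    moreover have "0 < 2 + 1 * r\<^sup>2" "0 < 6 + 1 * r\<^sup>2" by (simp_all add: add_pos_nonneg)
    ultimately have "\<forall>k. \<exists>d. ((\<lambda>s. c s $ k) has_vector_derivative d) (at 0)"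
      unfolding forall_8 c_def sphere_rep_nth n
      using S[of 2 1 r] S[of 6 1 r] S[of 8 "-1" r] S[of 4 "-1" r] S[of 2 "-1" r] r
      by (auto intro: exI[of _ 0])
    then show "\<exists>d. ((\<lambda>s. c s $ k) has_vector_derivative d) (at 0)" for k by blast
  qed
  have ev: "\<forall>\<^sub>F s in nhds 0. (r + s)\<^sup>2 < 2"
  proof -
    have "isCont (\<lambda>s. (r + s)\<^sup>2) 0" by (intro continuous_intros)
    then have "((\<lambda>s. (r + s)\<^sup>2) \<longlongrightarrow> r\<^sup>2) (nhds 0)"
      by (simp add: isCont_def tendsto_nhds_iff)
    then show ?thesis using r by (rule order_tendstoD(2))
  qed
  then have cW: "\<forall>\<^sub>F s in nhds 0. c s \<in> W"
    by eventually_elim (unfold c_def, rule sphere_rep_in_W, simp only: n)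
  let ?d = "\<alpha> * r + \<beta> * (cos \<phi> * q + r * cos \<phi> * (deriv ff (r\<^sup>2) * (2 * r) / (2 * q)))"
  have "((\<lambda>s. \<alpha> * (2 + (r + s)\<^sup>2) / 2 + \<beta> * ((r + s) * cos \<phi> * sqrt (ff ((r + s)\<^sup>2)))) has_real_derivative ?d) (at 0)"
    using f by (auto intro!: derivative_eq_intros DERIV_ff_chain simp: q_def) (simp add: field_simps)
  moreover have "\<forall>\<^sub>F s in nhds 0. \<alpha> * (2 + (r + s)\<^sup>2) / 2 + \<beta> * ((r + s) * cos \<phi> * sqrt (ff ((r + s)\<^sup>2)))
      = \<alpha> * (cmod (c s $ 3))\<^sup>2 / 2 + \<beta> * Re (Ymon (c s))"
    using ev
  proof eventually_elim
    case (elim s)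
    then show ?case unfolding c_def by (simp add: n Ymon_sphere_rep del: norm_mult of_real_add)
  qed
  ultimately have "((\<lambda>s. \<alpha> * (cmod (c s $ 3))\<^sup>2 / 2 + \<beta> * Re (Ymon (c s))) has_real_derivative ?d) (at 0)"
    using DERIV_cong_ev[OF refl _ refl] by fastforce
  from fixed_point_curve(2)[OF fp c' cW _ this] have "q * ?d = 0"
    by (simp add: c_def)
  moreover have "q * ?d = \<alpha> * r * q + \<beta> * cos \<phi> * (q * q + r\<^sup>2 * deriv ff (r\<^sup>2))"
    using q(1) by (simp add: field_simps power2_eq_square)
  ultimately show ?thesis unfolding q(2) by (simp only: q_def)
qed

text \<open>The derivative along a parallel, on which \<open>H\<close> is constant and \<open>X\<close> is proportional to \<open>cos \<phi>\<close>.\<close>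

lemma fixed_point_sphere_rep_angular:
  assumes fp: "fixed_point (JHX \<alpha> \<beta>) (proj (sphere_rep (of_real r * cis \<phi>)))" and r: "r\<^sup>2 < 2"
  shows "\<beta> * r * sin \<phi> = 0"
proof -
  define c where "c s = sphere_rep (of_real r * cis (\<phi> + s))" for s
  have n: "(cmod (complex_of_real x * cis \<psi>))\<^sup>2 = x\<^sup>2" for x \<psi>
    by (simp add: norm_mult power_mult_distrib)
  have f: "0 < ff (r\<^sup>2)" using r by (simp add: ff_pos)
  obtain c' where c': "(c has_vector_derivative c') (at 0)"
  proof (rule curve_differentiable)
    have "(\<lambda>s. complex_of_real r * cis (\<phi> + s)) = (\<lambda>s. of_real (r * cos (\<phi> + s)) + of_real (r * sin (\<phi> + s)) * \<i>)"
      by (simp add: fun_eq_iff complex_eq_iff)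
    moreover have "\<exists>d. ((\<lambda>s. complex_of_real (r * cos (\<phi> + s))) has_vector_derivative d) (at 0)"
      by (rule of_real_times_differentiable(2)[of _ "- r * sin \<phi>"]) (auto intro!: derivative_eq_intros)
    moreover have "\<exists>d. ((\<lambda>s. complex_of_real (r * sin (\<phi> + s)) * \<i>) has_vector_derivative d) (at 0)"
      by (rule of_real_times_differentiable(1)[of _ "r * cos \<phi>"]) (auto intro!: derivative_eq_intros)
    ultimately have 2: "\<exists>d. ((\<lambda>s. complex_of_real r * cis (\<phi> + s)) has_vector_derivative d) (at 0)"
      using has_vector_derivative_add by (elim exE) (simp only:, blast)
    have "\<exists>d. ((\<lambda>s. a) has_vector_derivative d) (at 0)" for a :: complex
      by (rule exI) (rule has_vector_derivative_const)
    with 2 have "\<forall>k. \<exists>d. ((\<lambda>s. c s $ k) has_vector_derivative d) (at 0)"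
      unfolding forall_8 c_def sphere_rep_nth n by (intro conjI)
    then show "\<exists>d. ((\<lambda>s. c s $ k) has_vector_derivative d) (at 0)" for k by blast
  qed
  have cW: "\<forall>\<^sub>F s in nhds 0. c s \<in> W"
    unfolding c_def by (rule always_eventually) (use r in \<open>intro allI sphere_rep_in_W, simp only: n\<close>)
  have "((\<lambda>s. \<alpha> * (2 + r\<^sup>2) / 2 + \<beta> * (r * cos (\<phi> + s) * sqrt (ff (r\<^sup>2)))) has_real_derivative
      - (\<beta> * r * sin \<phi> * sqrt (ff (r\<^sup>2)))) (at 0)"
    by (auto intro!: derivative_eq_intros)
  moreover have "\<alpha> * (2 + r\<^sup>2) / 2 + \<beta> * (r * cos (\<phi> + s) * sqrt (ff (r\<^sup>2)))
      = \<alpha> * (cmod (c s $ 3))\<^sup>2 / 2 + \<beta> * Re (Ymon (c s))" for s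
    unfolding c_def using r by (simp add: n Ymon_sphere_rep del: norm_mult)
  ultimately have "((\<lambda>s. \<alpha> * (cmod (c s $ 3))\<^sup>2 / 2 + \<beta> * Re (Ymon (c s))) has_real_derivative
      - (\<beta> * r * sin \<phi> * sqrt (ff (r\<^sup>2)))) (at 0)" by simp
  from fixed_point_curve(2)[OF fp c' cW _ this] show ?thesis
    using f by (simp add: c_def)
qed

text \<open>At the pole \<open>z\<^sub>8 = 0\<close> the coordinate \<open>r\<close> degenerates, so the eighth coordinate \<open>s\<close> is the parameter. Along
  this curve \<open>H\<close> is even in \<open>s\<close>, whereas \<open>X\<close> has a simple zero at \<open>s = 0\<close>.\<close>

lemma fixed_point_P_pt_rim:
  assumes fp: "fixed_point (JHX \<alpha> \<beta>) (P_pt (sqrt 2))"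
  shows "\<beta> = 0"
proof -
  define c :: "real \<Rightarrow> complex ^ 8" where
    "c s = vector (map complex_of_real [0, sqrt (2 + (-1) * (0 + s)\<^sup>2), sqrt (4 + (-1) * (0 + s)\<^sup>2),
      sqrt (8 + (-1) * (0 + s)\<^sup>2), sqrt 6, sqrt (6 + 1 * (0 + s)\<^sup>2), sqrt (2 + 1 * (0 + s)\<^sup>2), s])" for s
  have c_nth: "c s $ 1 = of_real 0" "c s $ 2 = of_real (sqrt (2 + (-1) * (0 + s)\<^sup>2))"
    "c s $ 3 = of_real (sqrt (4 + (-1) * (0 + s)\<^sup>2))" "c s $ 4 = of_real (sqrt (8 + (-1) * (0 + s)\<^sup>2))"
    "c s $ 5 = of_real (sqrt 6)" "c s $ 6 = of_real (sqrt (6 + 1 * (0 + s)\<^sup>2))"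
    "c s $ 7 = of_real (sqrt (2 + 1 * (0 + s)\<^sup>2))" "c s $ 8 = of_real s * 1" for s
    unfolding c_def by (simp_all add: vector_8)
  have c0: "c 0 = sphere_rep (complex_of_real (sqrt 2))"
    by (simp add: vec_eq_iff forall_8 c_nth)
  obtain c' where c': "(c has_vector_derivative c') (at 0)"
  proof (rule curve_differentiable)
    note S = sqrt_quadratic_differentiable
    have "\<exists>d. ((\<lambda>s. complex_of_real s * 1) has_vector_derivative d) (at 0)"
      by (rule of_real_times_differentiable(1)[of _ 1]) (auto intro!: derivative_eq_intros)
    then have "\<forall>k. \<exists>d. ((\<lambda>s. c s $ k) has_vector_derivative d) (at 0)"
      unfolding forall_8 c_nth
      using S[of 2 1 0] S[of 6 1 0] S[of 8 "-1" 0] S[of 4 "-1" 0] S[of 2 "-1" 0]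
      by (auto intro: exI[of _ 0] has_vector_derivative_const)
    then show "\<exists>d. ((\<lambda>s. c s $ k) has_vector_derivative d) (at 0)" for k by blast
  qed
  have ev: "\<forall>\<^sub>F s in nhds 0. s\<^sup>2 < (2::real)"
  proof -
    have "isCont (\<lambda>s. s\<^sup>2 :: real) 0" by (intro continuous_intros)
    then have "((\<lambda>s. s\<^sup>2 :: real) \<longlongrightarrow> 0) (nhds 0)"
      by (simp add: isCont_def tendsto_nhds_iff)
    then show ?thesis by (rule order_tendstoD(2)) simp
  qed
  have cW: "\<forall>\<^sub>F s in nhds 0. c s \<in> W"
    using ev by eventually_elim (simp add: W_def c_nth)
  let ?q = "\<lambda>s::real. sqrt (2 - s\<^sup>2) * sqrt (4 - s\<^sup>2) * sqrt (8 - s\<^sup>2) * sqrt (6 + s\<^sup>2) * sqrt (2 + s\<^sup>2)"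
  have "((\<lambda>s. s * ?q s) has_real_derivative ?q 0) (at 0)"
    by (auto intro!: derivative_eq_intros)
  then have "((\<lambda>s. \<alpha> * (4 - s\<^sup>2) / 2 + \<beta> * (s * ?q s)) has_real_derivative \<beta> * ?q 0) (at 0)"
    by (auto intro!: derivative_eq_intros)
  moreover have "\<forall>\<^sub>F s in nhds 0. \<alpha> * (4 - s\<^sup>2) / 2 + \<beta> * (s * ?q s)
      = \<alpha> * (cmod (c s $ 3))\<^sup>2 / 2 + \<beta> * Re (Ymon (c s))"
    using ev by eventually_elim (simp add: c_nth Ymon_def mult_ac)
  ultimately have "((\<lambda>s. \<alpha> * (cmod (c s $ 3))\<^sup>2 / 2 + \<beta> * Re (Ymon (c s))) has_real_derivative \<beta> * ?q 0) (at 0)"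
    using DERIV_cong_ev[OF refl _ refl] by fastforce
  from fixed_point_curve(2)[OF fp[unfolded P_pt_eq] c' cW c0 this] show ?thesis by simp
qed

text \<open>A fixed point inside the sphere has \<open>sin \<phi> = 0\<close> by the angular equation, hence a real representative, and
  the radial equation is the critical equation for its second coordinate.\<close>

lemma fixed_points_J_0:
  assumes "\<alpha> \<noteq> 0 \<or> \<beta> \<noteq> 0"
  shows "fixed_point (JHX \<alpha> \<beta>) p \<and> J p = 0 \<longleftrightarrow>
    (\<exists>u. u\<^sup>2 < 2 \<and> critical \<alpha> \<beta> u \<and> p = P_pt u) \<or> \<beta> = 0 \<and> p = P_pt (sqrt 2)" (is "?L \<longleftrightarrow> ?R")
proof
  assume L: ?L
  then obtain w where w: "(cmod w)\<^sup>2 \<le> 2" "p = proj (sphere_rep w)" using J_0_representative by blast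
  show ?R
  proof (cases "(cmod w)\<^sup>2 = 2")
    case True
    then show ?thesis using L w proj_sphere_rep_rim fixed_point_P_pt_rim by metis
  next
    case False
    define r \<phi> where "r = cmod w" "\<phi> = Arg w"
    have wr: "w = of_real r * cis \<phi>"
      using rcis_cmod_Arg[of w] by (simp add: rcis_def r_\<phi>_def)
    have r: "r\<^sup>2 < 2" using False w by (simp add: r_\<phi>_def)
    have fp: "fixed_point (JHX \<alpha> \<beta>) (proj (sphere_rep (of_real r * cis \<phi>)))" using L w wr by simp
    note rad = fixed_point_sphere_rep_radial[OF fp r] and ang = fixed_point_sphere_rep_angular[OF fp r]
    have f: "0 < ff (r\<^sup>2)" using r by (simp add: ff_pos)
    show ?thesis
    \<comment> \<open>At the pole the angle is arbitrary; the choice 0 gives the critical equation for 0.\<close>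
    proof (cases "r = 0")
      case True
      then have "w = of_real 0" using wr by simp
      moreover have "fixed_point (JHX \<alpha> \<beta>) (proj (sphere_rep (of_real 0 * cis 0)))" using fp True by simp
      from fixed_point_sphere_rep_radial[OF this] have "critical \<alpha> \<beta> 0" by (simp add: critical_def)
      ultimately show ?thesis using w by (intro disjI1 exI[of _ 0]) (simp add: P_pt_eq)
    next
      case False
      then have "\<beta> \<noteq> 0" using rad f assms by auto
      then have s: "sin \<phi> = 0" using ang False by simp
      then have "(cos \<phi>)\<^sup>2 = 1" using sin_cos_squared_add[of \<phi>] by simp
      then have "cos \<phi> = 1 \<or> cos \<phi> = -1" by (simp add: power2_eq_1_iff)
      then have "critical \<alpha> \<beta> (r * cos \<phi>) \<and> (r * cos \<phi>)\<^sup>2 < 2"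
        using rad r by (auto simp: critical_def)
      moreover have "w = of_real (r * cos \<phi>)" using wr s by (simp add: complex_eq_iff)
      ultimately show ?thesis using w by (intro disjI1 exI[of _ "r * cos \<phi>"]) (simp add: P_pt_eq)
    qed
  qed
next
  have J: "J (P_pt u) = 0" if "u\<^sup>2 \<le> 2" for u
    using that by (simp add: P_pt_eq J_H_X_proj sphere_rep_in_W)
  assume ?R
  then show ?L
  proof (elim disjE exE conjE)
    fix u assume u: "u\<^sup>2 < 2" "critical \<alpha> \<beta> u" "p = P_pt u"
    show ?thesis
    proof (cases "u = 0")
      case True
      then have "\<beta> = 0" using u(2) by (simp add: critical_def ff_def)
      then show ?thesis using True u J P_pt_fixed_vertices by simp
    qed (use u J P_pt_fixed_interior in simp)
  qed (use J P_pt_fixed_vertices in simp)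
qed

section \<open>Fixed points off the two spheres\<close>

abbreviation (input) "ptA \<equiv> pt [sqrt 2, sqrt 6, sqrt 6, 2 * sqrt 2, 2, sqrt 2, 0, 0]"
abbreviation (input) "ptB \<equiv> pt [sqrt 2, 0, 0, sqrt 2, 2, 2 * sqrt 2, sqrt 6, sqrt 6]"
abbreviation (input) "ptC \<equiv> pt [2, 2 * sqrt 2, sqrt 6, sqrt 6, sqrt 2, 0, 0, sqrt 2]"
abbreviation (input) "ptD \<equiv> pt [2, sqrt 2, 0, 0, sqrt 2, sqrt 6, sqrt 6, 2 * sqrt 2]"

lemma sqrt_multiples: "sqrt 4 = 2" "sqrt 8 = 2 * sqrt 2"
  using real_sqrt_mult[of 4 2] by simp_all

text \<open>At a vertex the six nonzero coordinates can be made positive by the six torus parameters, so that the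
  vertex corresponds to a single point of \<open>M\<close>.\<close>

lemma proj_vertex_78:
  assumes z: "z \<in> W" "z $ 7 = 0" "z $ 8 = 0"
  shows "proj z = ptA"
proof -
  define A where "A k = - Arg (z $ k)" for k
  define t where "t = (vector [A 1, A 2, A 3, A 4, A 6, A 5 - A 1 - A 2 + A 4 + A 6] :: real ^ 6)"
  have wt: "weight t $ k = A k" if "k \<in> {1,2,3,4,5,6}" for k
    using that by (auto simp: weight_def t_def vector_8 vector_6)
  have a: "(cmod (z $ 1))\<^sup>2 = 2" "(cmod (z $ 2))\<^sup>2 = 6" "(cmod (z $ 3))\<^sup>2 = 6" "(cmod (z $ 4))\<^sup>2 = 8"
    "(cmod (z $ 5))\<^sup>2 = 4" "(cmod (z $ 6))\<^sup>2 = 2"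
    using z unfolding W_def by auto
  have "act t z $ k = of_real (cmod (z $ k))" if "k \<in> {1,2,3,4,5,6}" for k
    unfolding act_nth wt[OF that] A_def by (rule cis_neg_Arg)
  then have "act t z = vector (map complex_of_real [sqrt 2, sqrt 6, sqrt 6, 2 * sqrt 2, 2, sqrt 2, 0, 0])"
    using a[THEN of_real_cmod_eq] by (simp add: vec_eq_iff forall_8 vector_8 sqrt_multiples)
      (simp add: act_nth z)
  then show ?thesis using proj_act[OF z(1), of t] by (simp add: pt_def)
qed

lemma proj_vertex_67:
  assumes z: "z \<in> W" "z $ 6 = 0" "z $ 7 = 0"
  shows "proj z = ptC"
proof -
  define A where "A k = - Arg (z $ k)" for k
  define t where "t = (vector [A 1, A 2, A 3, A 4, A 1 + A 2 - A 4 + A 8 - A 5, A 8] :: real ^ 6)"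
  have wt: "weight t $ k = A k" if "k \<in> {1,2,3,4,5,8}" for k
    using that by (auto simp: weight_def t_def vector_8 vector_6)
  have a: "(cmod (z $ 1))\<^sup>2 = 4" "(cmod (z $ 2))\<^sup>2 = 8" "(cmod (z $ 3))\<^sup>2 = 6" "(cmod (z $ 4))\<^sup>2 = 6"
    "(cmod (z $ 5))\<^sup>2 = 2" "(cmod (z $ 8))\<^sup>2 = 2"
    using z unfolding W_def by auto
  have "act t z $ k = of_real (cmod (z $ k))" if "k \<in> {1,2,3,4,5,8}" for k
    unfolding act_nth wt[OF that] A_def by (rule cis_neg_Arg)
  then have "act t z = vector (map complex_of_real [2, 2 * sqrt 2, sqrt 6, sqrt 6, sqrt 2, 0, 0, sqrt 2])"
    using a[THEN of_real_cmod_eq] by (simp add: vec_eq_iff forall_8 vector_8 sqrt_multiples)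
      (simp add: act_nth z)
  then show ?thesis using proj_act[OF z(1), of t] by (simp add: pt_def)
qed

lemma vertices_in_W:
  "(vector (map complex_of_real [sqrt 2, sqrt 6, sqrt 6, 2 * sqrt 2, 2, sqrt 2, 0, 0]) :: complex ^ 8) \<in> W"
  "(vector (map complex_of_real [2, 2 * sqrt 2, sqrt 6, sqrt 6, sqrt 2, 0, 0, sqrt 2]) :: complex ^ 8) \<in> W"
  by (simp_all add: W_def vector_8 norm_mult power_mult_distrib)

lemma flip_vertices: "flip_M ptA = ptD" "flip_M ptC = ptB"
  by (rule flip_pt, rule vertices_in_W)+

lemma fixed_vertices:
  "fixed_point (JHX \<alpha> \<beta>) ptA" "fixed_point (JHX \<alpha> \<beta>) ptB" "fixed_point (JHX \<alpha> \<beta>) ptC" "fixed_point (JHX \<alpha> \<beta>) ptD"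
proof -
  have A: "fixed_point (JHX \<alpha> \<beta>) ptA" for \<alpha> \<beta>
    unfolding fixed_point_JHX_iff pt_def
  proof
    let ?z = "vector (map complex_of_real [sqrt 2, sqrt 6, sqrt 6, 2 * sqrt 2, 2, sqrt 2, 0, 0]) :: complex ^ 8"
    fix D assume D: "D \<in> tangent_space (proj ?z)"
    note z = vertices_in_W(1)
    have "cderiv D (abs_sq 7) = 0" "cderiv D (abs_sq 8) = 0" "cderiv D Ymon = 0"
      by (rule cderiv_abs_sq_vertex_78[OF D z]; simp add: vector_8)+
    then show "D J = 0 \<and> \<alpha> * D H + \<beta> * D X = 0"
      using D_J_H_X[OF D z] cderiv_abs_sq[OF D z] by simp
  qed
  have C: "fixed_point (JHX \<alpha> \<beta>) ptC" for \<alpha> \<beta>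
    unfolding fixed_point_JHX_iff pt_def
  proof
    let ?z = "vector (map complex_of_real [2, 2 * sqrt 2, sqrt 6, sqrt 6, sqrt 2, 0, 0, sqrt 2]) :: complex ^ 8"
    fix D assume D: "D \<in> tangent_space (proj ?z)"
    note z = vertices_in_W(2)
    have "cderiv D (abs_sq 6) = 0" "cderiv D (abs_sq 7) = 0" "cderiv D Ymon = 0"
      by (rule cderiv_abs_sq_vertex_67[OF D z]; simp add: vector_8)+
    then show "D J = 0 \<and> \<alpha> * D H + \<beta> * D X = 0"
      using D_J_H_X[OF D z] cderiv_abs_sq[OF D z] by simp
  qed
  show "fixed_point (JHX \<alpha> \<beta>) ptA" "fixed_point (JHX \<alpha> \<beta>) ptB" "fixed_point (JHX \<alpha> \<beta>) ptC" "fixed_point (JHX \<alpha> \<beta>) ptD"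
    using A C fixed_point_flip flip_vertices by metis+
qed

text \<open>The rates of change of all \<open>abs_sq k\<close> when \<open>abs_sq 5\<close> grows at rate 1 and \<open>abs_sq 7\<close> at rate \<open>c\<close>.\<close>

definition polygon_dir :: "real \<Rightarrow> real ^ 8" where
  "polygon_dir c = vector [- 1, - 1 - c, - c, 1 - c, 1, 1 + c, c, c - 1]"

text \<open>If \<open>J\<close> takes neither 0 nor 3 and the point does not lie over a vertex, then some direction of the
  plane changes \<open>J\<close> and is parallel to the edge that contains the point, if any. Rescaling the nonzero
  coordinates realises it by a curve in \<open>W\<close>, so \<open>J\<close> is not critical.\<close>

lemma fixed_point_off_spheres:
  assumes fp: "fixed_point (JHX \<alpha> \<beta>) (proj z)" and z: "z \<in> W" "z $ 1 \<noteq> 0" "z $ 5 \<noteq> 0"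
  shows "z $ 7 = 0 \<and> z $ 8 = 0 \<or> z $ 6 = 0 \<and> z $ 7 = 0 \<or> z $ 2 = 0 \<and> z $ 3 = 0 \<or> z $ 3 = 0 \<and> z $ 4 = 0"
proof (rule ccontr)
  assume nv: "\<not> ?thesis"
  define a where "a k = (cmod (z $ k))\<^sup>2" for k
  have a0: "a k = 0 \<longleftrightarrow> z $ k = 0" for k by (simp add: a_def)
  have ge: "0 \<le> a k" for k by (simp add: a_def)
  have eqs: "a 1 + a 5 = 6" "a 2 + a 5 + a 7 = 10" "a 3 + a 7 = 6" "a 4 - a 5 + a 7 = 4"
    "a 5 - a 6 + a 7 = 2" "a 5 - a 7 + a 8 = 4"
    using z(1) by (auto simp: W_def a_def)
  note lin = eqs ge[of 1] ge[of 2] ge[of 3] ge[of 4] ge[of 5] ge[of 6] ge[of 7] ge[of 8]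
  \<comment> \<open>The edges 2 and 6 have slope -1, the edges 4 and 8 slope 1, the edges 3 and 7 slope 0.\<close>
  define c :: real where "c = (if z $ 2 = 0 \<or> z $ 6 = 0 then -1 else if z $ 4 = 0 \<or> z $ 8 = 0 then 1 else 0)"
  have "\<forall>k. z $ k = 0 \<longrightarrow> polygon_dir c $ k = 0"
    \<comment> \<open>Two edges that are not adjacent do not meet: their equations contradict the inequalities.\<close>
    unfolding forall_8 polygon_dir_def vector_8
    using z(2,3) nv lin unfolding a0[symmetric] c_def by (auto split: if_splits)
  then have dir: "polygon_dir c $ k = 0" if "z $ k = 0" for k using that by blast
  \<comment> \<open>Where \<open>a k = 0\<close> the quotient is 0, and the coordinate stays 0.\<close>
  define x where "x k = polygon_dir c $ k / a k" for k
  define g where "g s = (\<chi> k. of_real (sqrt (1 + s * x k)) * z $ k)" for s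
  have g0: "g 0 = z" by (simp add: g_def vec_eq_iff)
  obtain g' where g': "(g has_vector_derivative g') (at 0)"
  proof (rule curve_differentiable)
    fix k
    show "\<exists>d. ((\<lambda>s. g s $ k) has_vector_derivative d) (at 0)"
      unfolding g_def vec_lambda_beta
      by (rule of_real_times_differentiable(1)[of _ "x k / 2"]) (auto intro!: derivative_eq_intros)
  qed
  have "\<forall>\<^sub>F s in nhds 0. 0 < 1 + s * x k" for k
  proof -
    have "isCont (\<lambda>s. 1 + s * x k) 0" by (intro continuous_intros)
    then have "((\<lambda>s. 1 + s * x k) \<longlongrightarrow> 1) (nhds 0)"
      by (simp add: isCont_def tendsto_nhds_iff)
    then show ?thesis by (rule order_tendstoD(1)) simp
  qed
  then have "\<forall>\<^sub>F s in nhds 0. \<forall>k. 0 < 1 + s * x k"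
    by (simp add: eventually_all_finite)
  then have sq: "\<forall>\<^sub>F s in nhds 0. \<forall>k. (cmod (g s $ k))\<^sup>2 = a k + s * polygon_dir c $ k"
  proof eventually_elim
    case (elim s)
    show ?case
    proof
      fix k
      have "(cmod (g s $ k))\<^sup>2 = (1 + s * x k) * a k"
        using elim[rule_format, of k] by (simp add: g_def norm_mult power_mult_distrib a_def)
      also have "\<dots> = a k + s * (x k * a k)" by (simp add: algebra_simps)
      also have "x k * a k = polygon_dir c $ k"
        using dir[of k] a0[of k] by (cases "z $ k = 0") (simp_all add: x_def)
      finally show "(cmod (g s $ k))\<^sup>2 = a k + s * polygon_dir c $ k" .
    qed
  qed
  then have gW: "\<forall>\<^sub>F s in nhds 0. g s \<in> W"
  proof eventually_elim
    case (elim s)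
    then show ?case using eqs by (simp add: W_def polygon_dir_def vector_8 algebra_simps)
  qed
  have "((\<lambda>s. a 1 + s * polygon_dir c $ 1) has_real_derivative - 1) (at 0)"
    by (auto intro!: derivative_eq_intros simp: polygon_dir_def vector_8)
  moreover have "\<forall>\<^sub>F s in nhds 0. a 1 + s * polygon_dir c $ 1 = (cmod (g s $ 1))\<^sup>2"
    using sq by eventually_elim simp
  ultimately have "((\<lambda>s. (cmod (g s $ 1))\<^sup>2) has_real_derivative - 1) (at 0)"
    using DERIV_cong_ev[OF refl _ refl] by fastforce
  from fixed_point_curve(1)[OF fp g' gW g0 this] show False by simp
qed

lemma fixed_points_JHX:
  assumes "\<alpha> \<noteq> 0 \<or> \<beta> \<noteq> 0"
  shows "fixed_point (JHX \<alpha> \<beta>) p \<longleftrightarrow> p \<in> {ptA, ptB, ptC, ptD} \<or>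
    (\<exists>u. u\<^sup>2 < 2 \<and> critical \<alpha> \<beta> u \<and> p = P_pt u) \<or> \<beta> = 0 \<and> p = P_pt (sqrt 2) \<or>
    (\<exists>v. v\<^sup>2 < 2 \<and> critical (- \<alpha>) \<beta> v \<and> p = Q_pt v) \<or> \<beta> = 0 \<and> p = Q_pt (sqrt 2)" (is "?L \<longleftrightarrow> ?R")
proof -
  note J0 = fixed_points_J_0[OF assms, of p]
  have J3: "fixed_point (JHX \<alpha> \<beta>) p \<and> J p = 3 \<longleftrightarrow>
      (\<exists>v. v\<^sup>2 < 2 \<and> critical (- \<alpha>) \<beta> v \<and> p = Q_pt v) \<or> \<beta> = 0 \<and> p = Q_pt (sqrt 2)"
  proof -
    have "flip_M p = P_pt v \<longleftrightarrow> p = Q_pt v" if "v\<^sup>2 \<le> 2" for v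
      using flip_P_pt[OF that] flip_M_flip_M by metis
    note fl = this
    have "fixed_point (JHX \<alpha> \<beta>) p \<and> J p = 3 \<longleftrightarrow> fixed_point (JHX (- \<alpha>) \<beta>) (flip_M p) \<and> J (flip_M p) = 0"
      by (auto simp: fixed_point_flip J_H_X_flip)
    also have "\<dots> \<longleftrightarrow> (\<exists>v. v\<^sup>2 < 2 \<and> critical (- \<alpha>) \<beta> v \<and> flip_M p = P_pt v) \<or> \<beta> = 0 \<and> flip_M p = P_pt (sqrt 2)"
      using assms by (intro fixed_points_J_0) auto
    also have "\<dots> \<longleftrightarrow> (\<exists>v. v\<^sup>2 < 2 \<and> critical (- \<alpha>) \<beta> v \<and> p = Q_pt v) \<or> \<beta> = 0 \<and> p = Q_pt (sqrt 2)"
      using fl fl[of "sqrt 2"] by (metis less_imp_le order_refl real_sqrt_pow2 zero_le_numeral)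
    finally show ?thesis .
  qed
  have "p \<in> {ptA, ptB, ptC, ptD} \<or> J p = 0 \<or> J p = 3" if fp: "fixed_point (JHX \<alpha> \<beta>) p"
  proof -
    obtain z where z: "z \<in> W" "p = proj z" by (rule proj_exhaust)
    have fz: "flip_M (proj (shift z)) = p" using z by (simp add: flip_M_proj)
    show ?thesis
    proof (cases "z $ 1 = 0 \<or> z $ 5 = 0")
      case True
      then show ?thesis using z by (auto simp: J_H_X_proj W_def)
    next
      case False
      with fixed_point_off_spheres[OF fp[unfolded z(2)] z(1)]
      have "z $ 7 = 0 \<and> z $ 8 = 0 \<or> z $ 6 = 0 \<and> z $ 7 = 0 \<or> z $ 2 = 0 \<and> z $ 3 = 0 \<or> z $ 3 = 0 \<and> z $ 4 = 0"
        by blast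
      then show ?thesis
        using z fz proj_vertex_78[of z] proj_vertex_67[of z] proj_vertex_78[of "shift z"] proj_vertex_67[of "shift z"]
          flip_vertices by auto
    qed
  qed
  then show ?thesis using J0 J3 fixed_vertices by blast
qed

section \<open>The critical equation in trigonometric form\<close>

text \<open>In terms of \<open>\<eta> = u\<^sup>2 - 1\<close> the product \<open>u\<^sup>2 * ff (u\<^sup>2)\<close> becomes the even polynomial
  \<open>(1 - \<eta>\<^sup>2) * (9 - \<eta>\<^sup>2) * (49 - \<eta>\<^sup>2)\<close>. With \<open>\<eta> = cos x\<close> this polynomial is the square of \<open>rad_N x\<close>, which is smooth
  also at the zeros \<open>\<eta> = \<plusminus> 1\<close>, and the derivative of the polynomial in \<open>\<eta>\<close> is \<open>- 2 * pol_M x\<close>.\<close>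

definition root_w :: "real \<Rightarrow> real" where "root_w x = sqrt ((9 - (cos x)\<^sup>2) * (49 - (cos x)\<^sup>2))"
definition poly_S :: "real \<Rightarrow> real" where "poly_S x = 499 - 118 * (cos x)\<^sup>2 + 3 * (cos x)\<^sup>2 * (cos x)\<^sup>2"
definition rad_N :: "real \<Rightarrow> real" where "rad_N x = sin x * root_w x"
definition pol_M :: "real \<Rightarrow> real" where "pol_M x = cos x * poly_S x"

lemma cos_sq_le_1: "(cos x)\<^sup>2 \<le> 1" for x :: real
  using abs_cos_le_one[of x] by (simp add: abs_square_le_1)

lemma root_w_arg_pos: "0 < (9 - (cos x)\<^sup>2) * (49 - (cos x)\<^sup>2)" for x :: real
  using cos_sq_le_1[of x] by (intro mult_pos_pos) linarith+

lemma root_w_pos: "0 < root_w x"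
  using root_w_arg_pos[of x] by (simp add: root_w_def)

lemma poly_S_ge: "384 \<le> poly_S x"
proof -
  have "0 \<le> (1 - (cos x)\<^sup>2) * (115 - 3 * (cos x)\<^sup>2)"
    using cos_sq_le_1[of x] by (intro mult_nonneg_nonneg) linarith+
  then show ?thesis by (simp add: poly_S_def algebra_simps)
qed

lemma ff_shifted: "ff (1 + c) = (3 + c) * (7 + c) * (7 - c) * (3 - c) * (1 - c)"
  by (simp add: ff_def)

lemma ff_deriv_shifted:
  "ff (1 + c) + (1 + c) * deriv ff (1 + c) = - 2 * c * (499 - 118 * c\<^sup>2 + 3 * c\<^sup>2 * c\<^sup>2)"
proof -
  have *: "(\<lambda>x. x * ff x) = (\<lambda>x. (1 - (x - 1)\<^sup>2) * (9 - (x - 1)\<^sup>2) * (49 - (x - 1)\<^sup>2))"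
    by (simp add: fun_eq_iff ff_def algebra_simps power2_eq_square)
  have "((\<lambda>x. x * ff x) has_real_derivative ff (1 + c) + (1 + c) * deriv ff (1 + c)) (at (1 + c))"
    by (auto intro!: derivative_eq_intros deriv_ff)
  moreover have "((\<lambda>x. x * ff x) has_real_derivative - 2 * c * (499 - 118 * c\<^sup>2 + 3 * c\<^sup>2 * c\<^sup>2)) (at (1 + c))"
    unfolding * by (auto intro!: derivative_eq_intros) (simp add: algebra_simps power2_eq_square)
  ultimately show ?thesis by (rule DERIV_unique)
qed

text \<open>The nonnegative \<open>u\<close> correspond to \<open>u\<^sup>2 = 1 + cos x\<close>, the nonpositive ones to \<open>u\<^sup>2 = 1 - cos x\<close>. Both
  lead to the same equation, since all its terms change sign together; hence the negative root is
  minus the square root of 2 minus the square of the positive one.\<close>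

lemma critical_trig:
  assumes "0 \<le> x" "x \<le> pi"
  shows "critical \<alpha> \<beta> (sqrt 2 * cos (x / 2)) \<longleftrightarrow> \<alpha> * rad_N x = 2 * \<beta> * pol_M x"
    and "critical \<alpha> \<beta> (- sqrt 2 * sin (x / 2)) \<longleftrightarrow> \<alpha> * rad_N x = 2 * \<beta> * pol_M x"
proof -
  have s: "0 \<le> sin x" using assms by (rule sin_ge_zero)
  have sc: "0 \<le> cos (x / 2)" "0 \<le> sin (x / 2)"
    using assms by (auto intro!: cos_ge_zero sin_ge_zero)
  have c2: "(sqrt 2 * cos (x / 2))\<^sup>2 = 1 + cos x" "(- sqrt 2 * sin (x / 2))\<^sup>2 = 1 + - cos x"
    using cos_double_cos[of "x / 2"] cos_double_sin[of "x / 2"] by (simp_all add: power_mult_distrib)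
  have P: "(1 + c) * ff (1 + c) = (sin x)\<^sup>2 * ((9 - (cos x)\<^sup>2) * (49 - (cos x)\<^sup>2))" if "c\<^sup>2 = (cos x)\<^sup>2" for c
    unfolding ff_shifted sin_squared_eq that[symmetric] by (simp add: algebra_simps power2_eq_square)
  have Pr: "sqrt ((1 + c) * ff (1 + c)) = rad_N x" if "c\<^sup>2 = (cos x)\<^sup>2" for c
    using s by (simp add: P[OF that] real_sqrt_mult rad_N_def root_w_def)
  have "sqrt 2 * cos (x / 2) * sqrt (ff (1 + cos x)) = rad_N x"
    using Pr[of "cos x"] sc unfolding real_sqrt_mult c2(1)[symmetric] by (simp add: real_sqrt_abs)
  then show "critical \<alpha> \<beta> (sqrt 2 * cos (x / 2)) \<longleftrightarrow> \<alpha> * rad_N x = 2 * \<beta> * pol_M x"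
    unfolding critical_def c2 ff_deriv_shifted mult.assoc by (simp add: pol_M_def poly_S_def algebra_simps)
  have "- sqrt 2 * sin (x / 2) * sqrt (ff (1 + - cos x)) = - rad_N x"
    using Pr[of "- cos x"] sc unfolding real_sqrt_mult c2(2)[symmetric] by (simp add: real_sqrt_abs)
  then show "critical \<alpha> \<beta> (- sqrt 2 * sin (x / 2)) \<longleftrightarrow> \<alpha> * rad_N x = 2 * \<beta> * pol_M x"
    unfolding critical_def c2 ff_deriv_shifted mult.assoc by (simp add: pol_M_def poly_S_def algebra_simps) linarith
qed

definition rad_N_deriv :: "real \<Rightarrow> real" where
  "rad_N_deriv x = cos x * root_w x + (sin x)\<^sup>2 * cos x * (58 - 2 * (cos x)\<^sup>2) * inverse (root_w x)"
definition pol_M_deriv :: "real \<Rightarrow> real" where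
  "pol_M_deriv x = - sin x * poly_S x + (cos x)\<^sup>2 * sin x * (236 - 12 * (cos x)\<^sup>2)"
definition wronskian :: "real \<Rightarrow> real" where "wronskian x = rad_N_deriv x * pol_M x - rad_N x * pol_M_deriv x"

lemma DERIV_rad_N: "(rad_N has_real_derivative rad_N_deriv x) (at x)"
proof -
  have "(root_w has_real_derivative sin x * cos x * (58 - 2 * (cos x)\<^sup>2) * inverse (root_w x)) (at x)"
  proof -
    have "((\<lambda>x. (9 - (cos x)\<^sup>2) * (49 - (cos x)\<^sup>2)) has_real_derivative
        2 * (sin x * cos x * (58 - 2 * (cos x)\<^sup>2))) (at x)"
      by (auto intro!: derivative_eq_intros) (simp add: algebra_simps power2_eq_square)
    from DERIV_chain2[OF DERIV_real_sqrt[OF root_w_arg_pos] this] show ?thesis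
      unfolding root_w_def[symmetric, abs_def] by (rule DERIV_cong) simp
  qed
  then show ?thesis
    unfolding rad_N_def[abs_def] rad_N_deriv_def by (auto intro!: derivative_eq_intros simp: power2_eq_square)
qed

lemma DERIV_pol_M: "(pol_M has_real_derivative pol_M_deriv x) (at x)"
  unfolding pol_M_def[abs_def] pol_M_deriv_def poly_S_def
  by (auto intro!: derivative_eq_intros) (simp add: algebra_simps power2_eq_square)

text \<open>This makes the critical equation have a unique, nondegenerate solution. It expresses that the square root of
  \<open>\<zeta> * ff \<zeta>\<close> is a concave function of \<open>\<zeta>\<close>. After collecting terms, the only negative contribution is at most
  \<open>236 * root_w x\<close> in absolute value, against at least \<open>384 * root_w x\<close>.\<close>

lemma wronskian_pos: "0 < wronskian x"
proof -
  let ?c = "(cos x)\<^sup>2" and ?s = "(sin x)\<^sup>2"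
  have s: "?s = 1 - ?c" by (rule sin_squared_eq)
  have c: "0 \<le> ?c" "?c \<le> 1" using cos_sq_le_1[of x] by simp_all
  have "wronskian x = root_w x * (?c * poly_S x + ?s * poly_S x) + ?s * ?c * (58 - 2 * ?c) * poly_S x * inverse (root_w x)
      - ?s * ?c * (236 - 12 * ?c) * root_w x"
    by (simp add: wronskian_def rad_N_deriv_def pol_M_deriv_def rad_N_def pol_M_def algebra_simps power2_eq_square)
  also have "?c * poly_S x + ?s * poly_S x = poly_S x" unfolding s by (simp add: algebra_simps)
  finally have K: "wronskian x = root_w x * (poly_S x - ?s * ?c * (236 - 12 * ?c)) + ?s * ?c * (58 - 2 * ?c) * poly_S x * inverse (root_w x)"
    by (simp add: algebra_simps)
  have "?s * ?c * (236 - 12 * ?c) \<le> 1 * 236"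
    using c s by (intro mult_mono mult_le_one) auto
  then have "0 < root_w x * (poly_S x - ?s * ?c * (236 - 12 * ?c))"
    using root_w_pos[of x] poly_S_ge[of x] by (intro mult_pos_pos) linarith+
  moreover have "0 \<le> ?s * ?c * (58 - 2 * ?c) * poly_S x * inverse (root_w x)"
    using root_w_pos[of x] poly_S_ge[of x] c by (intro mult_nonneg_nonneg) auto
  ultimately show ?thesis unfolding K by linarith
qed

lemma rad_N_pos: "0 < x \<Longrightarrow> x < pi \<Longrightarrow> 0 < rad_N x"
  by (simp add: rad_N_def root_w_pos sin_gt_zero)

lemma quotient_strict_antimono:
  assumes "0 < x" "x < y" "y < pi"
  shows "pol_M y / rad_N y < pol_M x / rad_N x"
proof (rule DERIV_neg_imp_decreasing[OF assms(2)])
  fix z assume z: "x \<le> z" "z \<le> y"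
  then have "0 < rad_N z" using assms by (intro rad_N_pos) auto
  then have "((\<lambda>z. pol_M z / rad_N z) has_real_derivative - wronskian z / (rad_N z * rad_N z)) (at z)"
    by (auto intro!: derivative_eq_intros DERIV_rad_N DERIV_pol_M simp: wronskian_def)
  moreover have "- wronskian z / (rad_N z * rad_N z) < 0"
    using wronskian_pos[of z] \<open>0 < rad_N z\<close> by (simp add: divide_neg_pos)
  ultimately show "\<exists>d. ((\<lambda>z. pol_M z / rad_N z) has_real_derivative d) (at z) \<and> d < 0" by blast
qed

lemma quotient_inj:
  assumes "0 < x" "x < pi" "0 < y" "y < pi" "pol_M x / rad_N x = pol_M y / rad_N y"
  shows "x = y"
  using quotient_strict_antimono[of x y] quotient_strict_antimono[of y x] assms by force

lemma pol_M_endpoints: "0 < pol_M 0" "pol_M pi < 0" "pol_M (pi / 2) = 0" "rad_N 0 = 0" "rad_N pi = 0"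
  by (simp_all add: pol_M_def rad_N_def poly_S_def)

lemma smooth_trig:
  "C_k_on k U root_w" "C_k_on k U rad_N" "C_k_on k U pol_M" "C_k_on k U wronskian"
proof -
  have sc: "C_k_on k U sin" "C_k_on k U cos" using C_k_on_sin_cos by auto
  have c2: "C_k_on k U (\<lambda>x. (cos x)\<^sup>2)" "C_k_on k U (\<lambda>x. (sin x)\<^sup>2)"
    unfolding power2_eq_square by (intro C_k_on_mult sc)+
  have aff: "C_k_on k U (\<lambda>x. a - b * f x)" if "C_k_on k U f" for a b and f :: "real \<Rightarrow> real"
    using C_k_on_add[OF C_k_on_const[of k U a] C_k_on_mult[OF C_k_on_const[of k U "-b"] that]] by simp
  have aff': "C_k_on k U (\<lambda>x. a - f x)" if "C_k_on k U f" for a and f :: "real \<Rightarrow> real"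
    using aff[OF that, of a 1] by simp
  show w: "C_k_on k U root_w"
    unfolding root_w_def[abs_def]
    by (rule C_k_on_compose_real[OF C_k_on_sqrt]) (intro C_k_on_mult aff' c2, use root_w_arg_pos in auto)
  have S: "C_k_on k U poly_S"
    unfolding poly_S_def[abs_def] by (intro C_k_on_add aff c2 C_k_on_mult C_k_on_const)
  have iw: "C_k_on k U (\<lambda>x. inverse (root_w x))"
    by (rule C_k_on_compose_real[OF C_k_on_inverse w]) (use root_w_pos in auto)
  show N: "C_k_on k U rad_N" unfolding rad_N_def[abs_def] by (intro C_k_on_mult sc w)
  show M: "C_k_on k U pol_M" unfolding pol_M_def[abs_def] by (intro C_k_on_mult sc S)
  have neg: "C_k_on k U (\<lambda>x. - sin x)" using aff'[OF sc(1), of 0] by simp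
  have "C_k_on k U rad_N_deriv" "C_k_on k U pol_M_deriv"
    unfolding rad_N_deriv_def[abs_def] pol_M_deriv_def[abs_def]
    by (intro C_k_on_add C_k_on_mult sc S c2 iw aff w neg)+
  then have "C_k_on k U (\<lambda>x. rad_N_deriv x * pol_M x + (-1) * (rad_N x * pol_M_deriv x))"
    by (intro C_k_on_add C_k_on_mult C_k_on_const N M)
  then show "C_k_on k U wronskian" by (simp add: wronskian_def[abs_def])
qed

section \<open>The solution branches\<close>

text \<open>Solved for \<open>t\<close>, the equation reads \<open>t = T x\<close> with \<open>T = rad_N / (2 * rad_N + 2 * \<gamma> * pol_M)\<close>, and
  \<open>T'\<close> is a positive multiple of the Wronskian. So \<open>T\<close> has an inverse on any interval where the
  denominator is positive. Such an interval exists around the whole range from \<open>x = 0\<close>, where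
  \<open>T = 0\<close>, to the point \<open>x1\<close> where \<open>T = 1\<close>; the inverse is then smooth beyond both ends of \<open>[0,1]\<close>.\<close>

lemma phase_solution:
  assumes \<gamma>: "0 < (\<gamma>::real)"
  obtains \<psi> U where "open U" "{0..1} \<subseteq> U" "\<And>k. C_k_on k U \<psi>" "\<psi> 0 = 0"
    "\<And>t. t \<in> {0<..1} \<Longrightarrow> 0 < \<psi> t \<and> \<psi> t < pi"
    "\<And>t. t \<in> {0..1} \<Longrightarrow> (1 - 2 * t) * rad_N (\<psi> t) = 2 * (t * \<gamma>) * pol_M (\<psi> t)"
proof -
  define Df where "Df x = 2 * rad_N x + 2 * \<gamma> * pol_M x" for x
  define T where "T x = rad_N x / Df x" for x
  have cont: "isCont rad_N x" "isCont pol_M x" for x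
    using DERIV_isCont DERIV_rad_N DERIV_pol_M by blast+
  then have contD: "isCont Df x" for x unfolding Df_def[abs_def] by (intro continuous_intros)
  \<comment> \<open>The equation for \<open>t = 1\<close> has a solution by the intermediate value theorem.\<close>
  have "\<exists>x\<ge>pi / 2. x \<le> pi \<and> rad_N x + 2 * \<gamma> * pol_M x = 0"
  proof (rule IVT2)
    show "rad_N pi + 2 * \<gamma> * pol_M pi \<le> 0" "0 \<le> rad_N (pi / 2) + 2 * \<gamma> * pol_M (pi / 2)"
      using pol_M_endpoints \<gamma> rad_N_pos[of "pi / 2"] by (simp_all add: mult_nonneg_nonpos)
  qed (auto intro!: continuous_intros cont)
  then obtain x1 where x1: "pi / 2 \<le> x1" "x1 \<le> pi" "rad_N x1 + 2 * \<gamma> * pol_M x1 = 0" by blast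
  have x1': "0 < x1" "x1 < pi"
    using x1 pol_M_endpoints \<gamma> pi_gt_zero by (auto simp: less_le)
  have Dpos: "0 < Df x" if "0 \<le> x" "x \<le> x1" for x
  proof (cases "x = 0")
    case True
    then show ?thesis using pol_M_endpoints \<gamma> by (simp add: Df_def)
  next
    case False
    then have N: "0 < rad_N x" "0 < rad_N x1" using that x1' by (auto intro!: rad_N_pos)
    \<comment> \<open>The denominator divided by \<open>rad_N\<close> decreases in \<open>x\<close>, and it is still 1 at \<open>x1\<close>.\<close>
    have "pol_M x1 / rad_N x1 \<le> pol_M x / rad_N x"
      using that x1' False quotient_strict_antimono[of x x1] by (cases "x = x1") auto
    moreover have "pol_M x1 / rad_N x1 = - 1 / (2 * \<gamma>)" using x1(3) N \<gamma> by (simp add: field_simps)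
    ultimately have "- rad_N x \<le> 2 * \<gamma> * pol_M x" using N \<gamma> by (simp add: field_simps)
    then show ?thesis using N by (simp add: Df_def)
  qed
  have near: "\<exists>e>0. \<forall>x. \<bar>x - y\<bar> < e \<longrightarrow> 0 < Df x" if "0 < Df y" for y
  proof -
    have "\<forall>\<^sub>F x in nhds y. 0 < Df x"
      using contD[of y] that by (intro order_tendstoD(1)[of Df "Df y"]) (simp_all add: isCont_def tendsto_nhds_iff)
    then show ?thesis unfolding eventually_nhds_metric by (simp add: dist_real_def)
  qed
  obtain e1 where e1: "e1 > 0" "\<And>x. \<bar>x - 0\<bar> < e1 \<Longrightarrow> 0 < Df x"
    using near[OF Dpos[of 0]] x1' by auto
  obtain e2 where e2: "e2 > 0" "\<And>x. \<bar>x - x1\<bar> < e2 \<Longrightarrow> 0 < Df x"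
    using near[OF Dpos[of x1]] x1' by auto
  define a b where "a = - e1 / 2" "b = x1 + e2 / 2"
  have ab: "a < 0" "x1 < b" using e1 e2 by (simp_all add: a_b_def)
  have D: "0 < Df x" if "a \<le> x" "x \<le> b" for x
  proof -
    have "x < 0 \<or> 0 \<le> x \<and> x \<le> x1 \<or> x1 < x" by linarith
    then show ?thesis
      using that e1(2)[of x] e2(2)[of x] Dpos[of x] e1(1) e2(1) unfolding a_b_def by auto
  qed
  have dT: "(T has_real_derivative 2 * \<gamma> * wronskian x / (Df x * Df x)) (at x)" if "a \<le> x" "x \<le> b" for x
  proof -
    have "(Df has_real_derivative 2 * rad_N_deriv x + 2 * \<gamma> * pol_M_deriv x) (at x)"
      unfolding Df_def[abs_def] by (auto intro!: derivative_eq_intros DERIV_rad_N DERIV_pol_M)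
    then show ?thesis
      unfolding T_def[abs_def] using D[OF that]
      by (auto intro!: derivative_eq_intros DERIV_rad_N) (simp add: Df_def wronskian_def algebra_simps)
  qed
  have Tmono: "T x < T y" if "a \<le> x" "x < y" "y \<le> b" for x y
  proof (rule DERIV_pos_imp_increasing[OF that(2)])
    fix z assume "x \<le> z" "z \<le> y"
    then have z: "a \<le> z" "z \<le> b" using that by auto
    have "0 < 2 * \<gamma> * wronskian z / (Df z * Df z)" using D[OF z] wronskian_pos[of z] \<gamma> by simp
    with dT[OF z] show "\<exists>d. (T has_real_derivative d) (at z) \<and> 0 < d" by blast
  qed
  have T01: "T 0 = 0" "T x1 = 1"
    using x1(3) Dpos[of x1] x1' pol_M_endpoints by (auto simp: T_def Df_def)
  define g where "g y = (SOME x. a < x \<and> x < b \<and> T x = y)" for y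
  have gT: "g (T x) = x" if "a < x" "x < b" for x
  proof -
    have "a < g (T x) \<and> g (T x) < b \<and> T (g (T x)) = T x"
      unfolding g_def by (rule someI[of _ x]) (use that in simp)
    then show ?thesis using Tmono[of x "g (T x)"] Tmono[of "g (T x)" x] that by force
  qed
  let ?U = "{T a<..<T b}"
  have surj: "\<exists>x. a < x \<and> x < b \<and> T x = y" if "y \<in> ?U" for y
  proof -
    have "\<exists>x\<ge>a. x \<le> b \<and> T x = y"
      using that ab x1' by (intro IVT) (auto intro!: DERIV_isCont[OF dT])
    with that show ?thesis by (metis greaterThanLessThan_iff less_le less_irrefl)
  qed
  have g: "a < g y" "g y < b" "T (g y) = y" if "y \<in> ?U" for y
    using surj[OF that] gT by auto
  define V where "V x = Df x * Df x * inverse (2 * \<gamma> * wronskian x)" for x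
  have dg: "(g has_real_derivative V (g y)) (at y)" if y: "y \<in> ?U" for y
  proof -
    let ?x = "g y"
    have x: "?x \<in> {a<..<b}" using g[OF y] by simp
    have K: "2 * \<gamma> * wronskian ?x \<noteq> 0" using wronskian_pos[of ?x] \<gamma> by simp
    have "(g has_derivative (*) (V ?x)) (at y)"
    proof (rule has_derivative_inverse_strong_x[where S = "{a<..<b}" and f = T])
      show "(T has_derivative (*) (2 * \<gamma> * wronskian ?x / (Df ?x * Df ?x))) (at ?x)"
        using dT[of ?x] x by (simp add: has_field_derivative_def)
      show "(*) (2 * \<gamma> * wronskian ?x / (Df ?x * Df ?x)) \<circ> (*) (V ?x) = id"
      proof -
        have "2 * \<gamma> * wronskian ?x / (Df ?x * Df ?x) * V ?x = 1"
          using K D[of ?x] x by (simp add: V_def field_simps)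
        then show ?thesis by (simp only: fun_eq_iff comp_def id_def mult.assoc[symmetric]) simp
      qed
      show "continuous_on {a<..<b} T"
        by (intro continuous_at_imp_continuous_on ballI DERIV_isCont[OF dT]) auto
    qed (use x gT g[OF y] in auto)
    then show ?thesis by (simp add: has_field_derivative_def)
  qed
  have smD: "C_k_on k UNIV Df" for k
    unfolding Df_def[abs_def] by (intro C_k_on_add C_k_on_mult C_k_on_const smooth_trig)
  have smV: "C_k_on k UNIV V" for k
    unfolding V_def[abs_def]
  proof (intro C_k_on_mult smD)
    show "C_k_on k UNIV (\<lambda>x. inverse (2 * \<gamma> * wronskian x))"
      by (rule C_k_on_compose_real[OF C_k_on_inverse]) 
        (intro C_k_on_mult C_k_on_const smooth_trig, use wronskian_pos \<gamma> in auto)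
  qed
  have U: "{0..1} \<subseteq> ?U"
    using Tmono[of a 0] Tmono[of x1 b] ab x1' T01 by auto
  show thesis
  proof (rule that[of ?U g])
    show "C_k_on k ?U g" for k
      by (rule smooth_autonomous_ode[OF smV _ dg]) auto
    show "g 0 = 0" using gT[of 0] T01 ab x1' by simp
    show "(1 - 2 * t) * rad_N (g t) = 2 * (t * \<gamma>) * pol_M (g t)" if "t \<in> {0..1}" for t
    proof -
      have t: "t \<in> ?U" using that U by blast
      then have "T (g t) = t" "0 < Df (g t)" using g[OF t] D by simp_all
      then have "rad_N (g t) = t * Df (g t)" unfolding T_def by (metis nonzero_eq_divide_eq less_irrefl)
      then show ?thesis unfolding Df_def by (simp add: algebra_simps)
    qed
    show "0 < g t \<and> g t < pi" if "t \<in> {0<..1}" for t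
    proof -
      have "t \<in> {0..1}" using that by simp
      with U have t: "t \<in> ?U" by blast
      note gt = g[OF t]
      have "0 < g t" using Tmono[of "g t" 0] gt T01 that ab x1' by (cases "g t = 0") force+
      moreover have "g t \<le> x1" using Tmono[of x1 "g t"] gt T01 that ab x1' by force
      ultimately show ?thesis using x1' by simp
    qed
  qed (use U in auto)
qed

text \<open>For \<open>t > 0\<close> the equation prescribes the value of \<open>pol_M / rad_N\<close>, which is injective on \<open>(0, \<pi>)\<close>.
  The endpoints are excluded because \<open>rad_N\<close> vanishes there and \<open>pol_M\<close> does not.\<close>

lemma critical_roots:
  assumes \<gamma>: "0 < \<gamma>" and t: "t \<in> {0<..1}" and y: "0 < y" "y < pi"
    and eq: "(1 - 2 * t) * rad_N y = 2 * (t * \<gamma>) * pol_M y" and u: "u\<^sup>2 \<le> 2"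
  shows "critical (1 - 2 * t) (t * \<gamma>) u \<longleftrightarrow> u = sqrt 2 * cos (y / 2) \<or> u = - sqrt 2 * sin (y / 2)"
proof
  assume "u = sqrt 2 * cos (y / 2) \<or> u = - sqrt 2 * sin (y / 2)"
  then show "critical (1 - 2 * t) (t * \<gamma>) u"
    using critical_trig[of y "1 - 2 * t" "t * \<gamma>"] y eq by (elim disjE) simp_all
next
  assume L: "critical (1 - 2 * t) (t * \<gamma>) u"
  have unique: "x = y" if x: "0 \<le> x" "x \<le> pi" "(1 - 2 * t) * rad_N x = 2 * (t * \<gamma>) * pol_M x" for x
  proof -
    have tg: "0 < t * \<gamma>" using t \<gamma> by simp
    have x': "0 < x" "x < pi"
      using x tg pol_M_endpoints by (auto simp: less_le)
    have q: "pol_M z / rad_N z = (1 - 2 * t) / (2 * (t * \<gamma>))"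
      if "0 < z" "z < pi" "(1 - 2 * t) * rad_N z = 2 * (t * \<gamma>) * pol_M z" for z
          proof -
      have "pol_M z * (2 * (t * \<gamma>)) = (1 - 2 * t) * rad_N z" using that(3) by (simp only: mult_ac)
      then show ?thesis using rad_N_pos[OF that(1,2)] tg by (subst frac_eq_eq) auto
    qed
    show ?thesis
      by (rule quotient_inj[OF x' y]) (simp only: q[OF x' x(3)] q[OF y eq])
  qed
  have a: "\<bar>u / sqrt 2\<bar> \<le> 1"
  proof -
    have "\<bar>u\<bar> \<le> sqrt 2" using real_sqrt_le_mono[OF u] by simp
    then have "\<bar>u\<bar> / sqrt 2 \<le> 1" by (subst divide_le_eq_1_pos) simp_all
    moreover have "\<bar>u / sqrt 2\<bar> = \<bar>u\<bar> / sqrt 2" by (simp only: abs_divide) simp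
    ultimately show ?thesis by (simp only:)
  qed
  have a1: "- 1 \<le> u / sqrt 2" "u / sqrt 2 \<le> 1" and a2: "- 1 \<le> - (u / sqrt 2)" "- (u / sqrt 2) \<le> 1"
    using a by linarith+
  show "u = sqrt 2 * cos (y / 2) \<or> u = - sqrt 2 * sin (y / 2)"
  proof (cases "0 \<le> u")
    case True
    define x where "x = 2 * arccos (u / sqrt 2)"
    have u': "u = sqrt 2 * cos (x / 2)" using a by (simp add: x_def cos_arccos_abs)
    have "arccos (u / sqrt 2) \<le> pi / 2" using True by (intro arccos_le_pi2 a1(2)) simp
    moreover have "0 \<le> arccos (u / sqrt 2)" by (rule arccos_lbound[OF a1])
    ultimately have x: "0 \<le> x" "x \<le> pi" by (simp_all add: x_def)
    with unique[OF x] L show ?thesis unfolding u' using critical_trig(1)[OF x] by blast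
  next
    case False
    define x where "x = 2 * arcsin (- (u / sqrt 2))"
    have u': "u = - sqrt 2 * sin (x / 2)" unfolding x_def using sin_arcsin[OF a2] by simp
    have "arcsin (- (u / sqrt 2)) \<le> pi / 2" by (rule arcsin_ubound[OF a2])
    moreover have "0 \<le> arcsin (- (u / sqrt 2))"
      using False a2(2) arcsin_le_mono[of 0 "- (u / sqrt 2)"] by (simp add: divide_nonpos_pos)
    ultimately have x: "0 \<le> x" "x \<le> pi" by (simp_all add: x_def)
    with unique[OF x] L show ?thesis unfolding u' using critical_trig(2)[OF x] by blast
  qed
qed

lemma u_solution_iff:
  "u_solution \<gamma> u \<longleftrightarrow> u \<in> {0..1} \<rightarrow>\<^sub>E {- sqrt 2..sqrt 2} \<and> smooth_on {0..1} u \<and>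
    (\<forall>t\<in>{0..1}. critical (1 - 2 * t) (t * \<gamma>) (u t))"
  unfolding u_solution_def critical_def by (simp add: algebra_simps)

lemma u_solutions_exist:
  assumes \<gamma>: "0 < \<gamma>"
  obtains u\<^sub>p u\<^sub>m where "u_solution \<gamma> u\<^sub>p" "u\<^sub>p 0 = sqrt 2" "u_solution \<gamma> u\<^sub>m" "u\<^sub>m 0 = 0"
    "\<forall>t\<in>{0<..1}. u\<^sub>m t < 0 \<and> 0 < u\<^sub>p t"
    "\<forall>t\<in>{0<..1}. \<forall>u. u\<^sup>2 \<le> 2 \<longrightarrow>
      (critical (1 - 2 * t) (t * \<gamma>) u \<longleftrightarrow> u = u\<^sub>p t \<or> u = u\<^sub>m t)"
proof -
  obtain \<psi> U where U: "open U" "{0..1} \<subseteq> U" "\<And>k. C_k_on k U \<psi>" "\<psi> 0 = 0"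
    and \<psi>: "\<And>t. t \<in> {0<..1} \<Longrightarrow> 0 < \<psi> t \<and> \<psi> t < pi"
    and eq: "\<And>t. t \<in> {0..1} \<Longrightarrow> (1 - 2 * t) * rad_N (\<psi> t) = 2 * (t * \<gamma>) * pol_M (\<psi> t)"
    by (rule phase_solution[OF \<gamma>]) (rule that)
  define up where "up t = (if t \<in> {0..1} then sqrt 2 * cos (\<psi> t / 2) else undefined)" for t
  define um where "um t = (if t \<in> {0..1} then - sqrt 2 * sin (\<psi> t / 2) else undefined)" for t
  have range: "0 \<le> \<psi> t \<and> \<psi> t \<le> pi" if "t \<in> {0..1}" for t
    using that \<psi>[of t] U(4) by (cases "t = 0") auto
  have sm: "C_k_on k U (\<lambda>t. a * h (\<psi> t / 2))" if "\<And>k. C_k_on k UNIV h" for k a and h :: "real \<Rightarrow> real"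
  proof -
    have "C_k_on k U (\<lambda>t. \<psi> t * (1/2))"
      by (rule C_k_on_mult[OF U(3) C_k_on_const])
    from C_k_on_compose_real[OF that this]
    have "C_k_on k U (\<lambda>t. h (\<psi> t / 2))" by simp
    then show ?thesis by (rule C_k_on_mult[OF C_k_on_const])
  qed
  have smooth: "smooth_on {0..1} f"
    if h: "\<And>k. C_k_on k UNIV h" and f: "\<And>t. t \<in> {0..1} \<Longrightarrow> f t = a * h (\<psi> t / 2)" for f a and h :: "real \<Rightarrow> real"
    unfolding smooth_on_def
  proof
    fix t :: real assume "t \<in> {0..1}"
    then have "t \<in> U" using U(2) by blast
    have "\<forall>k. C_k_on k U (\<lambda>t. a * h (\<psi> t / 2))" using sm[OF h] by blast
    then show "\<exists>V g. open V \<and> t \<in> V \<and> (\<forall>k. C_k_on k V g) \<and> (\<forall>y\<in>V \<inter> {0..1}. g y = f y)"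
      using U(1) \<open>t \<in> U\<close> f by (intro exI[of _ U] exI[of _ "\<lambda>t. a * h (\<psi> t / 2)"]) simp
  qed
  have bounds: "\<bar>sqrt 2 * x\<bar> \<le> sqrt 2" if "\<bar>x\<bar> \<le> 1" for x
    using that by (simp add: abs_mult)
  show thesis
  proof (rule that[of up um])
    show "u_solution \<gamma> up"
      unfolding u_solution_iff
    proof (intro conjI ballI)
      show "up \<in> {0..1} \<rightarrow>\<^sub>E {- sqrt 2..sqrt 2}"
        using bounds[OF abs_cos_le_one, unfolded abs_le_iff]
        by (simp add: PiE_iff extensional_def up_def minus_le_iff del: real_sqrt_le_iff mult_le_cancel_left1)
      show "smooth_on {0..1} up"
        by (rule smooth[of cos _ "sqrt 2"]) (simp_all add: C_k_on_sin_cos up_def)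
      show "critical (1 - 2 * t) (t * \<gamma>) (up t)" if "t \<in> {0..1}" for t
        using critical_trig(1)[of "\<psi> t"] range[OF that] eq[OF that] that by (simp add: up_def)
    qed
    show "u_solution \<gamma> um"
      unfolding u_solution_iff
    proof (intro conjI ballI)
      show "um \<in> {0..1} \<rightarrow>\<^sub>E {- sqrt 2..sqrt 2}"
        using bounds[OF abs_sin_le_one, unfolded abs_le_iff]
        by (simp add: PiE_iff extensional_def um_def minus_le_iff del: real_sqrt_le_iff mult_le_cancel_left1)
      show "smooth_on {0..1} um"
        by (rule smooth[of sin _ "- sqrt 2"]) (simp_all add: C_k_on_sin_cos um_def)
      show "critical (1 - 2 * t) (t * \<gamma>) (um t)" if "t \<in> {0..1}" for t
        using critical_trig(2)[of "\<psi> t"] range[OF that] eq[OF that] that by (simp add: um_def)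
    qed
    show "up 0 = sqrt 2" "um 0 = 0" by (simp_all add: up_def um_def U)
    show "\<forall>t\<in>{0<..1}. um t < 0 \<and> 0 < up t"
    proof
      fix t :: real assume that: "t \<in> {0<..1}"
      show "um t < 0 \<and> 0 < up t"
        using that \<psi>[OF that] by (auto simp: up_def um_def intro!: mult_pos_pos sin_gt_zero cos_gt_zero)
    qed
    show "\<forall>t\<in>{0<..1}. \<forall>u. u\<^sup>2 \<le> 2 \<longrightarrow> (critical (1 - 2 * t) (t * \<gamma>) u \<longleftrightarrow> u = up t \<or> u = um t)"
    proof (intro ballI allI impI)
      fix t u :: real assume that: "t \<in> {0<..1}" "u\<^sup>2 \<le> 2"
      show "critical (1 - 2 * t) (t * \<gamma>) u \<longleftrightarrow> u = up t \<or> u = um t"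
        using critical_roots[OF \<gamma> that(1) _ _ _ that(2), of "\<psi> t"] \<psi>[OF that(1)] eq[of t] that(1)
        by (simp add: up_def um_def)
    qed
  qed
qed

lemma abs_le_sqrt2_iff: "u \<in> {- sqrt 2..sqrt 2} \<longleftrightarrow> u\<^sup>2 \<le> 2"
  using abs_le_square_iff[of u "sqrt 2"] by (auto simp: abs_le_iff)

text \<open>A solution takes one of the two values \<open>u\<^sub>m t < u\<^sub>p t\<close> at each time, also at time 0 by the initial
  condition. Being continuous and never equal to their mean, it cannot change branch.\<close>

lemma u_solution_unique:
  assumes sol: "u_solution \<gamma> u\<^sub>p" "u\<^sub>p 0 = sqrt 2" "u_solution \<gamma> u\<^sub>m" "u\<^sub>m 0 = 0"
    and sign: "\<forall>t\<in>{0<..1}. u\<^sub>m t < 0 \<and> 0 < u\<^sub>p t"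
    and roots: "\<forall>t\<in>{0<..1}. \<forall>u. u\<^sup>2 \<le> 2 \<longrightarrow>
      (critical (1 - 2 * t) (t * \<gamma>) u \<longleftrightarrow> u = u\<^sub>p t \<or> u = u\<^sub>m t)"
    and u: "u_solution \<gamma> u"
  shows "u 0 = sqrt 2 \<Longrightarrow> u = u\<^sub>p" and "u 0 = 0 \<Longrightarrow> u = u\<^sub>m"
proof -
  define h where "h t = u t - (u\<^sub>p t + u\<^sub>m t) / 2" for t
  have ext: "f \<in> extensional {0..1}" and bd: "\<And>t. t \<in> {0..1} \<Longrightarrow> (f t)\<^sup>2 \<le> 2"
    and cont: "continuous_on {0..1} f" if "u_solution \<gamma> f" for f
    using that abs_le_sqrt2_iff unfolding u_solution_iff by (auto intro: smooth_on_continuous simp: PiE_iff)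
  have less: "u\<^sub>m t < u\<^sub>p t" if "t \<in> {0..1}" for t
    using that bspec[OF sign, of t] sol by (cases "t = 0") auto
  have two: "u t = u\<^sub>p t \<or> u t = u\<^sub>m t" if "t \<in> {0<..1}" for t
  proof -
    have t: "t \<in> {0..1}" using that by simp
    with u have "critical (1 - 2 * t) (t * \<gamma>) (u t)" unfolding u_solution_iff by blast
    with roots that bd[OF u t] show ?thesis by blast
  qed
  have ch: "continuous_on {0..1} h"
    unfolding h_def[abs_def] by (intro continuous_intros cont u sol) auto
  have const: "u t = (if 0 < h 0 then u\<^sub>p t else u\<^sub>m t)"
    if h0: "u 0 = u\<^sub>p 0 \<or> u 0 = u\<^sub>m 0" and t: "t \<in> {0..1}" for t
  proof -
    have two': "u s = u\<^sub>p s \<or> u s = u\<^sub>m s" if "s \<in> {0..1}" for s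
      using that two[of s] h0 by (cases "s = 0") auto
    have nz: "h s \<noteq> 0" if "s \<in> {0..1}" for s
      using two'[OF that] less[OF that] by (auto simp: h_def field_simps)
    have "continuous_on {0..t} h" using ch by (rule continuous_on_subset) (use t in auto)
    then have "0 < h t \<longleftrightarrow> 0 < h 0"
      using IVT'[of h 0 0 t] IVT2'[of h t 0 0] nz t by (force simp: not_less)
    then show ?thesis using two'[OF t] less[OF t] by (auto simp: h_def field_simps split: if_splits)
  qed
  show "u = u\<^sub>p" if "u 0 = sqrt 2"
    using const that sol by (intro extensionalityI[OF ext[OF u] ext[OF sol(1)]]) (simp add: h_def)
  show "u = u\<^sub>m" if "u 0 = 0"
    using const that sol by (intro extensionalityI[OF ext[OF u] ext[OF sol(3)]]) (simp add: h_def)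
qed

text \<open>The equations for \<open>u\<close> and \<open>v\<close> differ by the sign of the unknown. Outside \<open>[0,1]\<close> the value must stay
  \<^const>\<open>undefined\<close> for extensional functions to be mapped to extensional ones.\<close>

definition negate :: "(real \<Rightarrow> real) \<Rightarrow> real \<Rightarrow> real" where
  "negate u = (\<lambda>t. if t \<in> {0..1} then - u t else undefined)"

lemma critical_minus: "critical (- \<alpha>) \<beta> (- u) \<longleftrightarrow> critical \<alpha> \<beta> u"
  by (simp add: critical_def)

lemma v_solution_iff:
  "v_solution \<gamma> v \<longleftrightarrow> v \<in> {0..1} \<rightarrow>\<^sub>E {- sqrt 2..sqrt 2} \<and> smooth_on {0..1} v \<and>
    (\<forall>t\<in>{0..1}. critical (1 - 2 * t) (t * \<gamma>) (- v t))"
  unfolding v_solution_def critical_def by (simp add: algebra_simps)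

lemma smooth_on_uminus:
  fixes f :: "real \<Rightarrow> real"
  assumes "smooth_on S f" "\<And>x. x \<in> S \<Longrightarrow> g x = - f x"
  shows "smooth_on S g"
  unfolding smooth_on_def
proof
  fix x assume "x \<in> S"
  then obtain U h where U: "open U" "x \<in> U" "\<forall>k. C_k_on k U h" "\<forall>y\<in>U \<inter> S. h y = f y"
    using assms(1) unfolding smooth_on_def by blast
  have "C_k_on k U (\<lambda>x. - h x)" for k
    using U(3) by (intro C_k_on_bounded_linear[OF bounded_linear_minus[OF bounded_linear_ident]]) blast
  with U show "\<exists>U h. open U \<and> x \<in> U \<and> (\<forall>k. C_k_on k U h) \<and> (\<forall>y\<in>U \<inter> S. h y = g y)"
    using assms(2)
    by (intro exI[of _ U] exI[of _ "\<lambda>x. - h x"]) auto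
qed

lemma negate_negate: "v \<in> extensional {0..1} \<Longrightarrow> negate (negate v) = v"
  by (auto simp: negate_def extensional_def fun_eq_iff)

lemma u_solution_negate: "v_solution \<gamma> v \<Longrightarrow> u_solution \<gamma> (negate v)"
  unfolding u_solution_iff v_solution_iff
  by (auto intro!: smooth_on_uminus[of _ v "negate v"]) (auto simp: negate_def PiE_iff extensional_def minus_le_iff)

lemma v_solution_negate: "u_solution \<gamma> u \<Longrightarrow> v_solution \<gamma> (negate u)"
  unfolding u_solution_iff v_solution_iff
  by (auto intro!: smooth_on_uminus[of _ u "negate u"]) (auto simp: negate_def PiE_iff extensional_def minus_le_iff)

section \<open>Counting the fixed points\<close>

lemma J_P_pt: "u\<^sup>2 \<le> 2 \<Longrightarrow> J (P_pt u) = 0" and H_P_pt: "u\<^sup>2 \<le> 2 \<Longrightarrow> H (P_pt u) = (2 + u\<^sup>2) / 2"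
  and X_P_pt: "u\<^sup>2 \<le> 2 \<Longrightarrow> X (P_pt u) = u * sqrt (ff (u\<^sup>2))"
  by (simp_all add: P_pt_eq J_H_X_proj sphere_rep_in_W Ymon_sphere_rep)

lemma J_vertices: "J ptA = 1" "J ptB = 1" "J ptC = 2" "J ptD = 2"
  and H_vertices: "H ptA = 3" "H ptB = 0" "H ptC = 3" "H ptD = 0"
proof -
  show A: "J ptA = 1" "H ptA = 3" and C: "J ptC = 2" "H ptC = 3"
    using vertices_in_W by (simp_all add: pt_def J_H_X_proj vector_8)
  show "J ptB = 1" "H ptB = 0" "J ptD = 2" "H ptD = 0"
    using A C J_H_X_flip[of ptA] J_H_X_flip[of ptC] by (simp_all add: flip_vertices)
qed

lemma P_pt_even: "u\<^sup>2 = 2 \<Longrightarrow> P_pt u = P_pt (sqrt 2)"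
  unfolding P_pt_eq[of u] by (rule proj_sphere_rep_rim) simp

lemma Q_pt_even: "u\<^sup>2 = 2 \<Longrightarrow> Q_pt u = Q_pt (sqrt 2)"
  using P_pt_even[of u] flip_P_pt[of u] flip_P_pt[of "sqrt 2"] by simp

text \<open>For \<open>u < 0 < v\<close> the two points may have equal \<open>H\<close>, but \<open>X\<close> has different signs there. In
  the other case they are the two poles, where \<open>X = 0\<close> and \<open>H\<close> differs.\<close>

lemma P_pt_distinct:
  assumes "u < 0 \<and> 0 < v \<and> u\<^sup>2 < 2 \<and> v\<^sup>2 < 2 \<or> u = 0 \<and> v = sqrt 2"
  shows "P_pt u \<noteq> P_pt v"
  using assms
proof
  assume uv: "u < 0 \<and> 0 < v \<and> u\<^sup>2 < 2 \<and> v\<^sup>2 < 2"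
  then have "X (P_pt u) < 0" "0 < X (P_pt v)"
    using ff_pos[of "u\<^sup>2"] ff_pos[of "v\<^sup>2"] by (simp_all add: X_P_pt mult_neg_pos)
  then show ?thesis by auto
next
  assume "u = 0 \<and> v = sqrt 2"
  then have "H (P_pt u) \<noteq> H (P_pt v)" by (simp add: H_P_pt)
  then show ?thesis by auto
qed

text \<open>At \<open>t = 0\<close> the coefficient of \<open>X\<close> vanishes, and the pole \<open>P_pt (sqrt 2)\<close> replaces the positive root.
  For \<open>t > 0\<close> the critical equation excludes this pole by itself.\<close>

lemma fixed_points_F:
  assumes \<gamma>: "0 < \<gamma>" and t: "t \<in> {0..1}"
    and u: "t = 0 \<Longrightarrow> u\<^sub>p = sqrt 2 \<and> u\<^sub>m = 0"
      "0 < t \<Longrightarrow> u\<^sub>m < 0 \<and> 0 < u\<^sub>p \<and> u\<^sub>m\<^sup>2 \<le> 2 \<and> u\<^sub>p\<^sup>2 \<le> 2"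
      "\<And>u. 0 < t \<Longrightarrow> u\<^sup>2 \<le> 2 \<Longrightarrow> critical (1 - 2 * t) (t * \<gamma>) u \<longleftrightarrow> u = u\<^sub>p \<or> u = u\<^sub>m"
  shows "{p. fixed_point (F \<gamma> t) p} =
      {ptA, ptB, ptC, ptD, P_pt u\<^sub>m, P_pt u\<^sub>p, Q_pt (- u\<^sub>p), Q_pt (- u\<^sub>m)}"
    and "card {p. fixed_point (F \<gamma> t) p} = 8"
proof -
  have nz: "1 - 2 * t \<noteq> 0 \<or> t * \<gamma> \<noteq> 0" using \<gamma> by (cases "t = 0") auto
  have rim: "v\<^sup>2 < 2" if v: "v\<^sup>2 \<le> 2" and e: "critical (1 - 2 * t) (t * \<gamma>) v" and "0 < t" for v
  proof (rule ccontr)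
    assume "\<not> v\<^sup>2 < 2"
    with v have v2: "v\<^sup>2 = 1 + 1" by simp
    \<comment> \<open>At \<open>v\<^sup>2 = 2\<close> the function \<open>ff\<close> vanishes and its derivative does not.\<close>
    have "ff (1 + 1) + (1 + 1) * deriv ff (1 + 1) = - 2 * 384" using ff_deriv_shifted[of 1] by simp
    moreover have "ff (1 + 1) = 0" by (simp add: ff_def)
    ultimately show False using e \<gamma> \<open>0 < t\<close> unfolding critical_def v2 by simp
  qed
  have sq: "u\<^sub>m\<^sup>2 \<le> 2" "u\<^sub>p\<^sup>2 \<le> 2" using u(1,2) t by (cases "t = 0"; simp)+
  show eq: "{p. fixed_point (F \<gamma> t) p} =
      {ptA, ptB, ptC, ptD, P_pt u\<^sub>m, P_pt u\<^sub>p, Q_pt (- u\<^sub>p), Q_pt (- u\<^sub>m)}"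
  proof (cases "t = 0")
    case True
    have PQ: "v\<^sup>2 < 2 \<and> critical 1 0 v \<longleftrightarrow> v = 0" "v\<^sup>2 < 2 \<and> critical (- 1) 0 v \<longleftrightarrow> v = 0" for v
      using ff_pos[of "v\<^sup>2"] by (auto simp: critical_def)
    have par: "1 - 2 * t = 1" "t * \<gamma> = 0" "u\<^sub>p = sqrt 2" "u\<^sub>m = 0" using True u(1) by simp_all
    have rim2: "Q_pt (- sqrt 2) = Q_pt (sqrt 2)" by (rule Q_pt_even) simp
    show ?thesis
      unfolding F_eq_JHX set_eq_iff mem_Collect_eq fixed_points_JHX[OF nz]
      unfolding par conj_assoc[symmetric] PQ
      by (auto simp: rim2)
  next
    case False
    then have t0: "0 < t" using t by simp
    have P: "v\<^sup>2 < 2 \<and> critical (1 - 2 * t) (t * \<gamma>) v \<longleftrightarrow> v = u\<^sub>m \<or> v = u\<^sub>p" for v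
      using rim[of v] u(3)[OF t0, of v] t0 sq by auto
    have Q: "v\<^sup>2 < 2 \<and> critical (- (1 - 2 * t)) (t * \<gamma>) v \<longleftrightarrow> v = - u\<^sub>m \<or> v = - u\<^sub>p" for v
      using P[of "- v"] critical_minus[of "1 - 2 * t" "t * \<gamma>" "- v"] by auto
    have "t * \<gamma> \<noteq> 0" using t0 \<gamma> by simp
    then show ?thesis
      unfolding F_eq_JHX set_eq_iff mem_Collect_eq fixed_points_JHX[OF nz] conj_assoc[symmetric] P Q
      by auto
  qed
  have lt: "0 < t \<Longrightarrow> u\<^sub>m\<^sup>2 < 2 \<and> u\<^sub>p\<^sup>2 < 2" using rim u(3) sq by blast
  have dP: "P_pt u\<^sub>m \<noteq> P_pt u\<^sub>p"
    using u(1,2) lt t by (intro P_pt_distinct) (cases "t = 0"; simp)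
  have fQ: "Q_pt (- u\<^sub>m) = flip_M (P_pt (- u\<^sub>m))" "Q_pt (- u\<^sub>p) = flip_M (P_pt (- u\<^sub>p))"
    using sq by (simp_all add: flip_P_pt)
  have "P_pt (- u\<^sub>m) \<noteq> P_pt (- u\<^sub>p)"
  proof (cases "t = 0")
    case True
    then show ?thesis using u(1) P_pt_even[of "- sqrt 2"] P_pt_distinct[of 0 "sqrt 2"] by simp
  next
    case False
    then show ?thesis using u(2) lt t P_pt_distinct[of "- u\<^sub>p" "- u\<^sub>m"] by auto
  qed
  then have dQ: "Q_pt (- u\<^sub>m) \<noteq> Q_pt (- u\<^sub>p)"
    unfolding fQ by (metis flip_M_flip_M)
  have JQ: "J (Q_pt (- u\<^sub>m)) = 3" "J (Q_pt (- u\<^sub>p)) = 3"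
    using sq by (simp_all add: fQ J_H_X_flip J_P_pt)
  have JP: "J (P_pt u\<^sub>m) = 0" "J (P_pt u\<^sub>p) = 0" using sq by (simp_all add: J_P_pt)
  have neq: "p \<noteq> q" if "J p \<noteq> J q \<or> H p \<noteq> H q" for p q using that by auto
  have "distinct [ptA, ptB, ptC, ptD, P_pt u\<^sub>m, P_pt u\<^sub>p, Q_pt (- u\<^sub>p), Q_pt (- u\<^sub>m)]"
    using dP dQ by (simp add: neq J_vertices H_vertices JP JQ)
  from distinct_card[OF this] show "card {p. fixed_point (F \<gamma> t) p} = 8"
    unfolding eq by simp
qed

theorem proposition4p8:
  fixes \<gamma> :: real
  assumes "0 < \<gamma>" and "\<gamma> < 1 / 48"
  shows "(\<exists>!u. u_solution \<gamma> u \<and> u 0 = 0) \<and>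
    (\<exists>!u. u_solution \<gamma> u \<and> u 0 = sqrt 2) \<and>
    (\<exists>!v. v_solution \<gamma> v \<and> v 0 = - sqrt 2) \<and>
    (\<exists>!v. v_solution \<gamma> v \<and> v 0 = 0) \<and>
    (\<forall>u\<^sub>m u\<^sub>p v\<^sub>m v\<^sub>p.
      u_solution \<gamma> u\<^sub>m \<and> u\<^sub>m 0 = 0 \<and>
      u_solution \<gamma> u\<^sub>p \<and> u\<^sub>p 0 = sqrt 2 \<and>
      v_solution \<gamma> v\<^sub>m \<and> v\<^sub>m 0 = - sqrt 2 \<and>
      v_solution \<gamma> v\<^sub>p \<and> v\<^sub>p 0 = 0 \<longrightarrow>
      (\<forall>t\<in>{0..1}.
        {p. fixed_point (F \<gamma> t) p} =
          {pt [sqrt 2, sqrt 6, sqrt 6, 2 * sqrt 2, 2, sqrt 2, 0, 0],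
           pt [sqrt 2, 0, 0, sqrt 2, 2, 2 * sqrt 2, sqrt 6, sqrt 6],
           pt [2, 2 * sqrt 2, sqrt 6, sqrt 6, sqrt 2, 0, 0, sqrt 2],
           pt [2, sqrt 2, 0, 0, sqrt 2, sqrt 6, sqrt 6, 2 * sqrt 2],
           P_pt (u\<^sub>m t), P_pt (u\<^sub>p t), Q_pt (v\<^sub>m t), Q_pt (v\<^sub>p t)} \<and>
        card {p. fixed_point (F \<gamma> t) p} = 8) \<and>
      P_pt (u\<^sub>m 0) = pt [0, 0, sqrt 2, sqrt 6, sqrt 6, 2 * sqrt 2, 2, sqrt 2] \<and>
      P_pt (u\<^sub>p 0) = pt [0, sqrt 2, 2, 2 * sqrt 2, sqrt 6, sqrt 6, sqrt 2, 0] \<and>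
      Q_pt (v\<^sub>m 0) = pt [sqrt 6, sqrt 6, sqrt 2, 0, 0, sqrt 2, 2, 2 * sqrt 2] \<and>
      Q_pt (v\<^sub>p 0) = pt [sqrt 6, 2 * sqrt 2, 2, sqrt 2, 0, 0, sqrt 2, sqrt 6])"
proof -
  obtain up um where up: "u_solution \<gamma> up" "up 0 = sqrt 2" and um: "u_solution \<gamma> um" "um 0 = 0"
    and sign: "\<forall>t\<in>{0<..1}. um t < 0 \<and> 0 < up t"
    and roots: "\<forall>t\<in>{0<..1}. \<forall>u. u\<^sup>2 \<le> 2 \<longrightarrow>
      (critical (1 - 2 * t) (t * \<gamma>) u \<longleftrightarrow> u = up t \<or> u = um t)"
    by (rule u_solutions_exist[OF assms(1)]) (rule that)
  note unique = u_solution_unique[OF up um sign roots]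
  have vext: "v = negate (negate v)" if "v_solution \<gamma> v" for v
    using that unfolding v_solution_iff by (intro negate_negate[symmetric]) (simp add: PiE_iff)
  have vp: "v = negate um" if "v_solution \<gamma> v" "v 0 = 0" for v
  proof -
    have "negate v 0 = 0" using that(2) by (simp add: negate_def)
    then have "negate v = um" by (rule unique(2)[OF u_solution_negate[OF that(1)]])
    with vext[OF that(1)] show ?thesis by metis
  qed
  have vm: "v = negate up" if "v_solution \<gamma> v" "v 0 = - sqrt 2" for v
  proof -
    have "negate v 0 = sqrt 2" using that(2) by (simp add: negate_def)
    then have "negate v = up" by (rule unique(1)[OF u_solution_negate[OF that(1)]])
    with vext[OF that(1)] show ?thesis by metis
  qed
  have ex: "\<exists>!u. u_solution \<gamma> u \<and> u 0 = 0" "\<exists>!u. u_solution \<gamma> u \<and> u 0 = sqrt 2"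
    "\<exists>!v. v_solution \<gamma> v \<and> v 0 = - sqrt 2" "\<exists>!v. v_solution \<gamma> v \<and> v 0 = 0"
  proof -
    show "\<exists>!u. u_solution \<gamma> u \<and> u 0 = 0"
      using um unique(2) by blast
    show "\<exists>!u. u_solution \<gamma> u \<and> u 0 = sqrt 2"
      using up unique(1) by blast
    have "negate up 0 = - sqrt 2" "negate um 0 = 0"
      using up um by (simp_all add: negate_def)
    then show "\<exists>!v. v_solution \<gamma> v \<and> v 0 = - sqrt 2" "\<exists>!v. v_solution \<gamma> v \<and> v 0 = 0"
      using v_solution_negate up(1) um(1) vm vp by blast+
  qed
  have sq: "(u t)\<^sup>2 \<le> 2" if "u_solution \<gamma> u" "t \<in> {0..1}" for u t
    using that abs_le_sqrt2_iff[of "u t"] unfolding u_solution_iff by (auto simp: PiE_iff)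
  have main: "{p. fixed_point (F \<gamma> t) p} =
      {ptA, ptB, ptC, ptD, P_pt (um t), P_pt (up t), Q_pt (negate up t), Q_pt (negate um t)}"
    "card {p. fixed_point (F \<gamma> t) p} = 8" if t: "t \<in> {0..1}" for t
  proof -
    have n: "negate up t = - up t" "negate um t = - um t" using t by (simp_all add: negate_def)
    have 1: "t = 0 \<Longrightarrow> up t = sqrt 2 \<and> um t = 0" using up um by simp
    have 2: "0 < t \<Longrightarrow> um t < 0 \<and> 0 < up t \<and> (um t)\<^sup>2 \<le> 2 \<and> (up t)\<^sup>2 \<le> 2"
      using bspec[OF sign, of t] sq[OF up(1) t] sq[OF um(1) t] t by simp
    have 3: "0 < t \<Longrightarrow> u\<^sup>2 \<le> 2 \<Longrightarrow> critical (1 - 2 * t) (t * \<gamma>) u \<longleftrightarrow> u = up t \<or> u = um t" for u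
      using bspec[OF roots, of t] t by simp
    show "{p. fixed_point (F \<gamma> t) p} =
        {ptA, ptB, ptC, ptD, P_pt (um t), P_pt (up t), Q_pt (negate up t), Q_pt (negate um t)}"
      unfolding n by (rule fixed_points_F(1)[OF assms(1) t 1 2 3])
    show "card {p. fixed_point (F \<gamma> t) p} = 8"
      by (rule fixed_points_F(2)[OF assms(1) t 1 2 3])
  qed
  have start: "P_pt 0 = pt [0, 0, sqrt 2, sqrt 6, sqrt 6, 2 * sqrt 2, 2, sqrt 2]"
    "P_pt (sqrt 2) = pt [0, sqrt 2, 2, 2 * sqrt 2, sqrt 6, sqrt 6, sqrt 2, 0]"
    "Q_pt (- sqrt 2) = pt [sqrt 6, sqrt 6, sqrt 2, 0, 0, sqrt 2, 2, 2 * sqrt 2]"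
    "Q_pt 0 = pt [sqrt 6, 2 * sqrt 2, 2, sqrt 2, 0, 0, sqrt 2, sqrt 6]"
    by (simp_all add: Q_pt_even[of "- sqrt 2"]) (simp_all add: P_pt_def Q_pt_def sqrt_multiples)
  show ?thesis
  proof (rule conjI[OF ex(1)], rule conjI[OF ex(2)], rule conjI[OF ex(3)], rule conjI[OF ex(4)],
      intro allI impI)
    fix u\<^sub>m u\<^sub>p v\<^sub>m v\<^sub>p
    assume sol: "u_solution \<gamma> u\<^sub>m \<and> u\<^sub>m 0 = 0 \<and> u_solution \<gamma> u\<^sub>p \<and> u\<^sub>p 0 = sqrt 2 \<and>
      v_solution \<gamma> v\<^sub>m \<and> v\<^sub>m 0 = - sqrt 2 \<and> v_solution \<gamma> v\<^sub>p \<and> v\<^sub>p 0 = 0"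
    have eqs: "u\<^sub>m = um" "u\<^sub>p = up" "v\<^sub>m = negate up" "v\<^sub>p = negate um"
      using sol by (blast intro: unique vm vp)+
    have start': "um 0 = 0" "up 0 = sqrt 2" "negate up 0 = - sqrt 2" "negate um 0 = 0"
      using sol unfolding eqs by blast+
    show "(\<forall>t\<in>{0..1}.
        {p. fixed_point (F \<gamma> t) p} =
          {ptA, ptB, ptC, ptD, P_pt (u\<^sub>m t), P_pt (u\<^sub>p t), Q_pt (v\<^sub>m t), Q_pt (v\<^sub>p t)} \<and>
        card {p. fixed_point (F \<gamma> t) p} = 8) \<and>
      P_pt (u\<^sub>m 0) = pt [0, 0, sqrt 2, sqrt 6, sqrt 6, 2 * sqrt 2, 2, sqrt 2] \<and>
      P_pt (u\<^sub>p 0) = pt [0, sqrt 2, 2, 2 * sqrt 2, sqrt 6, sqrt 6, sqrt 2, 0] \<and>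
      Q_pt (v\<^sub>m 0) = pt [sqrt 6, sqrt 6, sqrt 2, 0, 0, sqrt 2, 2, 2 * sqrt 2] \<and>
      Q_pt (v\<^sub>p 0) = pt [sqrt 6, 2 * sqrt 2, 2, sqrt 2, 0, 0, sqrt 2, sqrt 6]"
      unfolding eqs start' using main by (intro conjI ballI start)
  qed
qed

end
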